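(* Let $S^n\subset\mathbb{E}^{n+1}$ be a piecewise flat manifold with a dual tessellation into vertex regions $V_v$, and let $h$ be a hinge with associated hinge region $V_h$. The average curvature component orthogonal to $h$ over the region $V_h$ is $$\alpha_h := \widetilde\alpha(\hat\gamma_h^\perp)_{V_h} = \frac{1}{|V_h|}\left(|h|\,\epsilon_h + \sum_i |h_i\cap V_h|\,\cos^2\theta_i\,\epsilon_i + O(\epsilon_i^3)\right),$$ where the sum is taken over the other hinges $h_i$ intersecting $V_h$, $\epsilon_i$ is the hinge angle at $h_i$, and $\theta_i$ is the angle between $\gamma_h^\perp$ and the lines orthogonal to the hinge $h_i$.
   Context: **Piecewise flat manifolds.** $\mathbb{E}^k$ is Euclidean $k$-space. A piecewise flat manifold $S^n$ is a manifold that is a homogeneous simplicial $n$-complex formed from Euclidean $n$-simplices glued along their $(n-1)$-faces with consistent metrics; here it is embedded in $\mathbb{E}^{n+1}$ piecewise-linearly so that each simplex is flat. Simplices are open; $\bar\sigma$ is the closure of $\sigma$; the star of a simplex is the union of all simplices whose closure contains it. $|\cdot|$ denotes volume of the appropriate dimension. **Hinges and hinge angles.** A hinge $h$ is an $(n-1)$-simplex of $S^n$; it separates two $n$-simplices. With a given orientation (choice of positive normal $\hat n$), the hinge angle is $\epsilon_h := \pi/2-\phi$, where $\phi$ is the angle between the positive normal to one of the two $n$-simplices and the inward-directed vector tangent to the other $n$-simplex and orthogonal to $h$. **Vertex regions.** A dual tessellation is a decomposition of $S^n$ into $n$-dimensional regions $V_v$, one for each vertex $v$, such that: (1) $v\in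 V_v$ and no other vertex is in $V_v$; (2) the $V_v$ form a complete tessellation of $S^n$: $|S^n|=\sum_v|V_v|$ and $V_{v_i}\cap V_{v_j}=\emptyset$ for $i\neq j$; (3) only hinges in the star of $v$ intersect $V_v$. **Hinge regions.** $V_h$ is the intersection of $\bigcup_{v\in\bar h}V_v$ with the union of the geodesic extensions $\gamma_h^\perp$ of all lines in $S^n$ orthogonal to $h$ through points of $h$; $\hat\gamma_h^\perp$ is the unit tangent field to these lines. $V_h$ contains all of $h$. **Curvature integrals.** For a geodesic segment $\gamma:[0,1]\to S^n$ (straight in each $n$-simplex and straight across hinges after unfolding) crossing a single hinge, the integral $a_\gamma=\int_\gamma\alpha(\hat\gamma)\,\mathrm{d}s$ of the second fundamental form $\alpha(\hat\gamma):=\alpha(\hat\gamma,\hat\gamma)$ is the signed angle in $\mathbb{E}^{n+1}$ between its initial and final unit tangents $\hat\gamma_0,\hat\gamma_1$, positive if the normal component of $\hat\gamma_1-\hat\gamma_0$ is in the positive $\hat n$ direction and negative otherwise; for a segment crossing several hinges, $a_\gamma$ is the sum of the contributions of the individual hinges. The integral $\int_{V_h}\alpha(\hat\gamma_h^\perp)\,\mathrm{d}V^n$ is the integral over $h$, with respect to $(n-1)$-volume, of $a_\gamma$ for the segments $\gamma=\gamma_h^\perp\cap V_h$, and the average $\widetilde\alpha(\hat\gamma_h^\perp)_{V_h}$ is this integral divided by $|V_h|$. The asymptotics are for small hinge angles $\epsilon_i$.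
   Formalization: The angle φ in ε = π/2 − φ is taken as an oriented angle where the two n-simplices meet acutely, so nearly folded hinges do not count as having small hinge angle; with the unoriented angle the formula fails there (e.g. the apex of a thin triangle). *)

theory Defs
  imports "HOL-Analysis.Analysis"
begin

definition dirs :: "'a::euclidean_space set \<Rightarrow> 'a set" where
  "dirs A = span {x - y | x y. x \<in> A \<and> y \<in> A}"

definition vangle :: "'a::real_inner \<Rightarrow> 'a \<Rightarrow> real" where
  "vangle u v = arccos (u \<bullet> v / (norm u * norm v))"

text \<open>
  Volume of dimension \<open>dim (dirs A)\<close> on the affine hull of \<open>A\<close>: the image of the product
  Lebesgue measure under orthonormal coordinates.  This repeats the construction of
  \<open>lborel\<close> with an orthonormal basis of the direction space in place of \<open>Basis\<close>; the
  result does not depend on the chosen origin and frame.  In dimension 0 it is the unit point mass.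
\<close>
definition flat_measure :: "'a::euclidean_space set \<Rightarrow> 'a measure" where
  "flat_measure A =
     (let p = (SOME p. p \<in> A);
          B = (SOME B. B \<subseteq> dirs A \<and> pairwise orthogonal B \<and> (\<forall>b\<in>B. norm b = 1) \<and> span B = dirs A)
      in distr (\<Pi>\<^sub>M b\<in>B. lborel) borel (\<lambda>c. p + (\<Sum>b\<in>B. c b *\<^sub>R b)))"

text \<open>
  A complex is given by its closed simplices; the open simplex belonging to \<open>s\<close> is
  \<open>rel_interior s\<close>.  The simplices lie in the ambient Euclidean space, so the complex is
  piecewise linearly embedded by construction.  In contrast to \<open>simplicial_complex\<close> only
  local finiteness is required, so that non-compact manifolds are included.
\<close>

definition top_simplices :: "nat \<Rightarrow> 'a::euclidean_space set set \<Rightarrow> 'a set set" where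
  "top_simplices n K = {\<sigma> \<in> K. int n simplex \<sigma>}"

definition hinges :: "nat \<Rightarrow> 'a::euclidean_space set set \<Rightarrow> 'a set set" where
  "hinges n K = {f \<in> K. (int n - 1) simplex f}"

definition vertices :: "'a set set \<Rightarrow> 'a set" where
  "vertices K = {v. {v} \<in> K}"

definition star :: "'a::euclidean_space set set \<Rightarrow> 'a set \<Rightarrow> 'a set" where
  "star K s = \<Union> {rel_interior t | t. t \<in> K \<and> s \<subseteq> t}"

definition locally_finite_complex :: "'a::euclidean_space set set \<Rightarrow> bool" where
  "locally_finite_complex K \<longleftrightarrow>
     (\<forall>s\<in>K. \<exists>k. k simplex s) \<and>
     (\<forall>s\<in>K. \<forall>f. f face_of s \<longrightarrow> f \<in> K) \<and>
     (\<forall>s\<in>K. \<forall>t\<in>K. (s \<inter> t) face_of s) \<and>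
     (\<forall>x\<in>\<Union>K. \<exists>e>0. finite {s \<in> K. s \<inter> ball x e \<noteq> {}})"

text \<open>
  The last clause (a hinge separates two \<open>n\<close>-simplices) is a consequence of the others;
  it is listed because it is part of what is meant by a hinge.
\<close>
definition piecewise_flat_manifold :: "nat \<Rightarrow> 'a::euclidean_space set set \<Rightarrow> bool" where
  "piecewise_flat_manifold n K \<longleftrightarrow>
     locally_finite_complex K \<and>
     (\<forall>s\<in>K. \<exists>\<sigma>\<in>top_simplices n K. s \<subseteq> \<sigma>) \<and>
     (\<forall>p\<in>\<Union>K. \<exists>U T. openin (top_of_set (\<Union>K)) U \<and> p \<in> U \<and>
        subspace (T :: 'a set) \<and> dim T = n \<and> U homeomorphic T) \<and>
     (\<forall>f\<in>hinges n K. card {\<sigma> \<in> top_simplices n K. f \<subseteq> \<sigma>} = 2)"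

definition surface_volume :: "nat \<Rightarrow> 'a::euclidean_space set set \<Rightarrow> 'a set \<Rightarrow> ennreal" where
  "surface_volume n K A = (\<Sum>\<^sub>\<infinity>\<sigma>\<in>top_simplices n K. emeasure (flat_measure \<sigma>) (A \<inter> \<sigma>))"

definition conormal :: "'a::euclidean_space set \<Rightarrow> 'a set \<Rightarrow> 'a" where
  "conormal \<sigma> f = (SOME m. norm m = 1 \<and> m \<in> dirs \<sigma> \<and> (\<forall>w\<in>dirs f. w \<bullet> m = 0) \<and>
     (\<forall>x\<in>f. \<forall>y\<in>\<sigma>. 0 \<le> m \<bullet> (y - x)))"

definition adjacent_at :: "nat \<Rightarrow> 'a::euclidean_space set set \<Rightarrow> 'a set \<Rightarrow> 'a set \<Rightarrow> 'a set \<Rightarrow> bool" where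
  "adjacent_at n K f \<sigma> \<tau> \<longleftrightarrow> f \<in> hinges n K \<and> \<sigma> \<in> top_simplices n K \<and> \<tau> \<in> top_simplices n K \<and>
     \<sigma> \<noteq> \<tau> \<and> f \<subseteq> \<sigma> \<and> f \<subseteq> \<tau>"

text \<open>
  Consistency across a hinge: in the plane orthogonal to \<open>f\<close>, the rotation that takes the
  direction \<open>- conormal \<sigma> f\<close> (leaving \<open>\<sigma>\<close>) to \<open>conormal \<tau> f\<close> (entering \<open>\<tau>\<close>) takes the
  positive normal of \<open>\<sigma>\<close> to that of \<open>\<tau>\<close>.
\<close>
definition positive_normals :: "nat \<Rightarrow> 'a::euclidean_space set set \<Rightarrow> ('a set \<Rightarrow> 'a) \<Rightarrow> bool" where
  "positive_normals n K \<nu> \<longleftrightarrow>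
     (\<forall>\<sigma>\<in>top_simplices n K. norm (\<nu> \<sigma>) = 1 \<and> (\<forall>w\<in>dirs \<sigma>. w \<bullet> \<nu> \<sigma> = 0)) \<and>
     (\<forall>f \<sigma> \<tau>. adjacent_at n K f \<sigma> \<tau> \<longrightarrow>
        \<nu> \<tau> = (conormal \<tau> f \<bullet> \<nu> \<sigma>) *\<^sub>R conormal \<sigma> f - (conormal \<sigma> f \<bullet> conormal \<tau> f) *\<^sub>R \<nu> \<sigma>)"

text \<open>
  The angle between the positive normal of \<open>\<sigma>\<close> and the inward vector of \<open>\<tau>\<close>.  It is measured
  as an oriented angle with values between \<open>- pi/2\<close> and \<open>3 * pi/2\<close>: the last two cases concern
  only hinges at which the two simplices form an acute angle.  There the unoriented angle would not
  distinguish an almost flat hinge from an almost completely folded one.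
\<close>
definition normal_inward_angle :: "('a::euclidean_space set \<Rightarrow> 'a) \<Rightarrow> 'a set \<Rightarrow> 'a set \<Rightarrow> 'a set \<Rightarrow> real" where
  "normal_inward_angle \<nu> f \<sigma> \<tau> =
     (if conormal \<sigma> f \<bullet> conormal \<tau> f \<le> 0 then vangle (\<nu> \<sigma>) (conormal \<tau> f)
      else if 0 \<le> \<nu> \<sigma> \<bullet> conormal \<tau> f then - vangle (\<nu> \<sigma>) (conormal \<tau> f)
      else 2 * pi - vangle (\<nu> \<sigma>) (conormal \<tau> f))"

text \<open>For consistent normals the value does not depend on the order of the two simplices.\<close>
definition hinge_angle :: "nat \<Rightarrow> 'a::euclidean_space set set \<Rightarrow> ('a set \<Rightarrow> 'a) \<Rightarrow> 'a set \<Rightarrow> real" where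
  "hinge_angle n K \<nu> f =
     (let (\<sigma>, \<tau>) = (SOME (\<sigma>, \<tau>). adjacent_at n K f \<sigma> \<tau>) in pi / 2 - normal_inward_angle \<nu> f \<sigma> \<tau>)"

definition dual_tessellation :: "nat \<Rightarrow> 'a::euclidean_space set set \<Rightarrow> ('a \<Rightarrow> 'a set) \<Rightarrow> bool" where
  "dual_tessellation n K V \<longleftrightarrow>
     (\<forall>v\<in>vertices K. V v \<in> sets borel \<and> V v \<subseteq> \<Union>K) \<and>
     (\<forall>v\<in>vertices K. \<forall>w\<in>vertices K. w \<in> V v \<longleftrightarrow> w = v) \<and>
     surface_volume n K (\<Union>K) = (\<Sum>\<^sub>\<infinity>v\<in>vertices K. surface_volume n K (V v)) \<and>
     disjoint_family_on V (vertices K) \<and>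
     (\<forall>v\<in>vertices K. \<forall>f\<in>hinges n K. rel_interior f \<inter> V v \<noteq> {} \<longrightarrow> rel_interior f \<subseteq> star K {v})"

definition vertex_regions_of :: "'a::euclidean_space set set \<Rightarrow> ('a \<Rightarrow> 'a set) \<Rightarrow> 'a set \<Rightarrow> 'a set" where
  "vertex_regions_of K V h = (\<Union>v \<in> h \<inter> vertices K. V v)"

definition straight_at :: "nat \<Rightarrow> 'a::euclidean_space set set \<Rightarrow> (real \<Rightarrow> 'a) \<Rightarrow> real \<Rightarrow> bool" where
  "straight_at n K \<gamma> t \<longleftrightarrow>
     (\<exists>\<sigma>\<in>top_simplices n K. \<exists>u\<in>dirs \<sigma>. norm u = 1 \<and> \<gamma> t \<in> rel_interior \<sigma> \<and>
        (\<forall>\<^sub>F s in at t. \<gamma> s = \<gamma> t + (s - t) *\<^sub>R u))"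

text \<open>
  Crossing the hinge \<open>f\<close> from \<open>\<sigma>\<close> to \<open>\<tau>\<close> at unit speed.  Unfolding \<open>\<tau>\<close> about \<open>f\<close> fixes
  the component \<open>w\<close> along \<open>f\<close> and identifies \<open>conormal \<tau> f\<close> with \<open>- conormal \<sigma> f\<close>, so the
  path is straight after unfolding iff \<open>w\<close> and the orthogonal speed \<open>c\<close> agree on both sides.
\<close>
definition crosses_at :: "nat \<Rightarrow> 'a::euclidean_space set set \<Rightarrow> (real \<Rightarrow> 'a) \<Rightarrow> real \<Rightarrow>
    'a set \<Rightarrow> 'a set \<Rightarrow> 'a set \<Rightarrow> real \<Rightarrow> 'a \<Rightarrow> bool" where
  "crosses_at n K \<gamma> t f \<sigma> \<tau> c w \<longleftrightarrow>
     adjacent_at n K f \<sigma> \<tau> \<and> \<gamma> t \<in> rel_interior f \<and> 0 < c \<and> w \<in> dirs f \<and> c\<^sup>2 + (norm w)\<^sup>2 = 1 \<and>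
     (\<forall>\<^sub>F s in at_left t. \<gamma> s = \<gamma> t + (s - t) *\<^sub>R (w - c *\<^sub>R conormal \<sigma> f)) \<and>
     (\<forall>\<^sub>F s in at_right t. \<gamma> s = \<gamma> t + (s - t) *\<^sub>R (w + c *\<^sub>R conormal \<tau> f))"

text \<open>Such a path necessarily avoids all simplices of codimension greater than one.\<close>
definition geodesic_in :: "nat \<Rightarrow> 'a::euclidean_space set set \<Rightarrow> 'a set \<Rightarrow> real set \<Rightarrow> (real \<Rightarrow> 'a) \<Rightarrow> bool" where
  "geodesic_in n K W I \<gamma> \<longleftrightarrow> open I \<and> is_interval I \<and> \<gamma> ` I \<subseteq> W \<and>
     (\<forall>t\<in>I. straight_at n K \<gamma> t \<or> (\<exists>f \<sigma> \<tau> c w. crosses_at n K \<gamma> t f \<sigma> \<tau> c w))"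

text \<open>
  The geodesic extension of the line orthogonal to \<open>h\<close> through \<open>x\<close> (orthogonality is
  \<open>c = 1\<close>, \<open>w = 0\<close>), extended as far as possible inside the union of the stars of the vertices
  of \<open>h\<close>.  Extending it without this restriction would let it return to the vicinity of \<open>h\<close>
  after travelling around the manifold.
\<close>
definition orthogonal_geodesic :: "nat \<Rightarrow> 'a::euclidean_space set set \<Rightarrow> 'a set \<Rightarrow> 'a \<Rightarrow>
    (real \<Rightarrow> 'a) \<Rightarrow> real set \<Rightarrow> bool" where
  "orthogonal_geodesic n K h x \<gamma> I \<longleftrightarrow>
     (let W = (\<Union>v \<in> h \<inter> vertices K. star K {v}) in
        0 \<in> I \<and> \<gamma> 0 = x \<and> geodesic_in n K W I \<gamma> \<and> (\<exists>\<sigma> \<tau>. crosses_at n K \<gamma> 0 h \<sigma> \<tau> 1 0) \<and>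
        (\<forall>\<gamma>' J. geodesic_in n K W J \<gamma>' \<and> I \<subseteq> J \<and> (\<forall>t\<in>I. \<gamma>' t = \<gamma> t) \<longrightarrow> J = I))"

definition hinge_region :: "'a::euclidean_space set set \<Rightarrow> ('a \<Rightarrow> 'a set) \<Rightarrow> 'a set \<Rightarrow>
    ('a \<Rightarrow> real \<Rightarrow> 'a) \<Rightarrow> ('a \<Rightarrow> real set) \<Rightarrow> 'a set" where
  "hinge_region K V h \<gamma> I = vertex_regions_of K V h \<inter> (\<Union>x\<in>rel_interior h. \<gamma> x ` I x)"

text \<open>
  \<open>\<gamma> x\<close>, defined on \<open>I x\<close>, is the geodesic extension of the line orthogonal to \<open>h\<close> through
  \<open>x\<close>; its part in the hinge region is a segment, and the hinge region contains \<open>h\<close>.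
\<close>
definition orthogonal_lines :: "nat \<Rightarrow> 'a::euclidean_space set set \<Rightarrow> ('a \<Rightarrow> 'a set) \<Rightarrow> 'a set \<Rightarrow>
    ('a \<Rightarrow> real \<Rightarrow> 'a) \<Rightarrow> ('a \<Rightarrow> real set) \<Rightarrow> bool" where
  "orthogonal_lines n K V h \<gamma> I \<longleftrightarrow>
     (\<forall>x\<in>rel_interior h. orthogonal_geodesic n K h x (\<gamma> x) (I x) \<and>
        is_interval {t \<in> I x. \<gamma> x t \<in> hinge_region K V h \<gamma> I}) \<and>
     rel_interior h \<subseteq> hinge_region K V h \<gamma> I"

definition hinges_meeting :: "nat \<Rightarrow> 'a::euclidean_space set set \<Rightarrow> 'a set \<Rightarrow> 'a set set" where
  "hinges_meeting n K A = {f \<in> hinges n K. rel_interior f \<inter> A \<noteq> {}}"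

definition crossing_times :: "nat \<Rightarrow> 'a::euclidean_space set set \<Rightarrow> 'a set \<Rightarrow> (real \<Rightarrow> 'a) \<Rightarrow> real set \<Rightarrow> real set" where
  "crossing_times n K A \<gamma> I = {t \<in> I. \<gamma> t \<in> A \<and> (\<exists>f\<in>hinges n K. \<gamma> t \<in> rel_interior f)}"

text \<open>
  The contribution of a single crossing.  The sign refers to the positive normal on the incoming
  side; the positive normal on the outgoing side gives the same sign.
\<close>
definition turning_angle :: "nat \<Rightarrow> 'a::euclidean_space set set \<Rightarrow> ('a set \<Rightarrow> 'a) \<Rightarrow> (real \<Rightarrow> 'a) \<Rightarrow> real \<Rightarrow> real" where
  "turning_angle n K \<nu> \<gamma> t =
     (let u0 = vector_derivative \<gamma> (at_left t);
          u1 = vector_derivative \<gamma> (at_right t);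
          \<sigma> = (SOME \<sigma>. \<sigma> \<in> top_simplices n K \<and> (\<forall>\<^sub>F s in at_left t. \<gamma> s \<in> rel_interior \<sigma>))
      in if 0 < (u1 - u0) \<bullet> \<nu> \<sigma> then vangle u0 u1 else - vangle u0 u1)"

definition segment_curvature :: "nat \<Rightarrow> 'a::euclidean_space set set \<Rightarrow> ('a set \<Rightarrow> 'a) \<Rightarrow> 'a set \<Rightarrow>
    (real \<Rightarrow> 'a) \<Rightarrow> real set \<Rightarrow> real" where
  "segment_curvature n K \<nu> A \<gamma> I = (\<Sum>t\<in>crossing_times n K A \<gamma> I. turning_angle n K \<nu> \<gamma> t)"

definition average_curvature :: "nat \<Rightarrow> 'a::euclidean_space set set \<Rightarrow> ('a set \<Rightarrow> 'a) \<Rightarrow> ('a \<Rightarrow> 'a set) \<Rightarrow>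
    'a set \<Rightarrow> ('a \<Rightarrow> real \<Rightarrow> 'a) \<Rightarrow> ('a \<Rightarrow> real set) \<Rightarrow> real" where
  "average_curvature n K \<nu> V h \<gamma> I =
     (let A = hinge_region K V h \<gamma> I in
       (LINT x:rel_interior h|flat_measure h. segment_curvature n K \<nu> A (\<gamma> x) (I x))
         / enn2real (surface_volume n K A))"

text \<open>
  \<open>\<theta>\<close> is an angle at which one of the lines crosses \<open>f\<close> inside the hinge region.  In dimension
  at least three, lines passing a simplex of codimension two on different sides may cross the same
  hinge at slightly different angles; every value that occurs is admitted.
\<close>
definition crossing_angle :: "nat \<Rightarrow> 'a::euclidean_space set set \<Rightarrow> ('a \<Rightarrow> 'a set) \<Rightarrow> 'a set \<Rightarrow>
    ('a \<Rightarrow> real \<Rightarrow> 'a) \<Rightarrow> ('a \<Rightarrow> real set) \<Rightarrow> 'a set \<Rightarrow> real \<Rightarrow> bool" where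
  "crossing_angle n K V h \<gamma> I f \<theta> \<longleftrightarrow>
     (\<exists>x\<in>rel_interior h. \<exists>t\<in>I x. \<gamma> x t \<in> hinge_region K V h \<gamma> I \<and>
        (\<exists>\<sigma> \<tau> c w. crosses_at n K (\<gamma> x) t f \<sigma> \<tau> c w \<and>
           \<theta> = vangle (vector_derivative (\<gamma> x) (at_left t)) (- conormal \<sigma> f)))"

text \<open>
  The quantities on which the implied constant of the cubic error term depends: the number of
  hinges meeting the region, the number of hinge crossings of each segment, and the diameter.
\<close>
definition region_bounded_by :: "nat \<Rightarrow> 'a::euclidean_space set set \<Rightarrow> 'a set \<Rightarrow> 'a set \<Rightarrow>
    ('a \<Rightarrow> real \<Rightarrow> 'a) \<Rightarrow> ('a \<Rightarrow> real set) \<Rightarrow> nat \<Rightarrow> real \<Rightarrow> bool" where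
  "region_bounded_by n K A h \<gamma> I N D \<longleftrightarrow>
     finite (hinges_meeting n K A) \<and> card (hinges_meeting n K A) \<le> N \<and>
     (\<forall>x\<in>rel_interior h. finite (crossing_times n K A (\<gamma> x) (I x)) \<and>
        card (crossing_times n K A (\<gamma> x) (I x)) \<le> N) \<and>
     (\<forall>p\<in>A. \<forall>q\<in>A. dist p q \<le> D)"

end

theory Submission
  imports Defs
begin

text \<open>
  Fix \<open>h\<close> and let \<open>e\<close> bound the hinge angles. A line orthogonal to \<open>h\<close> is determined, up to its starting
  point, by its itinerary, the list of hinges that it crosses. For a fixed itinerary the directions are
  constant, the starting points form a convex set, and the map from the starting point to the last
  crossing point is affine and multiplies volumes by \<open>1 / c\<close>, where \<open>c\<close> is the cosine of the crossing
  angle; the last crossing turns the line by \<open>c \<epsilon> + O(\<epsilon>\<^sup>3)\<close>. So an itinerary that ends at \<open>f\<close> contributes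
  \<open>c\<^sup>2 \<epsilon>\<^sub>f\<close> times the volume of its crossing points, up to \<open>O(e\<^sup>3)\<close>.

  It remains to compare itineraries that end at the same hinge \<open>f\<close>. All normals met on the way are
  \<open>O(e)\<close>-close to a fixed one, and a bend changes the direction along such a normal up to \<open>O(e\<^sup>2)\<close>; hence
  the directions, projected along the fixed normal, agree up to \<open>O(e\<^sup>2)\<close>, and so do the cosines \<open>c\<close>.
  Unless \<open>c = O(e\<^sup>2)\<close>, when everything at \<open>f\<close> is negligible, no line crosses \<open>f\<close> twice, so that different
  itineraries have disjoint convex sets of starting points. Two lines that meet in \<open>f\<close> start at distance
  \<open>O(e\<^sup>2)\<close>, hence within a slab of width \<open>O(e\<^sup>2)\<close> along a hyperplane separating these sets. Therefore the crossing
  points of the itineraries cover \<open>f \<inter> V\<^sub>h\<close> with overlaps of volume \<open>O(e\<^sup>2)\<close>.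
\<close>

section \<open>Volume in flat subspaces\<close>

text \<open>Obstacle: the paths \<open>\<gamma> x\<close> are known only through local conditions.
  Nothing is assumed about measurability in \<open>x\<close>, and each of them may run through
  \<open>h\<close> in either orientation. Therefore position, direction and time of a crossing are
  computed from the itinerary alone, and maximality of the path is used to show that it follows
  every itinerary that can be followed. The sets of starting points then do not mention the paths at
  all, and the integrand becomes a finite sum of indicators of Borel sets. The volume formula needs
  a preparation: \<open>flat_measure\<close> chooses an origin and a frame, so independence of that
  choice comes before any change of variables. A cosine \<open>c\<close> may be arbitrarily small,
  so nothing is ever divided by it. What is shown to be O(e^2) is \<open>c\<close> times the volume
  of an overlap inside \<open>f\<close>; this suffices, because one of the two factors in
  \<open>c\<^sup>2\<close> is still available. Uniformity in the complex comes from counting: errors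
  accumulate over at most \<open>N\<close> crossings, and there are at most twice as many
  itineraries as lists of length at most \<open>N\<close> over \<open>N\<close> letters.\<close>

definition frame :: "'i set \<Rightarrow> ('i \<Rightarrow> 'a::euclidean_space) \<Rightarrow> bool" where
  "frame I e \<longleftrightarrow> finite I \<and> (\<forall>i\<in>I. \<forall>j\<in>I. e i \<bullet> e j = (if i = j then 1 else 0))"

text \<open>Arbitrary families of vectors are allowed, because the Jacobian computation passes
  through orthogonal families stretched by factors \<open>a i\<close>.\<close>

definition frame_measure :: "'i set \<Rightarrow> ('i \<Rightarrow> 'a::euclidean_space) \<Rightarrow> 'a \<Rightarrow> 'a measure" where
  "frame_measure I e p = distr (\<Pi>\<^sub>M i\<in>I. lborel) borel (\<lambda>c. p + (\<Sum>i\<in>I. c i *\<^sub>R e i))"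

text \<open>The rescaled image measure agrees with the product measure on boxes, by the
  one-dimensional formula in each coordinate, and boxes determine a product of sigma-finite
  measures.\<close>

lemma PiM_lborel_affine:
  fixes a v :: "'i \<Rightarrow> real"
  assumes I: "finite I" and a: "\<And>i. i \<in> I \<Longrightarrow> a i \<noteq> 0" and G: "G \<in> sets (\<Pi>\<^sub>M i\<in>I. lborel)"
  shows "ennreal (\<Prod>i\<in>I. \<bar>a i\<bar>) *
      emeasure (\<Pi>\<^sub>M i\<in>I. lborel) ((\<lambda>c. \<lambda>i\<in>I. v i + a i * c i) -` G \<inter> space (\<Pi>\<^sub>M i\<in>I. lborel))
    = emeasure (\<Pi>\<^sub>M i\<in>I. lborel) G"
proof -
  interpret product_sigma_finite "\<lambda>_::'i. lborel :: real measure" ..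
  let ?M = "\<Pi>\<^sub>M i\<in>I. (lborel :: real measure)"
  let ?T = "\<lambda>c. \<lambda>i\<in>I. v i + a i * c i"
  have T: "?T \<in> measurable ?M ?M"
    by measurable
  define P where "P = scale_measure (ennreal (\<Prod>i\<in>I. \<bar>a i\<bar>)) (distr ?M ?M ?T)"
  have eP: "emeasure P X = ennreal (\<Prod>i\<in>I. \<bar>a i\<bar>) * emeasure ?M (?T -` X \<inter> space ?M)"
    if "X \<in> sets ?M" for X
    unfolding P_def using T that by (simp add: emeasure_distr)
  have "P = ?M"
  proof (rule PiM_eqI[OF I])
    show "sets P = sets ?M" by (simp add: P_def)
    fix A :: "'i \<Rightarrow> real set" assume A: "\<And>i. i \<in> I \<Longrightarrow> A i \<in> sets lborel"
    have "?T -` PiE I A \<inter> space ?M = PiE I (\<lambda>i. (\<lambda>x. v i + a i * x) -` A i)"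
      by (auto simp: space_PiM PiE_def Pi_def extensional_def)
    moreover have m: "(\<lambda>x. v i + a i * x) -` A i \<in> sets lborel" if "i \<in> I" for i
    proof -
      have "(\<lambda>x. v i + a i * x) -` A i \<inter> space borel \<in> sets borel"
        using A[OF that] by (intro measurable_sets) auto
      then show ?thesis by simp
    qed
    moreover have "emeasure lborel (A i) = ennreal \<bar>a i\<bar> * emeasure lborel ((\<lambda>x. v i + a i * x) -` A i)"
      if "i \<in> I" for i
    proof -
      have Ai: "A i \<in> sets borel" using A[OF that] by simp
      have "emeasure lborel (A i) = emeasure (density (distr lborel borel (\<lambda>x. v i + a i * x)) (\<lambda>_. ennreal \<bar>a i\<bar>)) (A i)"
        using lborel_real_affine[OF a[OF that], of "v i"] by simp
      also have "\<dots> = ennreal \<bar>a i\<bar> * emeasure (distr lborel borel (\<lambda>x. v i + a i * x)) (A i)"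
        using Ai by (subst emeasure_density_const) auto
      also have "emeasure (distr lborel borel (\<lambda>x. v i + a i * x)) (A i) = emeasure lborel ((\<lambda>x. v i + a i * x) -` A i)"
        using Ai by (subst emeasure_distr) auto
      finally show ?thesis .
    qed
    ultimately show "emeasure P (PiE I A) = (\<Prod>i\<in>I. emeasure lborel (A i))"
      using A I by (subst eP) (auto simp: emeasure_PiM prod_ennreal[symmetric] prod.distrib intro!: sets_PiM_I_finite prod.cong)
  qed
  with eP[OF G] show ?thesis by simp
qed

lemma frame_map_measurable [measurable]:
  fixes e :: "'i \<Rightarrow> 'a::euclidean_space"
  shows "(\<lambda>c. p + (\<Sum>i\<in>I. c i *\<^sub>R e i)) \<in> borel_measurable (\<Pi>\<^sub>M i\<in>I. (lborel :: real measure))"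
  by measurable

lemma sets_frame_measure [simp, measurable_cong]: "sets (frame_measure I e p) = sets borel"
  and space_frame_measure [simp]: "space (frame_measure I e p) = UNIV"
  by (simp_all add: frame_measure_def)

lemma emeasure_frame_measure:
  fixes e :: "'i \<Rightarrow> 'a::euclidean_space"
  shows "G \<in> sets borel \<Longrightarrow> emeasure (frame_measure I e p) G =
    emeasure (\<Pi>\<^sub>M i\<in>I. lborel) ((\<lambda>c. p + (\<Sum>i\<in>I. c i *\<^sub>R e i)) -` G \<inter> space (\<Pi>\<^sub>M i\<in>I. (lborel :: real measure)))"
  unfolding frame_measure_def by (subst emeasure_distr) auto

lemma borel_vimage_shift:
  fixes G :: "'a::euclidean_space set"
  assumes "G \<in> sets borel"
  shows "(\<lambda>x. x + v) -` G \<in> sets borel"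
proof -
  have "(\<lambda>x. x + v) -` G \<inter> space borel \<in> sets borel"
    using assms by (intro measurable_sets[where A=borel]) auto
  then show ?thesis by simp
qed

lemma span_frame:
  fixes e :: "'i \<Rightarrow> 'a::euclidean_space"
  assumes "frame I e" "v \<in> span (e ` I)"
  shows "v = (\<Sum>i\<in>I. (v \<bullet> e i) *\<^sub>R e i)"
  using assms(2)
proof (induction rule: span_induct)
  case base
  then show ?case
  proof -
    have "c *\<^sub>R x = (\<Sum>i\<in>I. ((c *\<^sub>R x) \<bullet> e i) *\<^sub>R e i)" if "x = (\<Sum>i\<in>I. (x \<bullet> e i) *\<^sub>R e i)" for c x
    proof -
      have "c *\<^sub>R x = c *\<^sub>R (\<Sum>i\<in>I. (x \<bullet> e i) *\<^sub>R e i)" using that by simp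
      also have "\<dots> = (\<Sum>i\<in>I. ((c *\<^sub>R x) \<bullet> e i) *\<^sub>R e i)" by (simp add: scaleR_sum_right)
      finally show ?thesis .
    qed
    then show ?thesis
      by (intro subspaceI CollectI) (auto simp only: mem_Collect_eq, auto simp: scaleR_add_left sum.distrib inner_add_left)
  qed
next
  case (step x)
  then obtain j where j: "j \<in> I" "x = e j" by auto
  have "(\<Sum>i\<in>I. (x \<bullet> e i) *\<^sub>R e i) = (\<Sum>i\<in>I. if j = i then e i else 0)"
    using j assms(1) by (intro sum.cong) (auto simp: frame_def)
  also have "\<dots> = x" using j assms(1) by (simp add: frame_def)
  finally show ?case by simp
qed

lemma frame_measure_affine:
  assumes fr: "frame I e" and a: "\<And>i. i \<in> I \<Longrightarrow> a i \<noteq> 0" and G: "G \<in> sets borel"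
  shows "ennreal (\<Prod>i\<in>I. \<bar>a i\<bar>) * emeasure (frame_measure I (\<lambda>i. a i *\<^sub>R e i) p) G = emeasure (frame_measure I e p) G"
proof -
  let ?M = "\<Pi>\<^sub>M i\<in>I. (lborel :: real measure)"
  have I: "finite I" using fr by (simp add: frame_def)
  define X where "X = (\<lambda>c. p + (\<Sum>i\<in>I. c i *\<^sub>R e i)) -` G \<inter> space ?M"
  have X: "X \<in> sets ?M" unfolding X_def using G by (intro measurable_sets) auto
  have "(\<lambda>c. \<lambda>i\<in>I. 0 + a i * c i) -` X \<inter> space ?M = (\<lambda>c. p + (\<Sum>i\<in>I. c i *\<^sub>R a i *\<^sub>R e i)) -` G \<inter> space ?M"
    unfolding X_def by (auto simp: space_PiM mult.commute cong: sum.cong)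
  with PiM_lborel_affine[OF I _ X, where v = "\<lambda>_. 0" and a = a] show ?thesis
    using G a by (simp add: emeasure_frame_measure X_def)
qed

lemma frame_measure_translate:
  assumes fr: "frame I e" and v: "v \<in> span (e ` I)" and G: "G \<in> sets borel"
  shows "emeasure (frame_measure I e p) ((\<lambda>x. x + v) -` G) = emeasure (frame_measure I e p) G"
proof -
  let ?M = "\<Pi>\<^sub>M i\<in>I. (lborel :: real measure)"
  have I: "finite I" using fr by (simp add: frame_def)
  have v': "v = (\<Sum>i\<in>I. (v \<bullet> e i) *\<^sub>R e i)" by (rule span_frame[OF fr v])
  define X where "X = (\<lambda>c. p + (\<Sum>i\<in>I. c i *\<^sub>R e i)) -` G \<inter> space ?M"
  have X: "X \<in> sets ?M" unfolding X_def using G by (intro measurable_sets) auto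
  have *: "p + (\<Sum>i\<in>I. c i *\<^sub>R e i) + v = p + (\<Sum>i\<in>I. ((v \<bullet> e i) + 1 * c i) *\<^sub>R e i)" for c
    by (subst v') (simp add: algebra_simps sum.distrib)
  have "(\<lambda>c. \<lambda>i\<in>I. (v \<bullet> e i) + 1 * c i) -` X \<inter> space ?M =
      (\<lambda>c. p + (\<Sum>i\<in>I. c i *\<^sub>R e i)) -` ((\<lambda>x. x + v) -` G) \<inter> space ?M"
    unfolding X_def by (auto simp: space_PiM * cong: sum.cong)
  with PiM_lborel_affine[OF I _ X, where a = "\<lambda>_. 1" and v = "\<lambda>i. v \<bullet> e i"] show ?thesis
    using borel_vimage_shift[OF G] G by (simp add: emeasure_frame_measure X_def)
qed

lemma frame_measure_shift:
  assumes G: "G \<in> sets borel"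
  shows "emeasure (frame_measure I e p) G = emeasure (frame_measure I e 0) ((\<lambda>x. x + p) -` G)"
  using borel_vimage_shift[OF G] G
  by (simp add: emeasure_frame_measure vimage_def algebra_simps)

text \<open>By orthonormality the preimage of the ball is a ball in coordinates, so the value
  depends on dimension and radius only. This fixes the normalisation in the uniqueness proof and
  later bounds the volume of bounded sets.\<close>

lemma emeasure_frame_measure_cball:
  assumes fr: "frame I e" and r: "0 < r" and q: "q - p \<in> span (e ` I)"
  shows "emeasure (frame_measure I e p) (cball q r) = ennreal (unit_ball_vol (real (card I)) * r ^ card I)"
proof -
  let ?M = "\<Pi>\<^sub>M i\<in>I. (lborel :: real measure)"
  have I: "finite I" using fr by (simp add: frame_def)
  have n: "norm (\<Sum>i\<in>I. c i *\<^sub>R e i) = sqrt (\<Sum>i\<in>I. (c i)\<^sup>2)" for c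
  proof -
    have "(\<Sum>i\<in>I. c i *\<^sub>R e i) \<bullet> (\<Sum>i\<in>I. c i *\<^sub>R e i) = (\<Sum>i\<in>I. \<Sum>j\<in>I. c i * (c j * (e i \<bullet> e j)))"
      by (simp add: inner_sum_left inner_sum_right sum_distrib_left) (intro sum.cong refl, simp add: inner_commute)
    also have "\<dots> = (\<Sum>i\<in>I. \<Sum>j\<in>I. if i = j then c i * c i else 0)"
      using fr by (intro sum.cong) (auto simp: frame_def)
    also have "\<dots> = (\<Sum>i\<in>I. (c i)\<^sup>2)" using I by (simp add: power2_eq_square)
    finally show ?thesis by (simp add: norm_eq_sqrt_inner)
  qed
  have "emeasure (frame_measure I e p) (cball q r) = emeasure (frame_measure I e p) ((\<lambda>x. x + (q - p)) -` cball q r)"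
    by (rule frame_measure_translate[OF fr q, symmetric]) auto
  also have "(\<lambda>x. x + (q - p)) -` cball q r = cball p r"
    by (auto simp: dist_norm algebra_simps)
  also have "emeasure (frame_measure I e p) (cball p r) = emeasure ?M ({f. sqrt (\<Sum>i\<in>I. (f i)\<^sup>2) \<le> r} \<inter> space ?M)"
    by (subst emeasure_frame_measure) (auto simp: vimage_def dist_norm n)
  finally show ?thesis
    using emeasure_cball_aux[OF I r] by simp
qed

lemma sigma_finite_frame_measure:
  assumes fr: "frame I e"
  shows "sigma_finite_measure (frame_measure I e p)"
proof
  show "\<exists>A. countable A \<and> A \<subseteq> sets (frame_measure I e p) \<and> \<Union>A = space (frame_measure I e p) \<and>
      (\<forall>a\<in>A. emeasure (frame_measure I e p) a \<noteq> \<infinity>)"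
  proof (intro exI conjI)
    let ?A = "range (\<lambda>k. cball p (real (Suc k)))"
    show "countable ?A" "?A \<subseteq> sets (frame_measure I e p)" by auto
    have "\<exists>k. x \<in> cball p (real (Suc k))" for x
    proof -
      obtain k where "dist p x \<le> real k" using real_arch_simple by blast
      then have "x \<in> cball p (real (Suc k))" by simp
      then show ?thesis ..
    qed
    then show "\<Union>?A = space (frame_measure I e p)" by auto
    show "\<forall>a\<in>?A. emeasure (frame_measure I e p) a \<noteq> \<infinity>"
      using emeasure_frame_measure_cball[OF fr, of _ p p] by (auto simp: span_zero simp del: of_nat_Suc)
  qed
qed

lemma AE_frame_measure: "AE x in frame_measure I e p. x - p \<in> span (e ` I)"
proof -
  have "closed (span (e ` I))" by (rule closed_subspace) simp
  then have "{x. x - p \<in> span (e ` I)} \<in> sets borel"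
    by (intro borel_closed) (auto simp: vimage_def[symmetric] intro!: continuous_closed_vimage)
  then show ?thesis
    unfolding frame_measure_def
    by (subst AE_distr_iff) (auto intro!: AE_I2 span_sum span_scale simp: span_base)
qed

section \<open>Independence of flat volume from frame and origin\<close>

text \<open>Both measures are invariant under translations, so by Tonelli's theorem \<open>\<mu> A * \<nu> C = \<nu> A * \<mu> (- C)\<close>;
  the unit ball \<open>C\<close> has the same positive finite measure for both.\<close>
lemma frame_measure_unique_0:
  fixes e :: "'i \<Rightarrow> 'a::euclidean_space" and e' :: "'j \<Rightarrow> 'a"
  assumes fr: "frame I e" "frame J e'" and sp: "span (e ` I) = span (e' ` J)" and c: "card I = card J"
    and A: "A \<in> sets borel"
  shows "emeasure (frame_measure I e 0) A = emeasure (frame_measure J e' 0) A"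
proof -
  let ?m = "frame_measure I e 0" and ?n = "frame_measure J e' 0"
  let ?C = "cball 0 1 :: 'a set"
  define k where "k = emeasure ?m ?C"
  have k: "k = ennreal (unit_ball_vol (real (card I)))" "emeasure ?n ?C = k"
    unfolding k_def using emeasure_frame_measure_cball[OF fr(1), of 1 0 0] emeasure_frame_measure_cball[OF fr(2), of 1 0 0] c
    by (simp_all add: span_zero)
  interpret m: sigma_finite_measure ?m by (rule sigma_finite_frame_measure[OF fr(1)])
  interpret n: sigma_finite_measure ?n by (rule sigma_finite_frame_measure[OF fr(2)])
  interpret mn: pair_sigma_finite ?m ?n ..
  define H where "H = span (e ` I)"
  \<comment> \<open>Translation invariance holds only along \<open>H\<close>; almost every point,
    for either measure, lies there.\<close>
  have AEm: "AE x in ?m. x \<in> H" using AE_frame_measure[of 0 e I] by (simp add: H_def)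
  have AEn: "AE x in ?n. x \<in> H" using AE_frame_measure[of 0 e' J] by (simp add: H_def sp)
  have tr: "(\<integral>\<^sup>+x. f (x + v) \<partial>?m) = (\<integral>\<^sup>+x. f x \<partial>?m)" if "v \<in> H" "f \<in> borel_measurable borel" for f :: "'a \<Rightarrow> ennreal" and v
  proof -
    have "distr ?m borel (\<lambda>x. x + v) = ?m"
      by (rule measure_eqI) (use that frame_measure_translate[OF fr(1)] in \<open>auto simp: emeasure_distr H_def\<close>)
    then have "(\<integral>\<^sup>+x. f x \<partial>?m) = (\<integral>\<^sup>+x. f x \<partial>distr ?m borel (\<lambda>x. x + v))" by simp
    also have "\<dots> = (\<integral>\<^sup>+x. f (x + v) \<partial>?m)"
      using that(2) by (subst nn_integral_distr) auto
    finally show ?thesis by simp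
  qed
  have trn: "(\<integral>\<^sup>+x. f (x + v) \<partial>?n) = (\<integral>\<^sup>+x. f x \<partial>?n)" if "v \<in> H" "f \<in> borel_measurable borel" for f :: "'a \<Rightarrow> ennreal" and v
  proof -
    have "distr ?n borel (\<lambda>x. x + v) = ?n"
      by (rule measure_eqI) (use that frame_measure_translate[OF fr(2)] in \<open>auto simp: emeasure_distr H_def sp\<close>)
    then have "(\<integral>\<^sup>+x. f x \<partial>?n) = (\<integral>\<^sup>+x. f x \<partial>distr ?n borel (\<lambda>x. x + v))" by simp
    also have "\<dots> = (\<integral>\<^sup>+x. f (x + v) \<partial>?n)"
      using that(2) by (subst nn_integral_distr) auto
    finally show ?thesis by simp
  qed
  let ?a = "indicator A :: 'a \<Rightarrow> ennreal" and ?c = "indicator ?C :: 'a \<Rightarrow> ennreal"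
  have [measurable]: "?a \<in> borel_measurable borel" "?c \<in> borel_measurable borel" using A by (auto intro!: borel_measurable_indicator)
  \<comment> \<open>The ball is symmetric, so the reflection caused by the substitution in the inner
    integral is harmless.\<close>
  have cs: "?c (-x) = ?c x" for x by (simp add: indicator_def)
  have "emeasure ?m A * k = (\<integral>\<^sup>+y. (\<integral>\<^sup>+x. ?a x \<partial>?m) * ?c y \<partial>?n)"
    using k A by (simp add: nn_integral_cmult)
  also have "\<dots> = (\<integral>\<^sup>+y. (\<integral>\<^sup>+x. ?a (x + y) * ?c y \<partial>?m) \<partial>?n)"
    using AEn by (intro nn_integral_cong_AE) (auto elim!: eventually_mono simp: tr nn_integral_multc)
  also have "\<dots> = (\<integral>\<^sup>+x. (\<integral>\<^sup>+y. ?a (x + y) * ?c y \<partial>?n) \<partial>?m)"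
    by (rule mn.Fubini') measurable
  also have "\<dots> = (\<integral>\<^sup>+x. (\<integral>\<^sup>+y. ?a y * ?c (x - y) \<partial>?n) \<partial>?m)"
    using AEm
  proof (intro nn_integral_cong_AE, elim eventually_mono)
    fix x assume "x \<in> H"
    have "(\<integral>\<^sup>+y. ?a (x + y) * ?c y \<partial>?n) = (\<integral>\<^sup>+y. ?a (y + x) * ?c (x - (y + x)) \<partial>?n)"
      by (intro nn_integral_cong) (simp add: add.commute cs)
    also have "\<dots> = (\<integral>\<^sup>+y. ?a y * ?c (x - y) \<partial>?n)"
      by (rule trn[OF \<open>x \<in> H\<close>, where f = "\<lambda>y. ?a y * ?c (x - y)"]) measurable
    finally show "(\<integral>\<^sup>+y. ?a (x + y) * ?c y \<partial>?n) = (\<integral>\<^sup>+y. ?a y * ?c (x - y) \<partial>?n)" .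
  qed
  also have "\<dots> = (\<integral>\<^sup>+y. (\<integral>\<^sup>+x. ?a y * ?c (x - y) \<partial>?m) \<partial>?n)"
    by (rule mn.Fubini'[symmetric]) measurable
  also have "\<dots> = (\<integral>\<^sup>+y. ?a y * k \<partial>?n)"
    using AEn
  proof (intro nn_integral_cong_AE, elim eventually_mono)
    fix y assume "y \<in> H"
    then have "-y \<in> H" by (simp add: H_def span_neg)
    have "(\<integral>\<^sup>+x. ?a y * ?c (x - y) \<partial>?m) = ?a y * (\<integral>\<^sup>+x. ?c (x + -y) \<partial>?m)"
      by (subst nn_integral_cmult[symmetric]) auto
    also have "(\<integral>\<^sup>+x. ?c (x + -y) \<partial>?m) = k"
      by (subst tr[OF \<open>-y \<in> H\<close>]) (auto simp: k_def)
    finally show "(\<integral>\<^sup>+x. ?a y * ?c (x - y) \<partial>?m) = ?a y * k" .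
  qed
  also have "\<dots> = emeasure ?n A * k" using A by (simp add: nn_integral_multc)
  finally have "emeasure ?m A * k = emeasure ?n A * k" .
  then have "k * emeasure ?m A = k * emeasure ?n A"
    by (simp add: mult.commute)
  moreover have "k \<noteq> 0" "k \<noteq> top"
    using unit_ball_vol_pos[of "real (card I)"] unfolding k(1) by (auto simp: ennreal_eq_0_iff not_le simp del: unit_ball_vol_pos)
  ultimately show ?thesis by (simp add: ennreal_mult_cancel_left)
qed

lemma frame_card:
  assumes "frame I e"
  shows "dim (span (e ` I)) = card I"
proof -
  have inj: "inj_on e I"
    using assms by (auto simp: inj_on_def frame_def) (metis zero_neq_one)
  have "independent (e ` I)"
  proof (rule pairwise_orthogonal_independent)
    show "pairwise orthogonal (e ` I)"
      using assms by (auto simp: pairwise_def orthogonal_def frame_def)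
    show "0 \<notin> e ` I"
      using assms by (auto simp: frame_def) (metis inner_zero_left zero_neq_one)
  qed
  then show ?thesis
    using inj by (simp add: dim_eq_card_independent card_image)
qed

lemma frame_measure_unique:
  fixes e :: "'i \<Rightarrow> 'a::euclidean_space" and e' :: "'j \<Rightarrow> 'a"
  assumes fr: "frame I e" "frame J e'" and sp: "span (e ` I) = span (e' ` J)"
    and p: "p - p' \<in> span (e ` I)" and A: "A \<in> sets borel"
  shows "emeasure (frame_measure I e p) A = emeasure (frame_measure J e' p') A"
proof -
  have c: "card I = card J" using frame_card[OF fr(1)] frame_card[OF fr(2)] sp by simp
  have "emeasure (frame_measure I e p) A = emeasure (frame_measure I e 0) ((\<lambda>x. x + p) -` A)"
    by (rule frame_measure_shift[OF A])
  also have "(\<lambda>x. x + p) -` A = (\<lambda>x. x + (p - p')) -` ((\<lambda>x. x + p') -` A)" by (auto simp: algebra_simps)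
  also have "emeasure (frame_measure I e 0) \<dots> = emeasure (frame_measure I e 0) ((\<lambda>x. x + p') -` A)"
    by (rule frame_measure_translate[OF fr(1) p borel_vimage_shift[OF A]])
  also have "\<dots> = emeasure (frame_measure J e' 0) ((\<lambda>x. x + p') -` A)"
    by (rule frame_measure_unique_0[OF fr sp c borel_vimage_shift[OF A]])
  also have "\<dots> = emeasure (frame_measure J e' p') A"
    by (rule frame_measure_shift[OF A, symmetric])
  finally show ?thesis .
qed

lemma frame_exists:
  fixes H :: "'a::euclidean_space set"
  assumes "subspace H"
  obtains B where "frame B (\<lambda>b. b)" "span B = H" "B \<subseteq> H"
proof -
  obtain B where B: "B \<subseteq> H" "pairwise orthogonal B" "\<And>x. x \<in> B \<Longrightarrow> norm x = 1" "independent B" "card B = dim H" "span B = H"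
    by (rule orthonormal_basis_subspace[OF assms]) blast
  have "frame B (\<lambda>b. b)"
    using B by (auto simp: frame_def pairwise_def orthogonal_def independent_imp_finite norm_eq_1)
  then show thesis using B that by blast
qed

lemma subspace_dirs [simp]: "subspace (dirs S)"
  by (simp add: dirs_def)

lemma diff_in_dirs: "x \<in> S \<Longrightarrow> y \<in> S \<Longrightarrow> x - y \<in> dirs S"
  unfolding dirs_def by (rule span_base) blast

lemma flat_measure_frame:
  assumes "S \<noteq> {}"
  obtains B p where "frame B (\<lambda>b. b)" "span B = dirs S" "p \<in> S" "flat_measure S = frame_measure B (\<lambda>b. b) p"
proof -
  define p where "p = (SOME p. p \<in> S)"
  let ?P = "\<lambda>B. B \<subseteq> dirs S \<and> pairwise orthogonal B \<and> (\<forall>b\<in>B. norm b = 1) \<and> span B = dirs S"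
  define B where "B = (SOME B. ?P B)"
  have p: "p \<in> S" using assms unfolding p_def by (simp add: some_in_eq)
  have "\<exists>B. ?P B"
    by (rule orthonormal_basis_subspace[OF subspace_dirs, of S]) blast
  then have B: "?P B" unfolding B_def by (rule someI_ex)
  have "0 \<notin> B" using B by auto
  then have "independent B" using B by (intro pairwise_orthogonal_independent) auto
  then have "frame B (\<lambda>b. b)"
    using B by (auto simp: frame_def pairwise_def orthogonal_def independent_imp_finite norm_eq_1)
  moreover have "flat_measure S = frame_measure B (\<lambda>b. b) p"
    unfolding flat_measure_def frame_measure_def p_def B_def Let_def ..
  ultimately show thesis using that B p by blast
qed

text \<open>Removes the two choices made in \<open>flat_measure\<close>: from here on any
  orthonormal frame of the direction space and any base point in the affine hull may be
  used.\<close>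

lemma emeasure_flat_measure:
  fixes e :: "'i \<Rightarrow> 'a::euclidean_space"
  assumes "q \<in> S" "frame I e" "span (e ` I) = dirs S" "q - p \<in> dirs S" "G \<in> sets borel"
  shows "emeasure (flat_measure S) G = emeasure (frame_measure I e p) G"
proof -
  obtain B p' where B: "frame B (\<lambda>b. b)" "span B = dirs S" "p' \<in> S" "flat_measure S = frame_measure B (\<lambda>b. b) p'"
    using flat_measure_frame assms(1) by blast
  have "p' - p = (p' - q) + (q - p)" by simp
  also have "\<dots> \<in> dirs S"
    using assms B by (intro subspace_add) (auto simp: diff_in_dirs)
  finally show ?thesis
    unfolding B(4) using assms B by (intro frame_measure_unique) auto
qed

lemma sets_flat_measure [simp, measurable_cong]: "sets (flat_measure S) = sets borel"
  and space_flat_measure [simp]: "space (flat_measure S) = UNIV"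
  by (simp_all add: flat_measure_def Let_def)

lemma AE_flat_measure: "p \<in> S \<Longrightarrow> AE x in flat_measure S. x - p \<in> dirs S"
proof -
  assume p: "p \<in> S"
  then obtain B p' where B: "frame B (\<lambda>b. b)" "span B = dirs S" "p' \<in> S" "flat_measure S = frame_measure B (\<lambda>b. b) p'"
    using flat_measure_frame by blast
  have "p' - p \<in> dirs S" using B p by (simp add: diff_in_dirs)
  then have "x - p \<in> dirs S" if "x - p' \<in> dirs S" for x
    using subspace_add[OF subspace_dirs that] by fastforce
  then show ?thesis
    using AE_frame_measure[of p' "\<lambda>b. b" B] B(2) unfolding B(4) by (simp add: eventually_mono)
qed

lemma emeasure_flat_measure_bounded:
  assumes p: "p \<in> S" and q: "q - p \<in> dirs S" and r: "0 < r" and X: "X \<subseteq> cball q r"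
  shows "emeasure (flat_measure S) X \<le> ennreal (unit_ball_vol (real (dim (dirs S))) * r ^ dim (dirs S))"
proof -
  obtain B p' where B: "frame B (\<lambda>b. b)" "span B = dirs S" "p' \<in> S" "flat_measure S = frame_measure B (\<lambda>b. b) p'"
    using flat_measure_frame p by blast
  have c: "card B = dim (dirs S)" using frame_card[OF B(1)] B(2) by simp
  have "q - p' = (q - p) + (p - p')" by simp
  also have "\<dots> \<in> dirs S" using B p q by (intro subspace_add) (auto simp: diff_in_dirs)
  finally have "emeasure (flat_measure S) (cball q r) = ennreal (unit_ball_vol (real (card B)) * r ^ card B)"
    unfolding B(4) using B(2) by (intro emeasure_frame_measure_cball[OF B(1) r]) auto
  moreover have "emeasure (flat_measure S) X \<le> emeasure (flat_measure S) (cball q r)"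
    by (intro emeasure_mono X) auto
  ultimately show ?thesis by (simp add: c)
qed

lemma frame_insert:
  fixes b :: "'a::euclidean_space"
  assumes "frame B (\<lambda>b. b)" "span B = {x \<in> H. x \<bullet> b = 0}" "b \<in> H" "norm b = 1" "subspace H"
  shows "frame (insert b B) (\<lambda>b. b)" "span (insert b B) = H" "b \<notin> B"
proof -
  have B: "x \<in> H \<and> x \<bullet> b = 0" if "x \<in> B" for x
    using assms(2) span_base[OF that] by auto
  have bb: "b \<bullet> b = 1" using assms(4) by (simp add: norm_eq_1)
  then show "b \<notin> B" using B by force
  show "frame (insert b B) (\<lambda>b. b)"
    using assms(1) B bb by (auto simp: frame_def inner_commute)
  show "span (insert b B) = H"
  proof
    show "span (insert b B) \<subseteq> H"
      using B assms by (intro span_minimal) auto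
    show "H \<subseteq> span (insert b B)"
    proof
      fix x assume x: "x \<in> H"
      have "x - (x \<bullet> b) *\<^sub>R b \<in> {x \<in> H. x \<bullet> b = 0}"
        using assms x bb by (simp add: subspace_diff subspace_scale inner_diff_left)
      then have "x - (x \<bullet> b) *\<^sub>R b \<in> span B" using assms(2) by simp
      then show "x \<in> span (insert b B)"
        using span_breakdown_eq by blast
    qed
  qed
qed

text \<open>In an orthonormal frame containing \<open>a\<close> the set lies in a box with one side
  \<open>\<eta>\<close> and all other sides \<open>2 * r\<close>.\<close>

lemma emeasure_flat_measure_slab:
  fixes a :: "'a::euclidean_space"
  assumes q: "q \<in> S" and a: "a \<in> dirs S" "norm a = 1" and r: "0 < r" and \<eta>: "0 \<le> \<eta>"
    and X: "X \<subseteq> {x \<in> cball q r. b \<le> a \<bullet> x \<and> a \<bullet> x \<le> b + \<eta>}"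
  shows "emeasure (flat_measure S) X \<le> ennreal ((2 * r) ^ (dim (dirs S) - 1) * \<eta>)"
proof -
  interpret product_sigma_finite "\<lambda>_::'a. lborel :: real measure" ..
  let ?Y = "{x \<in> cball q r. b \<le> a \<bullet> x \<and> a \<bullet> x \<le> b + \<eta>}"
  have [measurable]: "?Y \<in> sets borel" by measurable
  have "subspace {x \<in> dirs S. x \<bullet> a = 0}"
    by (auto intro!: subspaceI simp: subspace_add subspace_scale subspace_0 inner_add_left)
  then obtain B where B: "frame B (\<lambda>b. b)" "span B = {x \<in> dirs S. x \<bullet> a = 0}"
    by (rule frame_exists)
  note F = frame_insert[OF B a subspace_dirs]
  have fin: "finite B" using B by (simp add: frame_def)
  have c: "Suc (card B) = dim (dirs S)" using frame_card[OF F(1)] F(2,3) fin by simp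
  let ?M = "\<Pi>\<^sub>M i\<in>insert a B. (lborel :: real measure)"
  let ?f = "\<lambda>c. q + (\<Sum>i\<in>insert a B. c i *\<^sub>R i)"
  let ?A = "\<lambda>i. if i = a then {b - a \<bullet> q..b - a \<bullet> q + \<eta>} else {-r..r}"
  have coord: "?f c \<bullet> i = q \<bullet> i + c i" if "i \<in> insert a B" for c i
  proof -
    have "(\<Sum>j\<in>insert a B. c j *\<^sub>R j) \<bullet> i = (\<Sum>j\<in>insert a B. if j = i then c i else 0)"
      unfolding inner_sum_left using F(1) that by (intro sum.cong) (auto simp: frame_def)
    then show ?thesis using that fin by (simp add: inner_add_left)
  qed
  have n1: "norm i = 1" if "i \<in> insert a B" for i
    using F(1) that by (auto simp: frame_def norm_eq_1)
  have sub: "?f -` ?Y \<inter> space ?M \<subseteq> PiE (insert a B) ?A"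
  proof
    fix c assume c: "c \<in> ?f -` ?Y \<inter> space ?M"
    have "c i \<in> ?A i" if i: "i \<in> insert a B" for i
    proof (cases "i = a")
      case True
      then show ?thesis using c coord[OF i, of c] by (auto simp: inner_commute)
    next
      case False
      have "c i = (?f c - q) \<bullet> i" using coord[OF i, of c] by (simp add: inner_diff_left inner_add_left)
      then have "\<bar>c i\<bar> \<le> norm (?f c - q)"
        using Cauchy_Schwarz_ineq2[of "?f c - q" i] n1[OF i] by simp
      also have "\<dots> \<le> r" using c by (simp add: dist_norm norm_minus_commute)
      finally show ?thesis using False by auto
    qed
    moreover have "c \<in> extensional (insert a B)" using c by (simp add: space_PiM PiE_def)
    ultimately show "c \<in> PiE (insert a B) ?A" unfolding PiE_def Pi_def by blast
  qed
  have "emeasure (flat_measure S) X \<le> emeasure (flat_measure S) ?Y"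
    using X by (intro emeasure_mono) auto
  also have "\<dots> = emeasure (frame_measure (insert a B) (\<lambda>b. b) q) ?Y"
    by (rule emeasure_flat_measure[OF q F(1)]) (simp_all add: F(2)[simplified] subspace_0)
  also have "\<dots> = emeasure ?M (?f -` ?Y \<inter> space ?M)"
    by (rule emeasure_frame_measure) measurable
  also have "\<dots> \<le> emeasure ?M (PiE (insert a B) ?A)"
    using fin by (intro emeasure_mono sub sets_PiM_I_finite) auto
  also have "\<dots> = (\<Prod>i\<in>insert a B. emeasure lborel (?A i))"
    using fin by (intro emeasure_PiM) auto
  also have "\<dots> = ennreal \<eta> * (\<Prod>i\<in>B. emeasure lborel (?A i))"
    using fin F(3) \<eta> by simp
  also have "(\<Prod>i\<in>B. emeasure lborel (?A i)) = (\<Prod>i\<in>B. ennreal (2 * r))"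
    using F(3) r by (intro prod.cong) auto
  also have "ennreal \<eta> * \<dots> = ennreal ((2 * r) ^ (dim (dirs S) - 1) * \<eta>)"
  proof -
    have "(\<Prod>i\<in>B. ennreal (2 * r)) = ennreal ((2 * r) ^ card B)"
      using r by (simp only: prod_constant) (simp add: ennreal_power del: power_mult_distrib)
    then show ?thesis using r \<eta> c[symmetric] by (simp add: ennreal_mult[symmetric] mult.commute del: power_mult_distrib)
  qed
  finally show ?thesis .
qed

section \<open>Projections and shears between hyperplanes\<close>

text \<open>Projection along \<open>u\<close> is the identity on the vectors orthogonal to both
  \<open>m\<close> and \<open>u\<close>. Only one direction of the source hyperplane remains, the
  normalised part \<open>b1\<close> of \<open>u\<close> orthogonal to \<open>m\<close>, and it is
  mapped to \<open>- a\<close> times the unit vector \<open>b2\<close>. So the determinant is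
  \<open>u \<bullet> m\<close> up to sign.\<close>

lemma frame_measure_project:
  fixes m u :: "'a::euclidean_space" and e :: "'i \<Rightarrow> 'a" and e' :: "'j \<Rightarrow> 'a"
  assumes T: "subspace T" and m: "m \<in> T" "norm m = 1" and u: "u \<in> T" "norm u = 1" and um: "u \<bullet> m \<noteq> 0"
    and fr: "frame I e" "span (e ` I) = {x \<in> T. x \<bullet> m = 0}"
    and fr': "frame J e'" "span (e' ` J) = {x \<in> T. x \<bullet> u = 0}"
    and G: "G \<in> sets borel"
  shows "ennreal \<bar>u \<bullet> m\<bar> * emeasure (frame_measure I e p) ((\<lambda>x. x - (x \<bullet> u) *\<^sub>R u) -` G)
    = emeasure (frame_measure J e' (p - (p \<bullet> u) *\<^sub>R u)) G"
proof -
  let ?pr = "\<lambda>x. x - (x \<bullet> u) *\<^sub>R u"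
  have mm: "m \<bullet> m = 1" and uu: "u \<bullet> u = 1" using m u by (simp_all add: norm_eq_1)
  have prG: "?pr -` G \<in> sets borel"
  proof -
    have "?pr \<in> borel_measurable borel" by measurable
    from measurable_sets[OF this G] show ?thesis by simp
  qed
  define a where "a = u \<bullet> m"
  have nz: "(norm (m - a *\<^sub>R u))\<^sup>2 = 1 - a\<^sup>2" "(norm (u - a *\<^sub>R m))\<^sup>2 = 1 - a\<^sup>2"
    unfolding power2_norm_eq_inner a_def using mm uu
    by (simp_all add: inner_diff_left inner_diff_right inner_commute power2_eq_square algebra_simps)
  show ?thesis
  \<comment> \<open>If \<open>u\<close> and \<open>m\<close> are parallel, the two hyperplanes have
    the same direction and \<open>b1\<close> does not exist.\<close>
  proof (cases "1 - a\<^sup>2 = 0")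
    case True
    then have ma: "m = a *\<^sub>R u" using nz by simp
    have sp: "span (e ` I) = span (e' ` J)" using fr fr' um ma by auto
    have eu: "e i \<bullet> u = 0" if "i \<in> I" for i
      using that span_base[of "e i" "e ` I"] fr(2) um ma by auto
    have "?pr (p + (\<Sum>i\<in>I. c i *\<^sub>R e i)) = ?pr p + (\<Sum>i\<in>I. c i *\<^sub>R e i)" for c
      using eu by (simp add: inner_add_left inner_sum_left)
    then have "emeasure (frame_measure I e p) (?pr -` G) = emeasure (frame_measure I e (?pr p)) G"
      using G prG by (simp only: emeasure_frame_measure vimage_def mem_Collect_eq)
    also have "\<dots> = emeasure (frame_measure J e' (?pr p)) G"
      by (rule frame_measure_unique[OF fr(1) fr'(1) sp _ G]) (simp add: span_zero)
    finally show ?thesis using True by (simp add: a_def[symmetric] abs_square_eq_1)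
  next
    case False
    define r where "r = norm (m - a *\<^sub>R u)"
    have "r \<noteq> 0" using False nz unfolding r_def by auto
    have r2: "r * r = 1 - a * a" using nz(1) by (simp add: r_def power2_eq_square)
    have r': "norm (u - a *\<^sub>R m) = r"
      using nz unfolding r_def by (metis norm_ge_zero power2_eq_iff_nonneg)
    define b1 where "b1 = (1 / r) *\<^sub>R (u - a *\<^sub>R m)"
    define b2 where "b2 = (1 / r) *\<^sub>R (m - a *\<^sub>R u)"
    have b1: "b1 \<in> {x \<in> T. x \<bullet> m = 0}" "norm b1 = 1"
      using T m u mm \<open>r \<noteq> 0\<close> r' by (auto simp: b1_def subspace_diff subspace_scale inner_diff_left a_def)
    have b2: "b2 \<in> {x \<in> T. x \<bullet> u = 0}" "norm b2 = 1"
      using T m u uu \<open>r \<noteq> 0\<close> by (auto simp: b2_def subspace_diff subspace_scale inner_diff_left a_def r_def) (simp add: inner_diff_right inner_commute)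
    have m': "m = a *\<^sub>R u + r *\<^sub>R b2" using \<open>r \<noteq> 0\<close> by (simp add: b2_def)
    have u': "u = a *\<^sub>R m + r *\<^sub>R b1" using \<open>r \<noteq> 0\<close> by (simp add: b1_def)
    have sub: "subspace {x \<in> T. x \<bullet> m = 0}" "subspace {x \<in> T. x \<bullet> u = 0}" "subspace {x \<in> T. x \<bullet> m = 0 \<and> x \<bullet> u = 0}"
      using T by (auto intro!: subspaceI simp: subspace_add subspace_scale subspace_0 inner_add_left)
    obtain B where B: "frame B (\<lambda>b. b)" "span B = {x \<in> T. x \<bullet> m = 0 \<and> x \<bullet> u = 0}" by (rule frame_exists[OF sub(3)])
    have B1: "span B = {x \<in> {x \<in> T. x \<bullet> m = 0}. x \<bullet> b1 = 0}"
      unfolding B(2) using \<open>r \<noteq> 0\<close> by (auto simp: b1_def inner_diff_right)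
    have B2: "span B = {x \<in> {x \<in> T. x \<bullet> u = 0}. x \<bullet> b2 = 0}"
      unfolding B(2) using \<open>r \<noteq> 0\<close> by (auto simp: b2_def inner_diff_right)
    note F1 = frame_insert[OF B(1) B1 b1 sub(1)]
    note F2 = frame_insert[OF B(1) B2 b2 sub(2)]
    have fin: "finite B" using B(1) by (simp add: frame_def)
    \<comment> \<open>\<open>e2\<close> is a frame of the image hyperplane indexed by the frame of
      the source, with \<open>b2\<close> in the place of \<open>b1\<close>; \<open>\<alpha>\<close>
      holds the stretching factors of the projection.\<close>
    define e2 where "e2 = (\<lambda>i. if i = b1 then b2 else i)"
    define \<alpha> where "\<alpha> = (\<lambda>i. if i = b1 then - a else 1)"
    have e2: "e2 ` insert b1 B = insert b2 B" using F1(3) by (auto simp: e2_def)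
    have frame2: "frame (insert b1 B) e2"
      using F1 F2 by (auto simp: frame_def e2_def)
    have pb1: "?pr b1 = - a *\<^sub>R b2"
    proof -
      have "b1 \<bullet> u = r"
      proof -
        have "r * (b1 \<bullet> u) = 1 - a * a"
          using \<open>r \<noteq> 0\<close> uu by (simp add: b1_def inner_diff_left inner_commute[of m u] a_def)
        then show ?thesis using r2 \<open>r \<noteq> 0\<close> by (metis mult_cancel_left)
      qed
      then have "r *\<^sub>R ?pr b1 = u - a *\<^sub>R m - (r * r) *\<^sub>R u"
        using \<open>r \<noteq> 0\<close> by (simp add: b1_def scaleR_diff_right)
      also have "\<dots> = - a *\<^sub>R (m - a *\<^sub>R u)" unfolding r2 by (simp add: algebra_simps)
      also have "\<dots> = r *\<^sub>R (- a *\<^sub>R b2)" using \<open>r \<noteq> 0\<close> by (simp add: b2_def)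
      finally show ?thesis using \<open>r \<noteq> 0\<close> unfolding scaleR_cancel_left by blast
    qed
    have pB: "?pr b = b" if "b \<in> B" for b
      using span_base[OF that] unfolding B(2) by simp
    have prsum: "?pr (p + (\<Sum>i\<in>insert b1 B. c i *\<^sub>R i)) = ?pr p + (\<Sum>i\<in>insert b1 B. c i *\<^sub>R (\<alpha> i *\<^sub>R e2 i))" for c
    proof -
      have lin: "linear ?pr"
        by (auto intro!: linearI simp: inner_add_left algebra_simps)
      have "?pr (p + (\<Sum>i\<in>insert b1 B. c i *\<^sub>R i)) = ?pr p + (\<Sum>i\<in>insert b1 B. c i *\<^sub>R ?pr i)"
        by (simp only: linear_add[OF lin] linear_sum[OF lin] linear_scale[OF lin])
      also have "(\<Sum>i\<in>insert b1 B. c i *\<^sub>R ?pr i) = (\<Sum>i\<in>insert b1 B. c i *\<^sub>R (\<alpha> i *\<^sub>R e2 i))"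
        by (intro sum.cong refl arg_cong2[where f=scaleR]) (use pb1 pB F1(3) in \<open>auto simp: \<alpha>_def e2_def\<close>)
      finally show ?thesis .
    qed
    have "emeasure (frame_measure I e p) (?pr -` G) = emeasure (frame_measure (insert b1 B) (\<lambda>b. b) p) (?pr -` G)"
      by (rule frame_measure_unique[OF fr(1) F1(1) _ _ prG]) (use fr(2) F1(2) T in \<open>simp_all add: subspace_0\<close>)
    also have "\<dots> = emeasure (frame_measure (insert b1 B) (\<lambda>i. \<alpha> i *\<^sub>R e2 i) (?pr p)) G"
      using G prG prsum by (simp only: emeasure_frame_measure vimage_def mem_Collect_eq)
    finally have 1: "emeasure (frame_measure I e p) (?pr -` G) = \<dots>" .
    have al: "(\<Prod>i\<in>insert b1 B. \<bar>\<alpha> i\<bar>) = \<bar>u \<bullet> m\<bar>"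
    proof -
      have "(\<Prod>i\<in>B. \<bar>\<alpha> i\<bar>) = 1" using F1(3) by (intro prod.neutral) (auto simp: \<alpha>_def)
      then show ?thesis using fin F1(3) by (simp add: \<alpha>_def a_def)
    qed
    have "ennreal \<bar>u \<bullet> m\<bar> * emeasure (frame_measure I e p) (?pr -` G) = emeasure (frame_measure (insert b1 B) e2 (?pr p)) G"
      unfolding 1 al[symmetric]
      by (rule frame_measure_affine[OF frame2 _ G]) (use um in \<open>auto simp: \<alpha>_def a_def\<close>)
    also have "\<dots> = emeasure (frame_measure J e' (?pr p)) G"
      by (rule frame_measure_unique[OF frame2 fr'(1) _ _ G]) (use fr'(2) F2(2) e2 T in \<open>simp_all add: subspace_0\<close>)
    finally show ?thesis .
  qed
qed

text \<open>The map moves points along \<open>u\<close> until they reach the second hyperplane.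
  Corresponding sets have the same projection along \<open>u\<close>, so both sides equal the volume
  of that common projection.\<close>

lemma flat_measure_project:
  fixes m m' u :: "'a::euclidean_space"
  assumes T: "subspace T" and m: "m \<in> T" "norm m = 1" and m': "m' \<in> T" "norm m' = 1"
    and u: "u \<in> T" "norm u = 1" and um: "u \<bullet> m \<noteq> 0" and um': "u \<bullet> m' \<noteq> 0"
    and S: "dirs S = {x \<in> T. x \<bullet> m = 0}" and S': "dirs S' = {x \<in> T. x \<bullet> m' = 0}"
    and p: "p \<in> S" and q: "q \<in> S'" and pq: "q - p \<in> T" and G: "G \<in> sets borel"
  shows "ennreal \<bar>u \<bullet> m\<bar> * emeasure (flat_measure S) ((\<lambda>x. x + ((m' \<bullet> (q - x)) / (m' \<bullet> u)) *\<^sub>R u) -` G)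
    = ennreal \<bar>u \<bullet> m'\<bar> * emeasure (flat_measure S') G"
proof -
  let ?pr = "\<lambda>x. x - (x \<bullet> u) *\<^sub>R u"
  let ?\<psi> = "\<lambda>x. x + ((m' \<bullet> (q - x)) / (m' \<bullet> u)) *\<^sub>R u"
  have uu: "u \<bullet> u = 1" using u by (simp add: norm_eq_1)
  have um2: "m' \<bullet> u \<noteq> 0" using um' by (simp add: inner_commute)
  have \<psi>m: "?\<psi> \<in> borel_measurable borel" by measurable
  have \<psi>G: "?\<psi> -` G \<in> sets borel" using measurable_sets[OF \<psi>m G] by simp
  \<comment> \<open>The shear is constant on lines parallel to \<open>u\<close>; its preimages are
    cylinders and are not changed by taking the preimage under \<open>?pr\<close>.\<close>
  have \<psi>pr: "?\<psi> (?pr x) = ?\<psi> x" for x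
    using um2 by (simp add: inner_diff_right add_divide_distrib diff_divide_distrib algebra_simps)
  have vim: "?pr -` (?\<psi> -` G) = ?\<psi> -` G" using \<psi>pr by (simp only: vimage_def mem_Collect_eq)
  have sub: "subspace {x \<in> T. x \<bullet> u = 0}"
    using T by (auto intro!: subspaceI simp: subspace_add subspace_scale subspace_0 inner_add_left)
  obtain B where B: "frame B (\<lambda>b. b)" "span B = {x \<in> T. x \<bullet> u = 0}" using frame_exists[OF sub] by metis
  have "S \<noteq> {}" "S' \<noteq> {}" using p q by auto
  obtain C where C: "frame C (\<lambda>b. b)" "span C = dirs S" using frame_exists[OF subspace_dirs[of S]] by metis
  obtain C' where C': "frame C' (\<lambda>b. b)" "span C' = dirs S'" using frame_exists[OF subspace_dirs[of S']] by metis
  have "ennreal \<bar>u \<bullet> m\<bar> * emeasure (flat_measure S) (?\<psi> -` G) = ennreal \<bar>u \<bullet> m\<bar> * emeasure (frame_measure C (\<lambda>b. b) p) (?pr -` (?\<psi> -` G))"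
    unfolding vim using emeasure_flat_measure[OF p C(1) _ _ \<psi>G, of p] C by (simp add: subspace_0)
  also have "\<dots> = emeasure (frame_measure B (\<lambda>b. b) (?pr p)) (?\<psi> -` G)"
    by (rule frame_measure_project[OF T m u um C(1) _ B(1) _ \<psi>G]) (use C B S in simp_all)
  also have "\<dots> = emeasure (frame_measure B (\<lambda>b. b) (?pr q)) (?\<psi> -` G)"
  proof (rule frame_measure_unique[OF B(1) B(1) refl _ \<psi>G])
    have "?pr p - ?pr q = (p - q) - ((p - q) \<bullet> u) *\<^sub>R u" by (simp add: inner_diff_left algebra_simps)
    also have "\<dots> \<in> {x \<in> T. x \<bullet> u = 0}"
      using T u uu pq subspace_neg[OF T pq] by (auto simp: inner_diff_left intro!: subspace_diff subspace_scale)
    finally show "?pr p - ?pr q \<in> span ((\<lambda>b. b) ` B)" using B by simp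
  qed
  also have "\<dots> = ennreal \<bar>u \<bullet> m'\<bar> * emeasure (frame_measure C' (\<lambda>b. b) q) (?pr -` (?\<psi> -` G))"
    by (rule frame_measure_project[OF T m' u um' C'(1) _ B(1) _ \<psi>G, symmetric]) (use C' B S' in simp_all)
  also have "\<dots> = ennreal \<bar>u \<bullet> m'\<bar> * emeasure (flat_measure S') (?\<psi> -` G)"
    unfolding vim using emeasure_flat_measure[OF q C'(1) _ _ \<psi>G, of q] C' by (simp add: subspace_0)
  \<comment> \<open>On the second hyperplane itself the shear is the identity, and the measure is
    concentrated there.\<close>
  also have "emeasure (flat_measure S') (?\<psi> -` G) = emeasure (flat_measure S') G"
  proof (rule emeasure_eq_AE)
    show "AE x in flat_measure S'. (x \<in> ?\<psi> -` G) = (x \<in> G)"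
      using AE_flat_measure[OF q]
    proof (eventually_elim)
      fix x assume "x - q \<in> dirs S'"
      then have "m' \<bullet> (q - x) = 0" unfolding S' by (simp add: inner_commute inner_diff_left inner_diff_right)
      then show "(x \<in> ?\<psi> -` G) = (x \<in> G)" by simp
    qed
  qed (use \<psi>G G in auto)
  finally show ?thesis .
qed

section \<open>Simplices and hinges\<close>

lemma span_shift_eq_dirs:
  assumes "a \<in> S"
  shows "span ((\<lambda>x. - a + x) ` S) = dirs S"
proof
  show "span ((\<lambda>x. - a + x) ` S) \<subseteq> dirs S"
  proof (rule span_minimal)
    show "(\<lambda>x. - a + x) ` S \<subseteq> dirs S"
      using assms by (auto simp: diff_in_dirs)
  qed simp
  show "dirs S \<subseteq> span ((\<lambda>x. - a + x) ` S)"
    unfolding dirs_def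
  proof (rule span_minimal)
    show "{x - y |x y. x \<in> S \<and> y \<in> S} \<subseteq> span ((\<lambda>x. - a + x) ` S)"
    proof safe
      fix x y assume "x \<in> S" "y \<in> S"
      then have "(- a + x) - (- a + y) \<in> span ((\<lambda>x. - a + x) ` S)"
        by (intro span_diff span_base) auto
      then show "x - y \<in> span ((\<lambda>x. - a + x) ` S)" by simp
    qed
  qed simp
qed

lemma dim_dirs:
  assumes "S \<noteq> {}"
  shows "int (dim (dirs S)) = aff_dim S"
proof -
  obtain a where a: "a \<in> S" using assms by auto
  show ?thesis
    unfolding span_shift_eq_dirs[OF a, symmetric] dim_span
    using aff_dim_eq_dim[of a S] a by (simp add: hull_inc)
qed

lemma affine_hull_iff_dirs:
  assumes "a \<in> S"
  shows "x \<in> affine hull S \<longleftrightarrow> x - a \<in> dirs S"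
proof -
  have "affine hull S = (\<lambda>x. a + x) ` dirs S"
    using affine_hull_span_gen[of a S] assms span_shift_eq_dirs[OF assms] by (simp add: hull_inc)
  then show ?thesis by (auto simp: image_iff intro!: bexI[of _ "x - a"])
qed

lemma dirs_mono: "S \<subseteq> T \<Longrightarrow> dirs S \<subseteq> dirs T"
  unfolding dirs_def by (intro span_mono) auto

lemma rel_interior_borel: "rel_interior (S :: 'a::euclidean_space set) \<in> sets borel"
proof -
  obtain U where U: "open U" "rel_interior S = U \<inter> affine hull S"
    using openin_rel_interior[of S] by (auto simp: openin_open)
  then show ?thesis by (simp add: borel_closed closed_affine_hull)
qed

locale flat_manifold =
  fixes n :: nat and K :: "'a::euclidean_space set set" and \<nu> :: "'a set \<Rightarrow> 'a"
  assumes dimA: "DIM('a) = n + 1" and n: "1 \<le> n"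
    and mfd: "piecewise_flat_manifold n K"
    and nrm: "positive_normals n K \<nu>"
begin

lemma complex: "s \<in> K \<Longrightarrow> \<exists>k. k simplex s" "s \<in> K \<Longrightarrow> f face_of s \<Longrightarrow> f \<in> K"
    "s \<in> K \<Longrightarrow> t \<in> K \<Longrightarrow> (s \<inter> t) face_of s"
  using mfd unfolding piecewise_flat_manifold_def locally_finite_complex_def by auto

text \<open>The intersection is a face of each simplex and meets the relative interior of each,
  hence is all of each.\<close>

lemma rel_interior_eq:
  assumes "s \<in> K" "t \<in> K" "x \<in> rel_interior s" "x \<in> rel_interior t"
  shows "s = t"
proof -
  have x: "x \<in> s" "x \<in> t" using assms rel_interior_subset by auto
  have "s \<inter> t = s"
    using face_of_disjoint_rel_interior[OF complex(3)[OF assms(1,2)]] x assms by blast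
  moreover have "t \<inter> s = t"
    using face_of_disjoint_rel_interior[OF complex(3)[OF assms(2,1)]] x assms by blast
  ultimately show ?thesis by blast
qed

lemma face_of_sub: "f \<in> K \<Longrightarrow> s \<in> K \<Longrightarrow> f \<subseteq> s \<Longrightarrow> f face_of s"
  using complex(3)[of s f] by (simp add: Int_absorb1)

lemma top_in: "\<sigma> \<in> top_simplices n K \<Longrightarrow> \<sigma> \<in> K" "\<sigma> \<in> top_simplices n K \<Longrightarrow> int n simplex \<sigma>"
  by (simp_all add: top_simplices_def)

lemma hinge_in: "f \<in> hinges n K \<Longrightarrow> f \<in> K" "f \<in> hinges n K \<Longrightarrow> (int n - 1) simplex f"
  by (simp_all add: hinges_def)

lemma hinge_nonempty: "f \<in> hinges n K \<Longrightarrow> f \<noteq> {}"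
  using n hinge_in(2)[of f] by (metis diff_ge_0_iff_ge int_one_le_iff_zero_less le_eq_less_or_eq of_nat_1 of_nat_mono simplex_empty zle_diff1_eq not_one_le_zero diff_0 le_minus_one_simps(1))

lemma top_nonempty: "\<sigma> \<in> top_simplices n K \<Longrightarrow> \<sigma> \<noteq> {}"
  using top_in(2)[of \<sigma>] by auto

lemma dim_top: "\<sigma> \<in> top_simplices n K \<Longrightarrow> dim (dirs \<sigma>) = n"
  using dim_dirs[of \<sigma>] top_nonempty aff_dim_simplex[OF top_in(2)] by fastforce

lemma dim_hinge: "f \<in> hinges n K \<Longrightarrow> dim (dirs f) = n - 1"
  using dim_dirs[of f] hinge_nonempty aff_dim_simplex[OF hinge_in(2)] n by fastforce

lemma convex_top: "\<sigma> \<in> top_simplices n K \<Longrightarrow> convex \<sigma>"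
  using top_in(2) convex_simplex by blast

lemma convex_hinge: "f \<in> hinges n K \<Longrightarrow> convex f"
  using hinge_in(2) convex_simplex by blast

lemma hinge_not_top: "f \<in> hinges n K \<Longrightarrow> f \<notin> top_simplices n K"
  using aff_dim_simplex[OF hinge_in(2), of f] aff_dim_simplex[OF top_in(2), of f] by auto

lemma ri_hinge_nonempty: "f \<in> hinges n K \<Longrightarrow> rel_interior f \<noteq> {}"
  using convex_hinge hinge_nonempty by (simp add: rel_interior_eq_empty)

lemma ri_top_nonempty: "\<sigma> \<in> top_simplices n K \<Longrightarrow> rel_interior \<sigma> \<noteq> {}"
  using convex_top top_nonempty by (simp add: rel_interior_eq_empty)

section \<open>Conormals of facets\<close>

abbreviation "facet f \<sigma> \<equiv> f \<in> hinges n K \<and> \<sigma> \<in> top_simplices n K \<and> f \<subseteq> \<sigma>"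

text \<open>Faces of a polyhedron are exposed, and the supporting hyperplane can be chosen with its
  normal \<open>a\<close> parallel to the affine hull of \<open>\<sigma>\<close>. That normal points
  outwards, hence the minus sign in \<open>?m\<close>.\<close>

lemma conormal_ex:
  assumes F: "facet f \<sigma>"
  shows "\<exists>m. norm m = 1 \<and> m \<in> dirs \<sigma> \<and> (\<forall>w\<in>dirs f. w \<bullet> m = 0) \<and> (\<forall>x\<in>f. \<forall>y\<in>\<sigma>. 0 \<le> m \<bullet> (y - x))"
proof -
  have face: "f face_of \<sigma>" using F face_of_sub hinge_in top_in by blast
  have ne: "f \<noteq> \<sigma>" "f \<noteq> {}" using F hinge_not_top hinge_nonempty by auto
  have "polyhedron \<sigma>" using F top_in simplex_imp_polyhedron by blast
  then have "f exposed_face_of \<sigma>" using face by (simp add: exposed_face_of_polyhedron)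
  then obtain a b where ab: "\<sigma> \<subseteq> {x. a \<bullet> x \<le> b}" "f = \<sigma> \<inter> {x. a \<bullet> x = b}" "a \<noteq> 0"
      "\<forall>w\<in>affine hull \<sigma>. w + a \<in> affine hull \<sigma>"
    using ne unfolding exposed_face_of_parallel by blast
  obtain x where x: "x \<in> f" using ne by auto
  then have x\<sigma>: "x \<in> \<sigma>" using F by auto
  have "x + a \<in> affine hull \<sigma>" using ab(4) x\<sigma> by (simp add: hull_inc)
  then have a: "a \<in> dirs \<sigma>" using affine_hull_iff_dirs[OF x\<sigma>] by simp
  let ?m = "(- 1 / norm a) *\<^sub>R a"
  have "w \<bullet> a = 0" if "w \<in> dirs f" for w
    using that unfolding dirs_def
  proof (induction rule: span_induct)
    case base
    then show ?case by (rule subspace_hyperplane2)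
  next
    case (step w)
    then show ?case using ab(2) by (auto simp: inner_diff_left inner_diff_right inner_commute)
  qed
  then have "\<forall>w\<in>dirs f. w \<bullet> ?m = 0" by simp
  moreover have "norm ?m = 1" using ab(3) by simp
  moreover have "?m \<in> dirs \<sigma>" by (rule subspace_scale[OF subspace_dirs a])
  moreover have "0 \<le> ?m \<bullet> (v - y)" if "y \<in> f" "v \<in> \<sigma>" for y v
  proof -
    have "a \<bullet> (v - y) \<le> 0" using that ab(1,2) by (auto simp: inner_diff_right)
    then show ?thesis by (simp add: divide_simps mult_le_0_iff)
  qed
  ultimately show ?thesis by blast
qed

lemma conormal:
  assumes F: "facet f \<sigma>"
  shows "norm (conormal \<sigma> f) = 1" "conormal \<sigma> f \<in> dirs \<sigma>" "\<And>w. w \<in> dirs f \<Longrightarrow> w \<bullet> conormal \<sigma> f = 0"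
    "\<And>x y. x \<in> f \<Longrightarrow> y \<in> \<sigma> \<Longrightarrow> 0 \<le> conormal \<sigma> f \<bullet> (y - x)"
  using someI_ex[OF conormal_ex[OF F]] unfolding conormal_def[symmetric] by blast+

text \<open>One inclusion is orthogonality of the conormal; equality follows because both spaces
  have dimension \<open>n - 1\<close>.\<close>

lemma dirs_facet:
  assumes F: "facet f \<sigma>"
  shows "dirs f = {x \<in> dirs \<sigma>. x \<bullet> conormal \<sigma> f = 0}"
proof -
  let ?m = "conormal \<sigma> f"
  let ?H = "{x \<in> dirs \<sigma>. x \<bullet> ?m = 0}"
  have sub: "subspace ?H"
    by (auto intro!: subspaceI simp: subspace_add subspace_scale subspace_0 inner_add_left)
  have "dim {y \<in> dirs \<sigma>. \<forall>x \<in> span {?m}. orthogonal x y} + dim (span {?m}) = dim (dirs \<sigma>)"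
    using conormal(2)[OF F] by (intro dim_subspace_orthogonal_to_vectors) (auto dest!: subsetD[OF span_minimal, rotated 2])
  moreover have "{y \<in> dirs \<sigma>. \<forall>x \<in> span {?m}. orthogonal x y} = ?H"
    by (auto simp: orthogonal_def span_singleton inner_commute)
  moreover have "dim (span {?m}) = 1" using conormal(1)[OF F] by (auto simp: dim_span)
  ultimately have "dim ?H = n - 1" using dim_top F by simp
  moreover have "dirs f \<subseteq> ?H"
    using conormal(3)[OF F] dirs_mono F by blast
  ultimately show ?thesis
    using dim_hinge F sub subspace_dim_equal[OF subspace_dirs sub, of f] by simp
qed

lemma conormal_pos:
  assumes F: "facet f \<sigma>" and x: "x \<in> f" and y: "y \<in> \<sigma>" "y \<notin> f"
  shows "0 < conormal \<sigma> f \<bullet> (y - x)"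
proof (rule ccontr)
  assume "\<not> ?thesis"
  then have "conormal \<sigma> f \<bullet> (y - x) = 0" using conormal(4)[OF F x y(1)] by simp
  moreover have "y - x \<in> dirs \<sigma>" using F x y by (auto simp: diff_in_dirs)
  ultimately have "y - x \<in> dirs f" using dirs_facet[OF F] by (simp add: inner_commute)
  then have "y \<in> affine hull f" using affine_hull_iff_dirs[OF x] by simp
  moreover have "f face_of \<sigma>" using F face_of_sub hinge_in top_in by blast
  ultimately have "y \<in> f" using face_of_imp_eq_affine_Int[OF convex_top] F y by blast
  then show False using y by simp
qed

lemma ri_top_not_hinge:
  assumes "facet f \<sigma>" "y \<in> rel_interior \<sigma>" shows "y \<in> \<sigma>" "y \<notin> f"
proof -
  show "y \<in> \<sigma>" using assms rel_interior_subset by blast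
  have "f face_of \<sigma>" "f \<noteq> \<sigma>" using assms face_of_sub hinge_in top_in hinge_not_top by blast+
  then show "y \<notin> f" using face_of_disjoint_rel_interior assms by blast
qed

text \<open>Take \<open>q\<close> in the open simplex and write \<open>u\<close> as a positive
  multiple of \<open>q - p\<close> plus a vector \<open>w\<close> along \<open>f\<close>. For small
  \<open>s\<close> the point then lies strictly between \<open>q\<close> and a point
  \<open>b\<close> of \<open>f\<close> close to \<open>p\<close>.\<close>

lemma inward:
  assumes F: "facet f \<sigma>" and p: "p \<in> rel_interior f" and u: "u \<in> dirs \<sigma>" "0 < u \<bullet> conormal \<sigma> f"
  shows "\<forall>\<^sub>F s in at_right 0. p + s *\<^sub>R u \<in> rel_interior \<sigma>"
proof -
  let ?m = "conormal \<sigma> f"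
  obtain q where q: "q \<in> rel_interior \<sigma>" using ri_top_nonempty F by auto
  have pf: "p \<in> f" and p\<sigma>: "p \<in> \<sigma>" using p rel_interior_subset F by auto
  note q' = ri_top_not_hinge[OF F q]
  define d where "d = ?m \<bullet> (q - p)"
  have d: "0 < d" unfolding d_def by (rule conormal_pos[OF F pf q'])
  define \<alpha> where "\<alpha> = (u \<bullet> ?m) / d"
  have \<alpha>: "0 < \<alpha>" using u d by (simp add: \<alpha>_def)
  define w where "w = u - \<alpha> *\<^sub>R (q - p)"
  have "w \<in> dirs \<sigma>" unfolding w_def
    by (rule subspace_diff[OF subspace_dirs u(1) subspace_scale[OF subspace_dirs diff_in_dirs[OF q'(1) p\<sigma>]]])
  moreover have "w \<bullet> ?m = 0"
    using d by (simp add: w_def inner_diff_left \<alpha>_def d_def inner_commute[of ?m] )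
  ultimately have w: "w \<in> dirs f" using dirs_facet[OF F] by simp
  obtain e where e: "0 < e" "cball p e \<inter> affine hull f \<subseteq> f"
    using p unfolding rel_interior_cball by auto
  have "continuous (at_right 0) (\<lambda>s. (s / (1 - s * \<alpha>)) *\<^sub>R w)"
    by (intro continuous_intros) auto
  then have "((\<lambda>s. (s / (1 - s * \<alpha>)) *\<^sub>R w) \<longlongrightarrow> 0) (at_right 0)"
    by (auto simp: continuous_within)
  then have ev1: "\<forall>\<^sub>F s in at_right 0. norm ((s / (1 - s * \<alpha>)) *\<^sub>R w) < e"
    using e(1) by (auto simp: tendsto_iff)
  have ev2: "\<forall>\<^sub>F s in at_right 0. 0 < s \<and> s < 1 / \<alpha>"
    unfolding eventually_at_right_field using \<alpha> by (intro exI[of _ "1 / \<alpha>"]) auto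
  from ev1 ev2 show ?thesis
  proof eventually_elim
    fix s assume s1: "norm ((s / (1 - s * \<alpha>)) *\<^sub>R w) < e" and s: "0 < s \<and> s < 1 / \<alpha>"
    \<comment> \<open>Solves \<open>p + s *\<^sub>R u = (s * \<alpha>) *\<^sub>R q + (1 - s *
      \<alpha>) *\<^sub>R b\<close> for \<open>b\<close>.\<close>
    define b where "b = p + (s / (1 - s * \<alpha>)) *\<^sub>R w"
    have sa: "0 < s * \<alpha>" "s * \<alpha> < 1" using s \<alpha> by (auto simp: field_simps)
    have "b \<in> cball p e" using s1 by (simp add: b_def dist_norm)
    moreover have "b \<in> affine hull f"
      unfolding affine_hull_iff_dirs[OF pf] b_def using w by (simp add: subspace_scale)
    ultimately have "b \<in> closure \<sigma>" using e F closure_subset by blast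
    then have os: "open_segment q b \<subseteq> rel_interior \<sigma>"
      using rel_interior_closure_convex_segment[OF convex_top q] F by blast
    have "b \<in> f" using e \<open>b \<in> cball p e\<close> \<open>b \<in> affine hull f\<close> by blast
    then have qb: "q \<noteq> b" using q' by auto
    have "(1 - s * \<alpha>) *\<^sub>R b = (1 - s * \<alpha>) *\<^sub>R p + s *\<^sub>R w"
      using sa by (simp add: b_def scaleR_add_right)
    then have "p + s *\<^sub>R u = (1 - (1 - s * \<alpha>)) *\<^sub>R q + (1 - s * \<alpha>) *\<^sub>R b"
      by (simp add: w_def algebra_simps)
    moreover have "(1 - (1 - s * \<alpha>)) *\<^sub>R q + (1 - s * \<alpha>) *\<^sub>R b \<in> open_segment q b"
      using qb sa unfolding in_segment by (intro conjI exI[of _ "1 - s * \<alpha>"]) auto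
    ultimately show "p + s *\<^sub>R u \<in> rel_interior \<sigma>" using os by auto
  qed
qed

section \<open>Adjacent simplices and the rotation at a hinge\<close>

lemma adjacent_sym: "adjacent_at n K f \<sigma> \<tau> \<Longrightarrow> adjacent_at n K f \<tau> \<sigma>"
  by (auto simp: adjacent_at_def)

lemma adjacent_facet: "adjacent_at n K f \<sigma> \<tau> \<Longrightarrow> facet f \<sigma>" "adjacent_at n K f \<sigma> \<tau> \<Longrightarrow> facet f \<tau>"
  by (auto simp: adjacent_at_def)

lemma hinge_card: "f \<in> hinges n K \<Longrightarrow> card {\<sigma> \<in> top_simplices n K. f \<subseteq> \<sigma>} = 2"
  using mfd unfolding piecewise_flat_manifold_def by blast

lemma adjacent_cases:
  assumes "adjacent_at n K f \<sigma> \<tau>" "facet f \<rho>"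
  shows "\<rho> = \<sigma> \<or> \<rho> = \<tau>"
proof (rule ccontr)
  assume *: "\<not> ?thesis"
  have c: "card {\<sigma> \<in> top_simplices n K. f \<subseteq> \<sigma>} = 2" using hinge_card assms by blast
  then have "finite {\<sigma> \<in> top_simplices n K. f \<subseteq> \<sigma>}" by (intro card_ge_0_finite) simp
  moreover have "{\<rho>, \<sigma>, \<tau>} \<subseteq> {\<sigma> \<in> top_simplices n K. f \<subseteq> \<sigma>}" using assms by (auto simp: adjacent_at_def)
  ultimately have "card {\<rho>, \<sigma>, \<tau>} \<le> 2" using c card_mono by metis
  moreover have "card {\<rho>, \<sigma>, \<tau>} = 3" using * assms by (auto simp: adjacent_at_def)
  ultimately show False by simp
qed

definition other :: "'a set \<Rightarrow> 'a set \<Rightarrow> 'a set" where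
  "other f \<sigma> = (THE \<tau>. adjacent_at n K f \<sigma> \<tau>)"

lemma other_unique: "adjacent_at n K f \<sigma> \<tau> \<Longrightarrow> adjacent_at n K f \<sigma> \<tau>' \<Longrightarrow> \<tau> = \<tau>'"
  using adjacent_cases[of f \<sigma> \<tau> \<tau>'] by (auto simp: adjacent_at_def)

lemma other_eq: "adjacent_at n K f \<sigma> \<tau> \<Longrightarrow> other f \<sigma> = \<tau>"
  unfolding other_def by (rule the_equality) (blast dest: other_unique)+

lemma adjacent_other:
  assumes F: "facet f \<sigma>" shows "adjacent_at n K f \<sigma> (other f \<sigma>)"
proof -
  have "card {\<sigma> \<in> top_simplices n K. f \<subseteq> \<sigma>} = 2" using hinge_card F by blast
  then obtain x y where "{\<sigma> \<in> top_simplices n K. f \<subseteq> \<sigma>} = {x, y}" "x \<noteq> y" by (auto simp: card_2_iff)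
  then have xy: "\<rho> \<in> top_simplices n K \<and> f \<subseteq> \<rho> \<longleftrightarrow> \<rho> = x \<or> \<rho> = y" for \<rho> by blast
  have "adjacent_at n K f \<sigma> (if \<sigma> = x then y else x)"
    using F xy[of \<sigma>] xy[of x] xy[of y] \<open>x \<noteq> y\<close> by (auto simp: adjacent_at_def)
  then show ?thesis using other_eq by metis
qed

lemma normal:
  assumes "\<sigma> \<in> top_simplices n K"
  shows "norm (\<nu> \<sigma>) = 1" "\<And>w. w \<in> dirs \<sigma> \<Longrightarrow> w \<bullet> \<nu> \<sigma> = 0"
  using nrm assms unfolding positive_normals_def by auto

text \<open>Codimension one: the orthogonal complement of the directions of \<open>\<sigma>\<close>
  is the line spanned by its normal.\<close>

lemma orthogonal_to_top:
  assumes \<sigma>: "\<sigma> \<in> top_simplices n K" and x: "\<And>w. w \<in> dirs \<sigma> \<Longrightarrow> w \<bullet> x = 0"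
  shows "x = (x \<bullet> \<nu> \<sigma>) *\<^sub>R \<nu> \<sigma>"
proof -
  let ?C = "{y \<in> UNIV. \<forall>x\<in>dirs \<sigma>. orthogonal x y}"
  have "dim ?C + dim (dirs \<sigma>) = dim (UNIV :: 'a set)"
    by (rule dim_subspace_orthogonal_to_vectors) auto
  then have dC: "dim ?C = 1" using dim_top[OF \<sigma>] dimA by simp
  have subC: "subspace ?C"
    by (auto intro!: subspaceI simp: orthogonal_def inner_add_right)
  have "span {\<nu> \<sigma>} \<subseteq> ?C"
    using normal[OF \<sigma>] subC by (intro span_minimal) (auto simp: orthogonal_def)
  moreover have "dim (span {\<nu> \<sigma>}) = 1" using normal(1)[OF \<sigma>] by auto
  ultimately have "span {\<nu> \<sigma>} = ?C" using dC subC by (intro subspace_dim_equal) auto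
  moreover have "x \<in> ?C" using x by (auto simp: orthogonal_def)
  ultimately have "x \<in> span {\<nu> \<sigma>}" by blast
  then obtain k where k: "x = k *\<^sub>R \<nu> \<sigma>" by (auto simp: span_singleton)
  moreover have "\<nu> \<sigma> \<bullet> \<nu> \<sigma> = 1" using normal(1)[OF \<sigma>] by (simp add: norm_eq_1)
  ultimately show ?thesis by simp
qed

text \<open>Both conormals are orthogonal to \<open>f\<close>, and the vectors orthogonal to
  \<open>f\<close> form the plane spanned by the conormal and the normal of
  \<open>\<sigma>\<close>.\<close>

lemma adjacent_conormal_plane:
  assumes A: "adjacent_at n K f \<sigma> \<tau>"
  shows "conormal \<tau> f = (conormal \<sigma> f \<bullet> conormal \<tau> f) *\<^sub>R conormal \<sigma> f + (\<nu> \<sigma> \<bullet> conormal \<tau> f) *\<^sub>R \<nu> \<sigma>"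
    and "(conormal \<sigma> f \<bullet> conormal \<tau> f)\<^sup>2 + (\<nu> \<sigma> \<bullet> conormal \<tau> f)\<^sup>2 = 1"
proof -
  let ?m = "conormal \<sigma> f" and ?m' = "conormal \<tau> f"
  note F = adjacent_facet[OF A]
  have mm: "?m \<bullet> ?m = 1" "?m' \<bullet> ?m' = 1" using conormal(1)[OF F(1)] conormal(1)[OF F(2)] by (auto simp: norm_eq_1)
  have \<sigma>: "\<sigma> \<in> top_simplices n K" using F by simp
  have NN: "\<nu> \<sigma> \<bullet> \<nu> \<sigma> = 1" using normal(1)[OF \<sigma>] by (simp add: norm_eq_1)
  have mN: "?m \<bullet> \<nu> \<sigma> = 0" using normal(2)[OF \<sigma>] conormal(2)[OF F(1)] by simp
  define x where "x = ?m' - (?m \<bullet> ?m') *\<^sub>R ?m"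
  have "w \<bullet> x = 0" if w: "w \<in> dirs \<sigma>" for w
  proof -
    have "w - (w \<bullet> ?m) *\<^sub>R ?m \<in> dirs f"
      unfolding dirs_facet[OF F(1)] using w conormal(2)[OF F(1)] mm
      by (auto simp: inner_diff_left intro!: subspace_diff subspace_scale)
    then have "(w - (w \<bullet> ?m) *\<^sub>R ?m) \<bullet> ?m' = 0" using conormal(3)[OF F(2)] by blast
    then show ?thesis by (simp add: x_def inner_diff_left inner_diff_right)
  qed
  from orthogonal_to_top[OF \<sigma> this] have "x = (x \<bullet> \<nu> \<sigma>) *\<^sub>R \<nu> \<sigma>" .
  moreover have "x \<bullet> \<nu> \<sigma> = \<nu> \<sigma> \<bullet> ?m'" using mN by (simp add: x_def inner_diff_left inner_diff_right inner_commute)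
  ultimately show 1: "?m' = (?m \<bullet> ?m') *\<^sub>R ?m + (\<nu> \<sigma> \<bullet> ?m') *\<^sub>R \<nu> \<sigma>"
    unfolding x_def by (metis add.commute diff_add_cancel)
  have "?m' \<bullet> ?m' = ?m' \<bullet> ((?m \<bullet> ?m') *\<^sub>R ?m + (\<nu> \<sigma> \<bullet> ?m') *\<^sub>R \<nu> \<sigma>)" using 1 by simp
  then show "(?m \<bullet> ?m')\<^sup>2 + (\<nu> \<sigma> \<bullet> ?m')\<^sup>2 = 1"
    using mm by (simp add: inner_add_right inner_commute power2_eq_square)
qed

text \<open>In the plane orthogonal to \<open>f\<close>, with the normal and the conormal of
  \<open>\<sigma>\<close> as axes, the coordinates of \<open>conormal \<tau> f\<close> are
  \<open>sin \<epsilon>\<close> and \<open>- cos \<epsilon>\<close>. The rule for consistent normals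
  then gives \<open>\<nu> \<tau>\<close>.\<close>

lemma adjacent_angle:
  assumes A: "adjacent_at n K f \<sigma> \<tau>" and e: "\<epsilon> = pi / 2 - normal_inward_angle \<nu> f \<sigma> \<tau>" "\<bar>\<epsilon>\<bar> < 1"
  shows "conormal \<tau> f = sin \<epsilon> *\<^sub>R \<nu> \<sigma> - cos \<epsilon> *\<^sub>R conormal \<sigma> f"
    "\<nu> \<tau> = sin \<epsilon> *\<^sub>R conormal \<sigma> f + cos \<epsilon> *\<^sub>R \<nu> \<sigma>"
proof -
  let ?m = "conormal \<sigma> f" and ?m' = "conormal \<tau> f"
  note F = adjacent_facet[OF A]
  define a where "a = ?m \<bullet> ?m'"
  define b where "b = \<nu> \<sigma> \<bullet> ?m'"
  note P = adjacent_conormal_plane[OF A, folded a_def b_def]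
  have v: "vangle (\<nu> \<sigma>) ?m' = arccos b"
    using normal(1)[of \<sigma>] conormal(1)[OF F(2)] F by (simp add: vangle_def b_def)
  have b1: "\<bar>b\<bar> \<le> 1"
    using P(2) by (metis abs_le_square_iff abs_one le_add_same_cancel2 one_power2 zero_le_power2)
  have ar: "0 \<le> arccos b" "arccos b \<le> pi" using b1 by (auto intro: arccos_lbound arccos_ubound)
  have a0: "a \<le> 0"
  \<comment> \<open>In the two acute cases of \<open>normal_inward_angle\<close> the absolute value
    of \<open>\<epsilon>\<close> is at least \<open>pi / 2\<close>, so smallness of the angle
    excludes them.\<close>
  proof (rule ccontr)
    assume "\<not> a \<le> 0"
    then have "\<epsilon> = (if 0 \<le> b then pi / 2 + arccos b else arccos b - pi - pi / 2)"
      using e(1) v unfolding normal_inward_angle_def a_def b_def by simp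
    moreover have "2 \<le> pi" using pi_ge_two .
    ultimately show False using e(2) ar by (auto split: if_splits)
  qed
  then have eb: "\<epsilon> = pi / 2 - arccos b" using e(1) v unfolding normal_inward_angle_def a_def b_def by simp
  have sb: "sin \<epsilon> = b" unfolding eb using b1 by (simp add: sin_diff)
  have "cos \<epsilon> = sqrt (1 - b\<^sup>2)" unfolding eb using b1 by (simp add: cos_diff sin_arccos_abs)
  also have "1 - b\<^sup>2 = a\<^sup>2" using P(2) by simp
  finally have cb: "cos \<epsilon> = - a" using a0 by simp
  show "?m' = sin \<epsilon> *\<^sub>R \<nu> \<sigma> - cos \<epsilon> *\<^sub>R ?m" using P(1) sb cb by simp
  have "\<nu> \<tau> = (?m' \<bullet> \<nu> \<sigma>) *\<^sub>R ?m - (?m \<bullet> ?m') *\<^sub>R \<nu> \<sigma>"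
    using nrm A unfolding positive_normals_def by blast
  then show "\<nu> \<tau> = sin \<epsilon> *\<^sub>R ?m + cos \<epsilon> *\<^sub>R \<nu> \<sigma>"
    using sb cb by (simp add: a_def b_def inner_commute)
qed

text \<open>The choice between the two orders of the simplices in \<^const>\<open>hinge_angle\<close> does not matter:
  in terms of normal and conormal, passing from one to the other is a symmetric orthogonal matrix, its own inverse.\<close>
lemma hinge_rotation:
  assumes A: "adjacent_at n K f \<sigma> \<tau>" and e: "\<bar>hinge_angle n K \<nu> f\<bar> < 1"
  shows "conormal \<tau> f = sin (hinge_angle n K \<nu> f) *\<^sub>R \<nu> \<sigma> - cos (hinge_angle n K \<nu> f) *\<^sub>R conormal \<sigma> f"
    "\<nu> \<tau> = sin (hinge_angle n K \<nu> f) *\<^sub>R conormal \<sigma> f + cos (hinge_angle n K \<nu> f) *\<^sub>R \<nu> \<sigma>"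
proof -
  let ?\<epsilon> = "hinge_angle n K \<nu> f"
  obtain \<sigma>1 \<tau>1 where c: "(SOME (\<sigma>, \<tau>). adjacent_at n K f \<sigma> \<tau>) = (\<sigma>1, \<tau>1)" by fastforce
  have "case (SOME (\<sigma>, \<tau>). adjacent_at n K f \<sigma> \<tau>) of (\<sigma>, \<tau>) \<Rightarrow> adjacent_at n K f \<sigma> \<tau>"
    by (rule someI_ex) (use A in auto)
  then have A1: "adjacent_at n K f \<sigma>1 \<tau>1" using c by simp
  have e1: "?\<epsilon> = pi / 2 - normal_inward_angle \<nu> f \<sigma>1 \<tau>1"
    unfolding hinge_angle_def by (simp add: c)
  note R = adjacent_angle[OF A1 e1 e]
  have sc: "sin ?\<epsilon> * sin ?\<epsilon> + cos ?\<epsilon> * cos ?\<epsilon> = 1" using sin_cos_squared_add[of ?\<epsilon>] by (simp add: power2_eq_square)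
  have "(\<sigma> = \<sigma>1 \<and> \<tau> = \<tau>1) \<or> (\<sigma> = \<tau>1 \<and> \<tau> = \<sigma>1)"
    using adjacent_cases[OF A1 adjacent_facet(1)[OF A]] adjacent_cases[OF A1 adjacent_facet(2)[OF A]] A
    by (auto simp: adjacent_at_def)
  then have "conormal \<tau> f = sin ?\<epsilon> *\<^sub>R \<nu> \<sigma> - cos ?\<epsilon> *\<^sub>R conormal \<sigma> f \<and>
    \<nu> \<tau> = sin ?\<epsilon> *\<^sub>R conormal \<sigma> f + cos ?\<epsilon> *\<^sub>R \<nu> \<sigma>"
  proof
    assume "\<sigma> = \<sigma>1 \<and> \<tau> = \<tau>1" then show ?thesis using R by simp
  next
    assume *: "\<sigma> = \<tau>1 \<and> \<tau> = \<sigma>1"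
    have "sin ?\<epsilon> *\<^sub>R \<nu> \<tau>1 - cos ?\<epsilon> *\<^sub>R conormal \<tau>1 f = (sin ?\<epsilon> * sin ?\<epsilon> + cos ?\<epsilon> * cos ?\<epsilon>) *\<^sub>R conormal \<sigma>1 f"
      unfolding R by (simp add: algebra_simps flip: scaleR_add_left)
    moreover have "sin ?\<epsilon> *\<^sub>R conormal \<tau>1 f + cos ?\<epsilon> *\<^sub>R \<nu> \<tau>1 = (sin ?\<epsilon> * sin ?\<epsilon> + cos ?\<epsilon> * cos ?\<epsilon>) *\<^sub>R \<nu> \<sigma>1"
      unfolding R by (simp add: algebra_simps flip: scaleR_add_left)
    ultimately show ?thesis using * sc by simp
  qed
  then show "conormal \<tau> f = sin ?\<epsilon> *\<^sub>R \<nu> \<sigma> - cos ?\<epsilon> *\<^sub>R conormal \<sigma> f"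
    "\<nu> \<tau> = sin ?\<epsilon> *\<^sub>R conormal \<sigma> f + cos ?\<epsilon> *\<^sub>R \<nu> \<sigma>" by auto
qed

abbreviation "stars h \<equiv> (\<Union>v \<in> h \<inter> vertices K. star K {v})"

lemma stars_iff:
  assumes "f \<in> K" "p \<in> rel_interior f"
  shows "p \<in> stars h \<longleftrightarrow> (\<exists>v \<in> h \<inter> vertices K. v \<in> f)"
proof
  assume "p \<in> stars h"
  then obtain v t where "v \<in> h \<inter> vertices K" "t \<in> K" "v \<in> t" "p \<in> rel_interior t"
    by (auto simp: star_def)
  then show "\<exists>v \<in> h \<inter> vertices K. v \<in> f" using rel_interior_eq[OF assms(1)] assms(2) by blast
next
  assume "\<exists>v \<in> h \<inter> vertices K. v \<in> f"
  then show "p \<in> stars h" using assms by (auto simp: star_def)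
qed

end

section \<open>Uniqueness and extension of geodesics\<close>

text \<open>Stronger than a one-sided derivative: the path coincides with a straight line just after
  \<open>t\<close>. Hence agreement of two paths at \<open>t\<close> in position and velocity
  spreads to nearby times.\<close>

definition right_velocity :: "(real \<Rightarrow> 'a::euclidean_space) \<Rightarrow> real \<Rightarrow> 'a \<Rightarrow> bool" where
  "right_velocity \<gamma> t u \<longleftrightarrow> (\<forall>\<^sub>F s in at_right t. \<gamma> s = \<gamma> t + (s - t) *\<^sub>R u)"

definition left_velocity :: "(real \<Rightarrow> 'a::euclidean_space) \<Rightarrow> real \<Rightarrow> 'a \<Rightarrow> bool" where
  "left_velocity \<gamma> t u \<longleftrightarrow> (\<forall>\<^sub>F s in at_left t. \<gamma> s = \<gamma> t + (s - t) *\<^sub>R u)"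

lemma right_velocity_unique:
  assumes "right_velocity \<gamma> t u" "right_velocity \<gamma> t v" shows "u = v"
proof -
  have "\<forall>\<^sub>F s in at_right t. t < s" by (simp add: eventually_at_filter)
  with assms have "\<forall>\<^sub>F s in at_right t. (s - t) *\<^sub>R u = (s - t) *\<^sub>R v \<and> t < s"
    unfolding right_velocity_def by eventually_elim auto
  then obtain s where "(s - t) *\<^sub>R u = (s - t) *\<^sub>R v \<and> t < s"
    using eventually_happens'[of "at_right t"] by auto
  then show ?thesis by auto
qed

lemma velocity_reverse:
  "right_velocity (\<lambda>s. \<gamma> (- s)) t u \<longleftrightarrow> left_velocity \<gamma> (- t) (- u)"
  "left_velocity (\<lambda>s. \<gamma> (- s)) t u \<longleftrightarrow> right_velocity \<gamma> (- t) (- u)"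
  unfolding right_velocity_def left_velocity_def
  by (simp_all add: at_left_minus[of "- t"] at_left_minus[of t] eventually_filtermap algebra_simps)

lemma left_velocity_unique:
  assumes "left_velocity \<gamma> t u" "left_velocity \<gamma> t v" shows "u = v"
proof -
  have "right_velocity (\<lambda>s. \<gamma> (- s)) (- t) (- u)" "right_velocity (\<lambda>s. \<gamma> (- s)) (- t) (- v)"
    using assms by (simp_all add: velocity_reverse)
  from right_velocity_unique[OF this] show ?thesis by simp
qed

lemma right_velocity_near:
  assumes "right_velocity \<gamma> t u"
  shows "\<forall>\<^sub>F s in at_right t. \<gamma> s = \<gamma> t + (s - t) *\<^sub>R u \<and> right_velocity \<gamma> s u"
proof -
  obtain b where b: "t < b" "\<And>y. t < y \<Longrightarrow> y < b \<Longrightarrow> \<gamma> y = \<gamma> t + (y - t) *\<^sub>R u"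
    using assms unfolding right_velocity_def eventually_at_right_field by blast
  have "right_velocity \<gamma> s u" if s: "t < s" "s < b" for s
    unfolding right_velocity_def eventually_at_right_field
  proof (intro exI[of _ b] conjI allI impI)
    fix y assume "s < y" "y < b"
    then have "\<gamma> y = \<gamma> t + (s - t) *\<^sub>R u + (y - s) *\<^sub>R u"
      using b(2)[of y] s by (simp add: algebra_simps)
    then show "\<gamma> y = \<gamma> s + (y - s) *\<^sub>R u" using b(2)[of s] s by simp
  qed (use s in auto)
  then show ?thesis
    unfolding eventually_at_right_field using b by blast
qed

text \<open>Nearby points to the left are also described by \<open>right_velocity\<close>, so that a
  single invariant serves on both sides of \<open>t\<close>.\<close>

lemma left_velocity_near:
  assumes "left_velocity \<gamma> t u"
  shows "\<forall>\<^sub>F s in at_left t. \<gamma> s = \<gamma> t + (s - t) *\<^sub>R u \<and> right_velocity \<gamma> s u"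
proof -
  obtain b where b: "b < t" "\<And>y. b < y \<Longrightarrow> y < t \<Longrightarrow> \<gamma> y = \<gamma> t + (y - t) *\<^sub>R u"
    using assms unfolding left_velocity_def eventually_at_left_field by blast
  have "right_velocity \<gamma> s u" if s: "b < s" "s < t" for s
    unfolding right_velocity_def eventually_at_right_field
  proof (intro exI[of _ t] conjI allI impI)
    fix y assume "s < y" "y < t"
    then have "\<gamma> y = \<gamma> t + (s - t) *\<^sub>R u + (y - s) *\<^sub>R u"
      using b(2)[of y] s by (simp add: algebra_simps)
    then show "\<gamma> y = \<gamma> s + (y - s) *\<^sub>R u" using b(2)[of s] s by simp
  qed (use s in auto)
  then show ?thesis
    unfolding eventually_at_left_field using b by blast
qed

lemma velocity_cong:
  assumes "\<forall>\<^sub>F s in nhds t. \<gamma> s = \<gamma>' s"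
  shows "right_velocity \<gamma> t u \<longleftrightarrow> right_velocity \<gamma>' t u" "left_velocity \<gamma> t u \<longleftrightarrow> left_velocity \<gamma>' t u" "\<gamma> t = \<gamma>' t"
proof -
  show t: "\<gamma> t = \<gamma>' t" using assms eventually_nhds_x_imp_x by blast
  have "\<forall>\<^sub>F s in at_right t. \<gamma> s = \<gamma>' s" "\<forall>\<^sub>F s in at_left t. \<gamma> s = \<gamma>' s"
    using assms unfolding eventually_at_filter by (auto elim!: eventually_mono)
  then show "right_velocity \<gamma> t u \<longleftrightarrow> right_velocity \<gamma>' t u" "left_velocity \<gamma> t u \<longleftrightarrow> left_velocity \<gamma>' t u"
    unfolding right_velocity_def left_velocity_def t
    by (auto elim: eventually_elim2)
qed

lemma velocity_of_line:
  assumes "\<forall>\<^sub>F s in at t. \<gamma> s = \<gamma> t + (s - t) *\<^sub>R u"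
  shows "right_velocity \<gamma> t u" "left_velocity \<gamma> t u"
  using assms unfolding right_velocity_def left_velocity_def eventually_at_split by auto

lemma vector_derivative_velocity:
  shows "right_velocity \<gamma> t u \<Longrightarrow> vector_derivative \<gamma> (at_right t) = u"
    and "left_velocity \<gamma> t u \<Longrightarrow> vector_derivative \<gamma> (at_left t) = u"
proof -
  have line: "(\<gamma> has_vector_derivative u) (at t within S)"
    if "\<forall>\<^sub>F s in at t within S. \<gamma> s = \<gamma> t + (s - t) *\<^sub>R u" for S
    unfolding has_vector_derivative_def has_derivative_within
  proof (intro conjI tendsto_eventually)
    show "bounded_linear (\<lambda>x. x *\<^sub>R u)" by (rule bounded_linear_scaleR_left)
    show "\<forall>\<^sub>F y in at t within S. (1 / norm (y - t)) *\<^sub>R (\<gamma> y - (\<gamma> t + (y - t) *\<^sub>R u)) = 0"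
      using that by eventually_elim simp
  qed
  { assume "right_velocity \<gamma> t u"
    then have "(\<gamma> has_vector_derivative u) (at_right t)"
      unfolding right_velocity_def by (rule line)
    then show "vector_derivative \<gamma> (at_right t) = u"
      by (rule vector_derivative_within[rotated]) simp }
  { assume "left_velocity \<gamma> t u"
    then have "(\<gamma> has_vector_derivative u) (at_left t)"
      unfolding left_velocity_def by (rule line)
    then show "vector_derivative \<gamma> (at_left t) = u"
      by (rule vector_derivative_within[rotated]) simp }
qed

context flat_manifold
begin

section \<open>Determinism of geodesics\<close>

text \<open>The local rule for geodesics as a relation between incoming velocity \<open>u\<close>
  and outgoing velocity \<open>v\<close> at \<open>p\<close>, without reference to a path.
  Uniqueness of geodesics reduces to this relation being functional in both directions.\<close>

definition passes :: "'a \<Rightarrow> 'a \<Rightarrow> 'a \<Rightarrow> bool" where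
  "passes p u v \<longleftrightarrow>
    (\<exists>\<sigma>\<in>top_simplices n K. p \<in> rel_interior \<sigma> \<and> u \<in> dirs \<sigma> \<and> norm u = 1 \<and> v = u) \<or>
    (\<exists>f \<sigma> \<tau> c w. adjacent_at n K f \<sigma> \<tau> \<and> p \<in> rel_interior f \<and> 0 < c \<and> w \<in> dirs f \<and> c\<^sup>2 + (norm w)\<^sup>2 = 1 \<and>
       u = w - c *\<^sub>R conormal \<sigma> f \<and> v = w + c *\<^sub>R conormal \<tau> f)"

lemma crosses_velocity:
  assumes "crosses_at n K \<gamma> t f \<sigma> \<tau> c w"
  shows "left_velocity \<gamma> t (w - c *\<^sub>R conormal \<sigma> f)" "right_velocity \<gamma> t (w + c *\<^sub>R conormal \<tau> f)"
    "passes (\<gamma> t) (w - c *\<^sub>R conormal \<sigma> f) (w + c *\<^sub>R conormal \<tau> f)"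
  using assms unfolding crosses_at_def left_velocity_def right_velocity_def passes_def by blast+

lemma geodesic_passes:
  "(straight_at n K \<gamma> t \<or> (\<exists>f \<sigma> \<tau> c w. crosses_at n K \<gamma> t f \<sigma> \<tau> c w)) \<longleftrightarrow>
   (\<exists>u v. passes (\<gamma> t) u v \<and> left_velocity \<gamma> t u \<and> right_velocity \<gamma> t v)"
proof
  assume "straight_at n K \<gamma> t \<or> (\<exists>f \<sigma> \<tau> c w. crosses_at n K \<gamma> t f \<sigma> \<tau> c w)"
  then show "\<exists>u v. passes (\<gamma> t) u v \<and> left_velocity \<gamma> t u \<and> right_velocity \<gamma> t v"
  proof (elim disjE exE)
    assume "straight_at n K \<gamma> t"
    then obtain \<sigma> u where "\<sigma> \<in> top_simplices n K" "u \<in> dirs \<sigma>" "norm u = 1" "\<gamma> t \<in> rel_interior \<sigma>"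
        "\<forall>\<^sub>F s in at t. \<gamma> s = \<gamma> t + (s - t) *\<^sub>R u"
      unfolding straight_at_def by blast
    then show ?thesis using velocity_of_line[of \<gamma> t u] unfolding passes_def by blast
  qed (blast dest: crosses_velocity)
next
  assume "\<exists>u v. passes (\<gamma> t) u v \<and> left_velocity \<gamma> t u \<and> right_velocity \<gamma> t v"
  then obtain u v where *: "passes (\<gamma> t) u v" "left_velocity \<gamma> t u" "right_velocity \<gamma> t v" by auto
  from *(1) show "straight_at n K \<gamma> t \<or> (\<exists>f \<sigma> \<tau> c w. crosses_at n K \<gamma> t f \<sigma> \<tau> c w)"
    unfolding passes_def
  proof (elim disjE)
    assume "\<exists>\<sigma>\<in>top_simplices n K. \<gamma> t \<in> rel_interior \<sigma> \<and> u \<in> dirs \<sigma> \<and> norm u = 1 \<and> v = u"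
    then have "straight_at n K \<gamma> t"
      using *(2,3) unfolding straight_at_def left_velocity_def right_velocity_def eventually_at_split by blast
    then show ?thesis ..
  next
    assume "\<exists>f \<sigma> \<tau> c w. adjacent_at n K f \<sigma> \<tau> \<and> \<gamma> t \<in> rel_interior f \<and> 0 < c \<and> w \<in> dirs f \<and> c\<^sup>2 + (norm w)\<^sup>2 = 1 \<and>
       u = w - c *\<^sub>R conormal \<sigma> f \<and> v = w + c *\<^sub>R conormal \<tau> f"
    then obtain f \<sigma> \<tau> c w where "adjacent_at n K f \<sigma> \<tau> \<and> \<gamma> t \<in> rel_interior f \<and> 0 < c \<and> w \<in> dirs f \<and> c\<^sup>2 + (norm w)\<^sup>2 = 1 \<and>
       u = w - c *\<^sub>R conormal \<sigma> f \<and> v = w + c *\<^sub>R conormal \<tau> f" by blast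
    then have "crosses_at n K \<gamma> t f \<sigma> \<tau> c w"
      using *(2,3) unfolding crosses_at_def left_velocity_def right_velocity_def by simp
    then show ?thesis by blast
  qed
qed

lemma geodesic_in_iff:
  "geodesic_in n K W I \<gamma> \<longleftrightarrow> open I \<and> is_interval I \<and> \<gamma> ` I \<subseteq> W \<and>
    (\<forall>t\<in>I. \<exists>u v. passes (\<gamma> t) u v \<and> left_velocity \<gamma> t u \<and> right_velocity \<gamma> t v)"
  unfolding geodesic_in_def geodesic_passes ..

lemma conormal_self: "facet f \<sigma> \<Longrightarrow> conormal \<sigma> f \<bullet> conormal \<sigma> f = 1"
  using conormal(1) by (simp add: norm_eq_1)

text \<open>With equal conormals, \<open>inward\<close> would place the same points in both open
  simplices.\<close>

lemma conormal_distinct: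
  assumes A: "adjacent_at n K f \<sigma> \<tau>" shows "conormal \<sigma> f \<noteq> conormal \<tau> f"
proof
  assume eq: "conormal \<sigma> f = conormal \<tau> f"
  note F = adjacent_facet[OF A]
  obtain p where p: "p \<in> rel_interior f" using ri_hinge_nonempty F by blast
  have "\<forall>\<^sub>F s in at_right 0. p + s *\<^sub>R conormal \<sigma> f \<in> rel_interior \<sigma>"
    using conormal_self[OF F(1)] conormal(2)[OF F(1)] by (intro inward[OF F(1) p]) auto
  moreover have "\<forall>\<^sub>F s in at_right 0. p + s *\<^sub>R conormal \<sigma> f \<in> rel_interior \<tau>"
    unfolding eq using conormal_self[OF F(2)] conormal(2)[OF F(2)] by (intro inward[OF F(2) p]) auto
  ultimately have "\<forall>\<^sub>F s in at_right (0::real). \<sigma> = \<tau>"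
    by eventually_elim (use rel_interior_eq F top_in in blast)
  then show False using A by (simp add: adjacent_at_def)
qed

text \<open>Two decompositions of one incoming velocity at a hinge have the same part
  \<open>w\<close> along it, because \<open>w - w'\<close> is orthogonal to both conormals. Then the
  speeds and the conormals agree; the conormal identifies the incoming simplex, and this one the
  outgoing simplex.\<close>

lemma passes_fun:
  assumes "passes p u v" "passes p u v'" shows "v = v'"
proof -
  have False if "\<sigma> \<in> top_simplices n K" "p \<in> rel_interior \<sigma>" "adjacent_at n K f \<sigma>' \<tau>" "p \<in> rel_interior f" for \<sigma> f \<sigma>' \<tau>
  proof -
    have "\<sigma> = f" using that rel_interior_eq top_in hinge_in unfolding adjacent_at_def by blast
    then show False using that hinge_not_top unfolding adjacent_at_def by blast
  qed
  moreover have "w + c *\<^sub>R conormal \<tau> f = w' + c' *\<^sub>R conormal \<tau>' f'"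
    if A: "adjacent_at n K f \<sigma> \<tau>" "p \<in> rel_interior f" "0 < c" "w \<in> dirs f"
      and A': "adjacent_at n K f' \<sigma>' \<tau>'" "p \<in> rel_interior f'" "0 < c'" "w' \<in> dirs f'"
      and eq: "w - c *\<^sub>R conormal \<sigma> f = w' - c' *\<^sub>R conormal \<sigma>' f'" for f \<sigma> \<tau> c w f' \<sigma>' \<tau>' c' w'
  proof -
    note F = adjacent_facet[OF A(1)] adjacent_facet[OF A'(1)]
    have ff: "f' = f" using A A' rel_interior_eq hinge_in unfolding adjacent_at_def by blast
    have "(w - w') \<bullet> (w - w') = (w - w') \<bullet> (c *\<^sub>R conormal \<sigma> f - c' *\<^sub>R conormal \<sigma>' f)"
    proof -
      have "w - w' = c *\<^sub>R conormal \<sigma> f - c' *\<^sub>R conormal \<sigma>' f" using eq ff by (simp add: algebra_simps)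
      then show ?thesis by simp
    qed
    also have "\<dots> = 0"
      using conormal(3)[OF F(1)] conormal(3)[OF F(3)] A(4) A'(4) ff
      by (simp add: inner_diff_left inner_diff_right)
    finally have ww: "w = w'" by simp
    then have cc: "c *\<^sub>R conormal \<sigma> f = c' *\<^sub>R conormal \<sigma>' f" using eq ff by simp
    then have "norm (c *\<^sub>R conormal \<sigma> f) = norm (c' *\<^sub>R conormal \<sigma>' f)" by simp
    then have c: "c = c'" using conormal(1)[OF F(1)] conormal(1)[OF F(3)] A A' ff by simp
    then have cm: "conormal \<sigma> f = conormal \<sigma>' f" using cc A by simp
    have "\<sigma>' = \<sigma> \<or> \<sigma>' = \<tau>" using adjacent_cases[OF A(1)] F(3) ff by blast
    then have "\<sigma>' = \<sigma>" using conormal_distinct[OF A(1)] cm by auto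
    then have "\<tau> = \<tau>'" using other_unique A(1) A'(1) ff by blast
    then show ?thesis using ww c ff by simp
  qed
  ultimately show ?thesis
    using assms unfolding passes_def by (elim disjE exE conjE bexE) (blast | metis)+
qed

lemma passes_reverse: "passes p u v \<Longrightarrow> passes p (- v) (- u)"
  unfolding passes_def
proof (elim disjE)
  assume "\<exists>f \<sigma> \<tau> c w. adjacent_at n K f \<sigma> \<tau> \<and> p \<in> rel_interior f \<and> 0 < c \<and> w \<in> dirs f \<and> c\<^sup>2 + (norm w)\<^sup>2 = 1 \<and>
       u = w - c *\<^sub>R conormal \<sigma> f \<and> v = w + c *\<^sub>R conormal \<tau> f"
  then obtain f \<sigma> \<tau> c w where "adjacent_at n K f \<sigma> \<tau>" "p \<in> rel_interior f" "0 < c" "w \<in> dirs f" "c\<^sup>2 + (norm w)\<^sup>2 = 1"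
       "u = w - c *\<^sub>R conormal \<sigma> f" "v = w + c *\<^sub>R conormal \<tau> f" by blast
  then have "adjacent_at n K f \<tau> \<sigma> \<and> p \<in> rel_interior f \<and> 0 < c \<and> - w \<in> dirs f \<and> c\<^sup>2 + (norm (- w))\<^sup>2 = 1 \<and>
       - v = - w - c *\<^sub>R conormal \<tau> f \<and> - u = - w + c *\<^sub>R conormal \<sigma> f"
    by (auto simp: adjacent_at_def subspace_neg)
  then show "(\<exists>\<sigma>\<in>top_simplices n K. p \<in> rel_interior \<sigma> \<and> - v \<in> dirs \<sigma> \<and> norm (- v) = 1 \<and> - u = - v) \<or>
    (\<exists>f \<sigma> \<tau> c w. adjacent_at n K f \<sigma> \<tau> \<and> p \<in> rel_interior f \<and> 0 < c \<and> w \<in> dirs f \<and> c\<^sup>2 + (norm w)\<^sup>2 = 1 \<and>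
       - v = w - c *\<^sub>R conormal \<sigma> f \<and> - u = w + c *\<^sub>R conormal \<tau> f)" by blast
qed (auto simp: subspace_neg)

lemma passes_inj: "passes p u v \<Longrightarrow> passes p u' v \<Longrightarrow> u = u'"
  using passes_fun[OF passes_reverse passes_reverse] by fastforce

text \<open>Agreement in position and right velocity is a locally constant property on the interval
  \<open>I \<inter> J\<close>. To the right of a time the outgoing velocities decide, to the left
  the incoming ones, and \<open>passes\<close> makes these two conditions equivalent.\<close>

lemma geodesic_unique:
  assumes g: "geodesic_in n K W I \<gamma>" and g': "geodesic_in n K W' J \<gamma>'"
    and s0: "s0 \<in> I" "s0 \<in> J" "\<gamma> s0 = \<gamma>' s0" "right_velocity \<gamma> s0 v0" "right_velocity \<gamma>' s0 v0"
    and t: "t \<in> I" "t \<in> J"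
  shows "\<gamma> t = \<gamma>' t"
proof -
  define E where "E s \<longleftrightarrow> \<gamma> s = \<gamma>' s \<and> (\<exists>v. right_velocity \<gamma> s v \<and> right_velocity \<gamma>' s v)" for s
  have "E s0 = E t"
  proof (rule connected_local_const[of "I \<inter> J"])
    show "connected (I \<inter> J)"
      using g g' by (auto simp: geodesic_in_def is_interval_connected_1[symmetric] intro: is_interval_Int)
    show "\<forall>a\<in>I \<inter> J. \<forall>\<^sub>F b in at a within I \<inter> J. E a = E b"
    proof
      fix a assume "a \<in> I \<inter> J"
      then obtain u v u' v' where u: "passes (\<gamma> a) u v" "left_velocity \<gamma> a u" "right_velocity \<gamma> a v"
        and u': "passes (\<gamma>' a) u' v'" "left_velocity \<gamma>' a u'" "right_velocity \<gamma>' a v'"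
        using g g' unfolding geodesic_in_iff by fast
      have Ea: "E a \<longleftrightarrow> \<gamma> a = \<gamma>' a \<and> v = v'"
        using u u' right_velocity_unique unfolding E_def by metis
      then have Ea': "E a \<longleftrightarrow> \<gamma> a = \<gamma>' a \<and> u = u'"
        using u(1) u'(1) passes_fun passes_inj by metis
      have "\<forall>\<^sub>F b in at_right a. E a = E b"
        using right_velocity_near[OF u(3)] right_velocity_near[OF u'(3)]
      proof eventually_elim
        fix b assume b: "\<gamma> b = \<gamma> a + (b - a) *\<^sub>R v \<and> right_velocity \<gamma> b v" "\<gamma>' b = \<gamma>' a + (b - a) *\<^sub>R v' \<and> right_velocity \<gamma>' b v'"
        then have "E b \<longleftrightarrow> \<gamma> b = \<gamma>' b \<and> v = v'"
          using right_velocity_unique unfolding E_def by metis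
        then show "E a = E b" using Ea b by auto
      qed
      moreover have "\<forall>\<^sub>F b in at_left a. E a = E b"
        using left_velocity_near[OF u(2)] left_velocity_near[OF u'(2)]
      proof eventually_elim
        fix b assume b: "\<gamma> b = \<gamma> a + (b - a) *\<^sub>R u \<and> right_velocity \<gamma> b u" "\<gamma>' b = \<gamma>' a + (b - a) *\<^sub>R u' \<and> right_velocity \<gamma>' b u'"
        then have "E b \<longleftrightarrow> \<gamma> b = \<gamma>' b \<and> u = u'"
          using right_velocity_unique unfolding E_def by metis
        then show "E a = E b" using Ea' b by auto
      qed
      ultimately have "\<forall>\<^sub>F b in at a. E a = E b" by (simp add: eventually_at_split)
      then show "\<forall>\<^sub>F b in at a within I \<inter> J. E a = E b"
        by (rule filter_leD[OF at_le, rotated]) simp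
    qed
  qed (use s0 t in auto)
  then show ?thesis using s0 unfolding E_def by blast
qed

definition maximal_geodesic :: "'a set \<Rightarrow> real set \<Rightarrow> (real \<Rightarrow> 'a) \<Rightarrow> bool" where
  "maximal_geodesic W I \<gamma> \<longleftrightarrow> geodesic_in n K W I \<gamma> \<and>
    (\<forall>\<gamma>' J. geodesic_in n K W J \<gamma>' \<and> I \<subseteq> J \<and> (\<forall>t\<in>I. \<gamma>' t = \<gamma> t) \<longrightarrow> J = I)"

text \<open>By uniqueness the two paths glue to a geodesic on \<open>I \<union> J\<close>, which by
  maximality is no larger than \<open>I\<close>.\<close>

lemma maximal_geodesic_extends:
  assumes m: "maximal_geodesic W I \<gamma>" and g': "geodesic_in n K W J \<gamma>'"
    and s0: "s0 \<in> I" "s0 \<in> J" "\<gamma> s0 = \<gamma>' s0" "right_velocity \<gamma> s0 v0" "right_velocity \<gamma>' s0 v0"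
  shows "J \<subseteq> I" "\<And>t. t \<in> J \<Longrightarrow> \<gamma> t = \<gamma>' t"
proof -
  have g: "geodesic_in n K W I \<gamma>" using m by (simp add: maximal_geodesic_def)
  note agree = geodesic_unique[OF g g' s0]
  define \<gamma>'' where "\<gamma>'' t = (if t \<in> I then \<gamma> t else \<gamma>' t)" for t
  have op: "open I" "open J" using g g' by (auto simp: geodesic_in_def)
  have n1: "\<forall>\<^sub>F s in nhds t. \<gamma>'' s = \<gamma> s" if "t \<in> I" for t
    using eventually_nhds_in_open[OF op(1) that] by eventually_elim (simp add: \<gamma>''_def)
  have n2: "\<forall>\<^sub>F s in nhds t. \<gamma>'' s = \<gamma>' s" if "t \<in> J" for t
    using eventually_nhds_in_open[OF op(2) that] by eventually_elim (simp add: \<gamma>''_def agree)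
  have "geodesic_in n K W (I \<union> J) \<gamma>''"
    unfolding geodesic_in_iff
  proof (intro conjI ballI)
    show "open (I \<union> J)" using op by auto
    show "is_interval (I \<union> J)"
      using g g' s0 unfolding is_interval_connected_1 geodesic_in_def by (intro connected_Un) auto
    show "\<gamma>'' ` (I \<union> J) \<subseteq> W" using g g' by (auto simp: geodesic_in_def \<gamma>''_def)
    fix t assume "t \<in> I \<union> J"
    then consider "t \<in> I" | "t \<in> J" by auto
    then show "\<exists>u v. passes (\<gamma>'' t) u v \<and> left_velocity \<gamma>'' t u \<and> right_velocity \<gamma>'' t v"
    proof cases
      case 1
      then show ?thesis using velocity_cong[OF n1[OF 1]] g unfolding geodesic_in_iff by simp
    next
      case 2
      then show ?thesis using velocity_cong[OF n2[OF 2]] g' unfolding geodesic_in_iff by simp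
    qed
  qed
  moreover have "\<forall>t\<in>I. \<gamma>'' t = \<gamma> t" by (simp add: \<gamma>''_def)
  ultimately have "I \<union> J = I" using m unfolding maximal_geodesic_def by blast
  then show "J \<subseteq> I" by blast
  then show "\<And>t. t \<in> J \<Longrightarrow> \<gamma> t = \<gamma>' t" using agree by blast
qed

lemma geodesic_reverse:
  assumes "geodesic_in n K W I \<gamma>"
  shows "geodesic_in n K W (uminus ` I) (\<lambda>t. \<gamma> (- t))"
  unfolding geodesic_in_iff
proof (intro conjI ballI)
  show "open (uminus ` I)" using assms by (auto simp: geodesic_in_def intro: open_negations)
  show "is_interval (uminus ` I)" using assms by (auto simp: geodesic_in_def)
  show "(\<lambda>t. \<gamma> (- t)) ` (uminus ` I) \<subseteq> W" using assms by (auto simp: geodesic_in_def)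
  fix t assume "t \<in> uminus ` I"
  then have "- t \<in> I" by auto
  then obtain u v where "passes (\<gamma> (- t)) u v" "left_velocity \<gamma> (- t) u" "right_velocity \<gamma> (- t) v"
    using assms unfolding geodesic_in_iff by blast
  then show "\<exists>u v. passes (\<gamma> (- t)) u v \<and> left_velocity (\<lambda>t. \<gamma> (- t)) t u \<and> right_velocity (\<lambda>t. \<gamma> (- t)) t v"
    by (intro exI[of _ "- v"] exI[of _ "- u"]) (simp add: velocity_reverse passes_reverse)
qed

lemma maximal_geodesic_reverse:
  assumes "maximal_geodesic W I \<gamma>"
  shows "maximal_geodesic W (uminus ` I) (\<lambda>t. \<gamma> (- t))"
  unfolding maximal_geodesic_def
proof (intro conjI allI impI)
  show "geodesic_in n K W (uminus ` I) (\<lambda>t. \<gamma> (- t))"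
    using assms geodesic_reverse by (auto simp: maximal_geodesic_def)
  fix \<gamma>' J assume J: "geodesic_in n K W J \<gamma>' \<and> uminus ` I \<subseteq> J \<and> (\<forall>t\<in>uminus ` I. \<gamma>' t = \<gamma> (- t))"
  then have "geodesic_in n K W (uminus ` J) (\<lambda>t. \<gamma>' (- t))" using geodesic_reverse by blast
  moreover have "I \<subseteq> uminus ` J" using J by (force simp: image_iff)
  moreover have "\<forall>t\<in>I. \<gamma>' (- t) = \<gamma> t" using J by auto
  ultimately have "uminus ` J = I" using assms unfolding maximal_geodesic_def by blast
  then show "J = uminus ` I" by (auto simp: image_image)
qed

lemma crosses_reverse:
  assumes "crosses_at n K \<gamma> t f \<sigma> \<tau> c w"
  shows "crosses_at n K (\<lambda>s. \<gamma> (- s)) (- t) f \<tau> \<sigma> c (- w)"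
proof -
  have "left_velocity (\<lambda>s. \<gamma> (- s)) (- t) (- w - c *\<^sub>R conormal \<tau> f)"
    "right_velocity (\<lambda>s. \<gamma> (- s)) (- t) (- w + c *\<^sub>R conormal \<sigma> f)"
    using crosses_velocity[OF assms] by (simp_all add: velocity_reverse add.commute)
  then show ?thesis
    using assms unfolding crosses_at_def left_velocity_def right_velocity_def
    by (auto simp: adjacent_at_def subspace_neg)
qed

lemma rel_interior_line_near:
  assumes "p \<in> rel_interior S" "u \<in> dirs S"
  shows "\<forall>\<^sub>F r in nhds 0. p + r *\<^sub>R u \<in> rel_interior (S::'a set)"
proof -
  obtain U where U: "open U" "rel_interior S = U \<inter> affine hull S"
    using openin_rel_interior[of S] by (auto simp: openin_open)
  have "open ((\<lambda>r::real. p + r *\<^sub>R u) -` U)"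
    by (intro open_vimage U continuous_intros)
  moreover have "0 \<in> (\<lambda>r::real. p + r *\<^sub>R u) -` U" using assms U by auto
  ultimately have "\<forall>\<^sub>F r in nhds 0. r \<in> (\<lambda>r::real. p + r *\<^sub>R u) -` U" by (rule eventually_nhds_in_open)
  then show ?thesis
  proof eventually_elim
    fix r :: real assume r: "r \<in> (\<lambda>r. p + r *\<^sub>R u) -` U"
    have p: "p \<in> S" using assms rel_interior_subset by blast
    then have "p + r *\<^sub>R u \<in> affine hull S"
      using affine_hull_iff_dirs[OF p] assms(2) by (simp add: subspace_scale)
    then show "p + r *\<^sub>R u \<in> rel_interior S" using r U by auto
  qed
qed

lemma straight_near:
  assumes s: "straight_at n K \<gamma> s"
  obtains \<sigma> u where "\<sigma> \<in> top_simplices n K" "\<gamma> s \<in> rel_interior \<sigma>" "right_velocity \<gamma> s u"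
    "\<forall>\<^sub>F y in at s. \<gamma> y = \<gamma> s + (y - s) *\<^sub>R u \<and> \<gamma> y \<in> rel_interior \<sigma> \<and> right_velocity \<gamma> y u"
proof -
  obtain \<sigma> u where \<sigma>: "\<sigma> \<in> top_simplices n K" "\<gamma> s \<in> rel_interior \<sigma>" "u \<in> dirs \<sigma>"
      "\<forall>\<^sub>F y in at s. \<gamma> y = \<gamma> s + (y - s) *\<^sub>R u"
    using s unfolding straight_at_def by blast
  note v = velocity_of_line[OF \<sigma>(4)]
  have 1: "\<forall>\<^sub>F y in at s. \<gamma> y = \<gamma> s + (y - s) *\<^sub>R u \<and> right_velocity \<gamma> y u"
    using right_velocity_near[OF v(1)] left_velocity_near[OF v(2)] by (simp add: eventually_at_split)
  have "((\<lambda>y. y - s) \<longlongrightarrow> s - s) (at s)" by (intro tendsto_intros)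
  then have "filterlim (\<lambda>y. y - s) (nhds 0) (at s)" by simp
  from eventually_compose_filterlim[OF rel_interior_line_near[OF \<sigma>(2,3)] this]
  have 2: "\<forall>\<^sub>F y in at s. \<gamma> s + (y - s) *\<^sub>R u \<in> rel_interior \<sigma>" .
  from 1 2 have "\<forall>\<^sub>F y in at s. \<gamma> y = \<gamma> s + (y - s) *\<^sub>R u \<and> \<gamma> y \<in> rel_interior \<sigma> \<and> right_velocity \<gamma> y u"
    by eventually_elim auto
  then show thesis using that \<sigma>(1,2) v(1) by blast
qed

section \<open>Geodesics inside a simplex and across the next hinge\<close>

text \<open>Away from hinges the path is straight near every time, so the simplex and the line that
  carries it are locally constant, hence constant, between crossings.\<close>

lemma geodesic_between_hinges:
  assumes g: "geodesic_in n K W I \<gamma>" and I: "t0 \<in> I" "t1 \<in> I" "t0 < t1"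
    and no: "\<And>s f. t0 < s \<Longrightarrow> s < t1 \<Longrightarrow> f \<in> hinges n K \<Longrightarrow> \<gamma> s \<notin> rel_interior f"
    and u0: "right_velocity \<gamma> t0 u"
  obtains \<sigma> where "\<sigma> \<in> top_simplices n K"
    "\<And>s. t0 < s \<Longrightarrow> s < t1 \<Longrightarrow> \<gamma> s \<in> rel_interior \<sigma> \<and> \<gamma> s = \<gamma> t0 + (s - t0) *\<^sub>R u"
    "\<gamma> t1 = \<gamma> t0 + (t1 - t0) *\<^sub>R u" "left_velocity \<gamma> t1 u"
proof -
  have sub: "{t0..t1} \<subseteq> I"
    using g I unfolding geodesic_in_def is_interval_1 by (meson atLeastAtMost_iff subsetI)
  have st: "straight_at n K \<gamma> s" if "t0 < s" "s < t1" for s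
  proof -
    have "s \<in> I" using sub that by auto
    then have "straight_at n K \<gamma> s \<or> (\<exists>f \<sigma> \<tau> c w. crosses_at n K \<gamma> s f \<sigma> \<tau> c w)"
      using g unfolding geodesic_in_def by blast
    then show ?thesis using no[OF that] unfolding crosses_at_def adjacent_at_def by blast
  qed
  \<comment> \<open>The invariant consists of simplex, velocity and the point where the line would
    be at time zero. As a set of triples it needs no choice; by \<open>F1\<close> it is a
    singleton.\<close>
  define F where "F s = {(\<sigma>, v, \<gamma> s - s *\<^sub>R v) | \<sigma> v. \<sigma> \<in> top_simplices n K \<and> \<gamma> s \<in> rel_interior \<sigma> \<and> right_velocity \<gamma> s v}" for s
  have F1: "F s = {(\<sigma>, v, \<gamma> s - s *\<^sub>R v)}" if "\<sigma> \<in> top_simplices n K" "\<gamma> s \<in> rel_interior \<sigma>" "right_velocity \<gamma> s v" for s \<sigma> v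
    unfolding F_def using that rel_interior_eq top_in right_velocity_unique by blast
  have const: "F a = F b" if "a \<in> {t0<..<t1}" "b \<in> {t0<..<t1}" for a b
  proof (rule connected_local_const[OF _ that])
    show "connected {t0<..<t1}" by simp
    show "\<forall>a\<in>{t0<..<t1}. \<forall>\<^sub>F b in at a within {t0<..<t1}. F a = F b"
    proof
      fix a assume "a \<in> {t0<..<t1}"
      then have "straight_at n K \<gamma> a" using st by auto
      then obtain \<sigma> u where \<sigma>: "\<sigma> \<in> top_simplices n K" "\<gamma> a \<in> rel_interior \<sigma>" "right_velocity \<gamma> a u"
        "\<forall>\<^sub>F y in at a. \<gamma> y = \<gamma> a + (y - a) *\<^sub>R u \<and> \<gamma> y \<in> rel_interior \<sigma> \<and> right_velocity \<gamma> y u"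
        by (rule straight_near)
      from \<sigma>(4) have "\<forall>\<^sub>F b in at a. F a = F b"
      proof eventually_elim
        fix y assume y: "\<gamma> y = \<gamma> a + (y - a) *\<^sub>R u \<and> \<gamma> y \<in> rel_interior \<sigma> \<and> right_velocity \<gamma> y u"
        then have "\<gamma> y - y *\<^sub>R u = \<gamma> a - a *\<^sub>R u" by (simp add: algebra_simps)
        moreover have "F y = {(\<sigma>, u, \<gamma> y - y *\<^sub>R u)}" using F1[OF \<sigma>(1), of y u] y by blast
        ultimately show "F a = F y" using F1[OF \<sigma>(1-3)] by simp
      qed
      then show "\<forall>\<^sub>F b in at a within {t0<..<t1}. F a = F b"
        by (rule filter_leD[OF at_le, rotated]) simp
    qed
  qed
  have "\<forall>\<^sub>F s in at_right t0. s < t1"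
    unfolding eventually_at_right_field using I by blast
  moreover have "\<forall>\<^sub>F s in at_right t0. t0 < s" by (simp add: eventually_at_filter)
  ultimately have "\<forall>\<^sub>F s in at_right t0. t0 < s \<and> s < t1 \<and> \<gamma> s = \<gamma> t0 + (s - t0) *\<^sub>R u \<and> right_velocity \<gamma> s u"
    using right_velocity_near[OF u0] by eventually_elim auto
  then obtain s1 where s1: "t0 < s1" "s1 < t1" "\<gamma> s1 = \<gamma> t0 + (s1 - t0) *\<^sub>R u" "right_velocity \<gamma> s1 u"
    using eventually_happens'[of "at_right t0"] by auto
  obtain \<sigma> where \<sigma>: "\<sigma> \<in> top_simplices n K" "\<gamma> s1 \<in> rel_interior \<sigma>"
    using st[OF s1(1,2)] unfolding straight_at_def by blast
  have line: "\<gamma> s \<in> rel_interior \<sigma> \<and> \<gamma> s = \<gamma> t0 + (s - t0) *\<^sub>R u \<and> right_velocity \<gamma> s u" if "t0 < s" "s < t1" for s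
  proof -
    have "F s = F s1" by (rule const) (use that s1 in simp_all)
    note sts = st[OF that]
    obtain \<sigma>' v where \<sigma>': "\<sigma>' \<in> top_simplices n K" "\<gamma> s \<in> rel_interior \<sigma>'" "right_velocity \<gamma> s v"
      by (rule straight_near[OF sts])
    have "(\<sigma>', v, \<gamma> s - s *\<^sub>R v) = (\<sigma>, u, \<gamma> s1 - s1 *\<^sub>R u)"
      using \<open>F s = F s1\<close> unfolding F1[OF \<sigma>'] F1[OF \<sigma> s1(4)] by (rule singleton_inject)
    then show ?thesis using \<sigma>' s1(3) by (auto simp: algebra_simps)
  qed
  \<comment> \<open>The endpoint is not covered by the constancy argument. The line just before
    \<open>t1\<close>, compared with the known one at a single time \<open>s2\<close>, extends the
    formula to \<open>t1\<close>.\<close>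
  obtain u1 v1 where u1: "left_velocity \<gamma> t1 u1" using g I unfolding geodesic_in_iff by blast
  have "\<forall>\<^sub>F s in at_left t1. t0 < s"
    unfolding eventually_at_left_field using I by blast
  moreover have "\<forall>\<^sub>F s in at_left t1. s < t1" by (simp add: eventually_at_filter)
  ultimately have "\<forall>\<^sub>F s in at_left t1. t0 < s \<and> s < t1 \<and> \<gamma> s = \<gamma> t1 + (s - t1) *\<^sub>R u1 \<and> right_velocity \<gamma> s u1"
    using left_velocity_near[OF u1] by eventually_elim auto
  then obtain s2 where s2: "t0 < s2" "s2 < t1" "\<gamma> s2 = \<gamma> t1 + (s2 - t1) *\<^sub>R u1" "right_velocity \<gamma> s2 u1"
    using eventually_happens'[of "at_left t1"] by auto
  have "u1 = u" using line[OF s2(1,2)] s2(4) right_velocity_unique by blast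
  then have "\<gamma> t1 = \<gamma> t0 + (t1 - t0) *\<^sub>R u" "left_velocity \<gamma> t1 u"
    using line[OF s2(1,2)] s2(3) u1 by (auto simp: algebra_simps)
  then show thesis using that \<sigma>(1) line by blast
qed

text \<open>\<open>inward\<close> puts an earlier point of the segment into the open simplex; from
  there to a point of the closure the segment stays inside.\<close>

lemma open_segment_in_top:
  assumes F: "facet f \<sigma>" and G: "facet g \<sigma>" and p: "p \<in> rel_interior f" and u: "u \<in> dirs \<sigma>" "0 < u \<bullet> conormal \<sigma> f"
    and s: "p + s *\<^sub>R u \<in> g" and r: "0 < r" "r < s"
  shows "p + r *\<^sub>R u \<in> rel_interior \<sigma>"
proof -
  have "\<forall>\<^sub>F a in at_right 0. a < r" unfolding eventually_at_right_field using r by blast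
  moreover have "\<forall>\<^sub>F a in at_right (0::real). 0 < a" by (simp add: eventually_at_filter)
  ultimately have "\<forall>\<^sub>F a in at_right 0. 0 < a \<and> a < r \<and> p + a *\<^sub>R u \<in> rel_interior \<sigma>"
    using inward[OF F p u] by eventually_elim auto
  then obtain a where a: "0 < a" "a < r" "p + a *\<^sub>R u \<in> rel_interior \<sigma>"
    using eventually_happens'[of "at_right (0::real)"] by auto
  have "p + s *\<^sub>R u \<in> closure \<sigma>" using s G closure_subset by blast
  then have os: "open_segment (p + a *\<^sub>R u) (p + s *\<^sub>R u) \<subseteq> rel_interior \<sigma>"
    using rel_interior_closure_convex_segment[OF convex_top a(3)] F by blast
  have "u \<noteq> 0" using u by auto
  then have ne: "p + a *\<^sub>R u \<noteq> p + s *\<^sub>R u" using a r by simp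
  define k where "k = (r - a) / (s - a)"
  have k: "0 < k" "k < 1" using a r by (auto simp: k_def)
  have ks: "k * (s - a) = r - a" using a r by (simp add: k_def)
  have "(1 - k) *\<^sub>R (p + a *\<^sub>R u) + k *\<^sub>R (p + s *\<^sub>R u) = p + (a + k * (s - a)) *\<^sub>R u"
    by (simp add: algebra_simps)
  also have "\<dots> = p + r *\<^sub>R u" by (simp add: ks)
  finally have "p + r *\<^sub>R u \<in> open_segment (p + a *\<^sub>R u) (p + s *\<^sub>R u)"
    unfolding in_segment using ne k by metis
  then show ?thesis using os by blast
qed

text \<open>The place where maximality is used: an explicit geodesic runs through
  \<open>\<sigma>\<close>, crosses \<open>f\<close> and goes a little way into
  \<open>\<tau>\<close>. Since all this lies in \<open>W\<close>, the maximal geodesic has to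
  contain it.\<close>

lemma geodesic_continues:
  assumes m: "maximal_geodesic W I \<gamma>" and t0: "t0 \<in> I" "right_velocity \<gamma> t0 u"
    and F: "facet g \<sigma>" "\<gamma> t0 \<in> rel_interior g" and u: "u \<in> dirs \<sigma>" "norm u = 1" "0 < u \<bullet> conormal \<sigma> g"
    and A: "adjacent_at n K f \<sigma> \<tau>" and s: "0 < s" "\<gamma> t0 + s *\<^sub>R u \<in> rel_interior f" and um: "u \<bullet> conormal \<sigma> f < 0"
    and W: "rel_interior \<sigma> \<subseteq> W" "rel_interior f \<subseteq> W" "rel_interior \<tau> \<subseteq> W"
  shows "t0 + s \<in> I" "\<gamma> (t0 + s) = \<gamma> t0 + s *\<^sub>R u"
    "crosses_at n K \<gamma> (t0 + s) f \<sigma> \<tau> (- (u \<bullet> conormal \<sigma> f)) (u - (u \<bullet> conormal \<sigma> f) *\<^sub>R conormal \<sigma> f)"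
proof -
  let ?m = "conormal \<sigma> f" and ?m' = "conormal \<tau> f"
  note Ff = adjacent_facet[OF A]
  define c where "c = - (u \<bullet> ?m)"
  define w where "w = u - (u \<bullet> ?m) *\<^sub>R ?m"
  define u' where "u' = w + c *\<^sub>R ?m'"
  have c: "0 < c" using um by (simp add: c_def)
  have wf: "w \<in> dirs f"
    unfolding dirs_facet[OF Ff(1)] w_def using u conormal(2)[OF Ff(1)] conormal_self[OF Ff(1)]
    by (auto simp: inner_diff_left intro!: subspace_diff subspace_scale)
  have uw: "u = w - c *\<^sub>R ?m" by (simp add: w_def c_def)
  have "w \<bullet> w + c * c = 1"
    using u(2) conormal(3)[OF Ff(1) wf] conormal_self[OF Ff(1)] unfolding norm_eq_1 uw
    by (simp add: inner_diff_left inner_diff_right inner_commute)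
  then have cw: "c\<^sup>2 + (norm w)\<^sup>2 = 1" unfolding power2_norm_eq_inner by (simp add: power2_eq_square add.commute)
  have u'\<tau>: "u' \<in> dirs \<tau>"
    using wf dirs_mono[of f \<tau>] Ff conormal(2)[OF Ff(2)] unfolding u'_def
    by (intro subspace_add[OF subspace_dirs] subspace_scale[OF subspace_dirs]) auto
  have u'm: "u' \<bullet> ?m' = c"
    using conormal(3)[OF Ff(2) wf] conormal_self[OF Ff(2)] by (simp add: u'_def inner_add_left)
  have u'n: "norm u' = 1"
    using \<open>w \<bullet> w + c * c = 1\<close> conormal(3)[OF Ff(2) wf] conormal_self[OF Ff(2)] unfolding norm_eq_1 u'_def
    by (simp add: inner_add_left inner_add_right inner_commute)
  define q where "q = \<gamma> t0 + s *\<^sub>R u"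
  obtain \<eta> where \<eta>: "0 < \<eta>" "\<And>r. 0 < r \<Longrightarrow> r < \<eta> \<Longrightarrow> q + r *\<^sub>R u' \<in> rel_interior \<tau>"
    using inward[OF Ff(2) _ u'\<tau>, of q] s(2) u'm c unfolding q_def eventually_at_right_field by auto
  \<comment> \<open>\<open>J\<close> leaves out \<open>t0\<close>, where the path is on the hinge
    \<open>g\<close>. Agreement with \<open>\<gamma>\<close> is established at a slightly later time
    \<open>s0\<close>.\<close>
  define J where "J = {t0<..<t0 + s + \<eta>}"
  define \<gamma>' where "\<gamma>' t = (if t \<le> t0 + s then \<gamma> t0 + (t - t0) *\<^sub>R u else q + (t - (t0 + s)) *\<^sub>R u')" for t
  have seg: "\<gamma> t0 + (t - t0) *\<^sub>R u \<in> rel_interior \<sigma>" if "t0 < t" "t < t0 + s" for t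
    using open_segment_in_top[OF F(1) Ff(1) F(2) u(1,3), of s "t - t0"] s that rel_interior_subset by auto
  have straight1: "passes (\<gamma>' t) u u \<and> left_velocity \<gamma>' t u \<and> right_velocity \<gamma>' t u" if t: "t0 < t" "t < t0 + s" for t
  proof -
    have "\<forall>\<^sub>F y in nhds t. y \<in> {t0<..<t0 + s}" using t by (intro eventually_nhds_in_open) auto
    then have "\<forall>\<^sub>F y in at t. y \<in> {t0<..<t0 + s}" by (simp add: eventually_at_filter eventually_mono)
    then have "\<forall>\<^sub>F y in at t. \<gamma>' y = \<gamma>' t + (y - t) *\<^sub>R u"
      by eventually_elim (use t in \<open>auto simp: \<gamma>'_def algebra_simps\<close>)
    moreover have "passes (\<gamma>' t) u u"
      unfolding passes_def using seg[OF t] t F(1) u by (auto simp: \<gamma>'_def)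
    ultimately show ?thesis using velocity_of_line by blast
  qed
  have straight2: "passes (\<gamma>' t) u' u' \<and> left_velocity \<gamma>' t u' \<and> right_velocity \<gamma>' t u'" if t: "t0 + s < t" "t < t0 + s + \<eta>" for t
  proof -
    have "\<forall>\<^sub>F y in nhds t. y \<in> {t0 + s<..}" using t by (intro eventually_nhds_in_open) auto
    then have "\<forall>\<^sub>F y in at t. y \<in> {t0 + s<..}" by (simp add: eventually_at_filter eventually_mono)
    then have "\<forall>\<^sub>F y in at t. \<gamma>' y = \<gamma>' t + (y - t) *\<^sub>R u'"
      by eventually_elim (use t in \<open>auto simp: \<gamma>'_def algebra_simps\<close>)
    moreover have "passes (\<gamma>' t) u' u'"
      unfolding passes_def using \<eta>(2)[of "t - (t0 + s)"] t Ff(2) u'\<tau> u'n by (auto simp: \<gamma>'_def)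
    ultimately show ?thesis using velocity_of_line by blast
  qed
  have cr: "crosses_at n K \<gamma>' (t0 + s) f \<sigma> \<tau> c w"
  proof -
    have "\<forall>\<^sub>F y in at_left (t0 + s). y < t0 + s" by (simp add: eventually_at_filter)
    then have 1: "\<forall>\<^sub>F y in at_left (t0 + s). \<gamma>' y = \<gamma>' (t0 + s) + (y - (t0 + s)) *\<^sub>R (w - c *\<^sub>R ?m)"
      by eventually_elim (simp add: \<gamma>'_def uw[symmetric] algebra_simps)
    have "\<forall>\<^sub>F y in at_right (t0 + s). t0 + s < y" by (simp add: eventually_at_filter)
    then have 2: "\<forall>\<^sub>F y in at_right (t0 + s). \<gamma>' y = \<gamma>' (t0 + s) + (y - (t0 + s)) *\<^sub>R (w + c *\<^sub>R ?m')"
      by eventually_elim (simp add: \<gamma>'_def u'_def[symmetric] q_def)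
    show ?thesis unfolding crosses_at_def using 1 2 A c wf cw s(2) by (simp add: \<gamma>'_def)
  qed
  have g': "geodesic_in n K W J \<gamma>'"
    unfolding geodesic_in_iff
  proof (intro conjI ballI)
    show "open J" "is_interval J" by (auto simp: J_def is_interval_1)
    show "\<gamma>' ` J \<subseteq> W"
    proof safe
      fix t assume "t \<in> J"
      then consider "t0 < t" "t < t0 + s" | "t = t0 + s" | "t0 + s < t" "t < t0 + s + \<eta>" by (fastforce simp: J_def)
      then show "\<gamma>' t \<in> W"
        by cases (use seg W s \<eta>(2)[of "t - (t0 + s)"] in \<open>auto simp: \<gamma>'_def\<close>)
    qed
    fix t assume "t \<in> J"
    then consider "t0 < t" "t < t0 + s" | "t = t0 + s" | "t0 + s < t" "t < t0 + s + \<eta>" by (fastforce simp: J_def)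
    then show "\<exists>u v. passes (\<gamma>' t) u v \<and> left_velocity \<gamma>' t u \<and> right_velocity \<gamma>' t v"
      by cases (use straight1 straight2 crosses_velocity[OF cr] in blast)+
  qed
  have "open I" using m by (auto simp: maximal_geodesic_def geodesic_in_def)
  then have "\<forall>\<^sub>F y in at_right t0. y \<in> I"
    using eventually_nhds_in_open[OF _ t0(1)] by (auto simp: eventually_at_filter elim: eventually_mono)
  moreover have "\<forall>\<^sub>F y in at_right t0. t0 < y" by (simp add: eventually_at_filter)
  moreover have "\<forall>\<^sub>F y in at_right t0. y < t0 + s"
    unfolding eventually_at_right_field using s by (intro exI[of _ "t0 + s"]) auto
  ultimately have "\<forall>\<^sub>F y in at_right t0. y \<in> I \<and> t0 < y \<and> y < t0 + s \<and> \<gamma> y = \<gamma> t0 + (y - t0) *\<^sub>R u \<and> right_velocity \<gamma> y u"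
    using right_velocity_near[OF t0(2)] by eventually_elim auto
  then obtain s0 where s0: "s0 \<in> I" "t0 < s0" "s0 < t0 + s" "\<gamma> s0 = \<gamma> t0 + (s0 - t0) *\<^sub>R u" "right_velocity \<gamma> s0 u"
    using eventually_happens'[of "at_right t0"] by auto
  have s0J: "s0 \<in> J" "\<gamma> s0 = \<gamma>' s0" "right_velocity \<gamma>' s0 u"
    using s0 \<eta>(1) straight1 by (auto simp: J_def \<gamma>'_def)
  note ext = maximal_geodesic_extends[OF m g' s0(1) s0J(1,2) s0(5) s0J(3)]
  have tJ: "t0 + s \<in> J" using s \<eta> by (simp add: J_def)
  then show "t0 + s \<in> I" "\<gamma> (t0 + s) = \<gamma> t0 + s *\<^sub>R u" using ext by (auto simp: \<gamma>'_def)
  have "open J" by (simp add: J_def)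
  then have "\<forall>\<^sub>F y in nhds (t0 + s). \<gamma> y = \<gamma>' y"
    using eventually_nhds_in_open[OF _ tJ] ext(2) by (auto elim!: eventually_mono)
  from velocity_cong[OF this] crosses_velocity(1,2)[OF cr] cr
  have "crosses_at n K \<gamma> (t0 + s) f \<sigma> \<tau> c w"
    unfolding crosses_at_def left_velocity_def right_velocity_def by auto
  then show "crosses_at n K \<gamma> (t0 + s) f \<sigma> \<tau> (- (u \<bullet> ?m)) (u - (u \<bullet> ?m) *\<^sub>R ?m)"
    by (simp add: c_def w_def)
qed

end

section \<open>Itineraries\<close>

text \<open>The signed angle between a unit vector and its image when its component orthogonal to a
  hinge, of length \<open>c\<close>, is rotated by \<open>\<epsilon>\<close> and the component along
  the hinge is kept.\<close>

definition turn :: "real \<Rightarrow> real \<Rightarrow> real" where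
  "turn c \<epsilon> = (if 0 < sin \<epsilon> then arccos (1 - c\<^sup>2 + c\<^sup>2 * cos \<epsilon>) else - arccos (1 - c\<^sup>2 + c\<^sup>2 * cos \<epsilon>))"

lemma one_minus_cos_le: "1 - cos x \<le> x\<^sup>2 / 2" for x :: real
proof -
  have "1 - cos x = 2 * (sin (x / 2))\<^sup>2" using cos_double_sin[of "x / 2"] by simp
  also have "\<dots> \<le> 2 * (x / 2)\<^sup>2" using abs_sin_x_le_abs_x[of "x / 2"] by (intro mult_left_mono) (auto simp: abs_le_square_iff[symmetric])
  finally show ?thesis by (simp add: power_divide)
qed

text \<open>The turning angle \<open>a\<close> satisfies \<open>sin (a / 2) = c * sin (\<epsilon> / 2)\<close>.\<close>
lemma turn_approx:
  assumes c: "0 \<le> c" "c \<le> 1" and e: "\<bar>\<epsilon>\<bar> \<le> 1"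
  shows "\<bar>turn c \<epsilon> - c * \<epsilon>\<bar> \<le> \<bar>\<epsilon>\<bar> ^ 3"
proof -
  define e where "e = \<bar>\<epsilon>\<bar>"
  have e01: "0 \<le> e" "e \<le> 1" using assms by (auto simp: e_def)
  have epi: "e \<le> pi" using e01 pi_gt3 by linarith
  define a where "a = arccos (1 - c\<^sup>2 + c\<^sup>2 * cos e)"
  have ce: "cos \<epsilon> = cos e" by (simp add: e_def)
  have c2: "0 \<le> c\<^sup>2" "c\<^sup>2 \<le> 1" using c by (auto simp: power_le_one)
  have eq: "1 - c\<^sup>2 + c\<^sup>2 * cos e = 1 - c\<^sup>2 * (1 - cos e)" by (simp add: algebra_simps)
  have le: "c\<^sup>2 * (1 - cos e) \<le> 1 * (1 - cos e)" using c2 by (intro mult_right_mono) auto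
  have ge: "0 \<le> c\<^sup>2 * (1 - cos e)" using c2 by simp
  have rng: "-1 \<le> 1 - X \<and> 1 - X \<le> 1 \<and> cos e \<le> 1 - X" if "X \<le> 1 * (1 - cos e)" "0 \<le> X" for X
  proof -
    have "1 * (1 - cos e) \<le> 2" by simp
    then have "X \<le> 2" using that(1) by (rule order_trans[rotated])
    then show ?thesis using that by auto
  qed
  note rng = rng[OF le ge, THEN conjunct1] rng[OF le ge, THEN conjunct2, THEN conjunct1] rng[OF le ge, THEN conjunct2, THEN conjunct2]
  have ca: "cos a = 1 - c\<^sup>2 * (1 - cos e)" and a0: "0 \<le> a" "a \<le> pi"
    unfolding a_def eq using rng by (auto intro: cos_arccos arccos_lbound arccos_ubound)
  have ae: "a \<le> e"
    using rng(3) ca a0 e01 epi cos_mono_le_eq[of e a] by simp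
  have "2 * (sin (a / 2))\<^sup>2 = c\<^sup>2 * (2 * (sin (e / 2))\<^sup>2)"
  proof -
    have "2 * (sin (a / 2))\<^sup>2 = 1 - cos a" "2 * (sin (e / 2))\<^sup>2 = 1 - cos e"
      using cos_double_sin[of "a / 2"] cos_double_sin[of "e / 2"] by simp_all
    then show ?thesis using ca by simp
  qed
  then have "(sin (a / 2))\<^sup>2 = (c * sin (e / 2))\<^sup>2" by (simp add: power_mult_distrib)
  moreover have "0 \<le> sin (a / 2)" "0 \<le> sin (e / 2)" using a0 e01 epi by (auto intro!: sin_ge_zero)
  ultimately have s: "sin (a / 2) = c * sin (e / 2)" using c by (simp add: power2_eq_iff_nonneg)
  \<comment> \<open>Used at \<open>a / 2\<close> and at \<open>e / 2\<close>: the errors add up to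
    \<open>e ^ 3 / 24\<close>, which gives \<open>e ^ 3 / 12\<close> for \<open>a - c * e\<close>;
    the factor is then dropped.\<close>
  have sb: "\<bar>sin x - x\<bar> \<le> \<bar>x\<bar> ^ 3 / 6" for x :: real
    using Maclaurin_sin_bound[of x 3] by (simp add: sin_coeff_def numeral_3_eq_3 fact_reduce)
  have 1: "\<bar>sin (a / 2) - a / 2\<bar> \<le> (e / 2) ^ 3 / 6"
  proof -
    have "\<bar>a / 2\<bar> ^ 3 \<le> (e / 2) ^ 3" using ae a0 by (intro power_mono) auto
    then show ?thesis using sb[of "a / 2"] by linarith
  qed
  have 2: "\<bar>c * sin (e / 2) - c * (e / 2)\<bar> \<le> (e / 2) ^ 3 / 6"
  proof -
    have "\<bar>c * sin (e / 2) - c * (e / 2)\<bar> = c * \<bar>sin (e / 2) - e / 2\<bar>"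
      unfolding right_diff_distrib[symmetric] using c by (simp add: abs_mult)
    also have "\<dots> \<le> 1 * \<bar>sin (e / 2) - e / 2\<bar>" using c by (intro mult_right_mono) auto
    finally show ?thesis using sb[of "e / 2"] e01 by simp
  qed
  have ae3: "\<bar>a - c * e\<bar> \<le> e ^ 3"
  proof -
    have "\<bar>a / 2 - c * (e / 2)\<bar> \<le> (e / 2) ^ 3 / 6 + (e / 2) ^ 3 / 6" using 1 2 s by linarith
    moreover have "0 \<le> e ^ 3" using e01 by simp
    moreover have "a / 2 - c * (e / 2) = (a - c * e) / 2" by (simp add: field_simps)
    ultimately have "\<bar>(a - c * e) / 2\<bar> \<le> (e / 2) ^ 3 / 6 + (e / 2) ^ 3 / 6" by (simp only:)
    then have "\<bar>a - c * e\<bar> / 2 \<le> e ^ 3 / 24" unfolding abs_divide by (simp add: power_divide)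
    then have "\<bar>a - c * e\<bar> \<le> e ^ 3 / 12" by simp
    also have "\<dots> \<le> e ^ 3" using e01 by simp
    finally show ?thesis .
  qed
  show ?thesis
  proof (cases "0 < sin \<epsilon>")
    case True
    have "\<not> \<epsilon> < 0"
    proof
      assume "\<epsilon> < 0"
      then have "0 \<le> sin (- \<epsilon>)" using e pi_gt3 by (intro sin_ge_zero) linarith+
      then show False using True by simp
    qed
    then have "\<epsilon> = e" by (simp add: e_def)
    then show ?thesis using ae3 True e01 by (simp add: turn_def a_def)
  next
    case False
    have "\<not> \<epsilon> > 0"
    proof
      assume "\<epsilon> > 0"
      then have "0 < sin \<epsilon>" using e pi_gt3 by (intro sin_gt_zero) linarith+
      then show False using False by simp
    qed
    then have "\<epsilon> = - e" by (simp add: e_def)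
    then have "turn c \<epsilon> - c * \<epsilon> = - (a - c * e)" using False by (simp add: turn_def a_def)
    then have "\<bar>turn c \<epsilon> - c * \<epsilon>\<bar> = \<bar>a - c * e\<bar>" by (simp only: abs_minus_cancel)
    then show ?thesis using ae3 by (simp add: e_def[symmetric])
  qed
qed

lemma turn_1: "\<bar>\<epsilon>\<bar> \<le> 1 \<Longrightarrow> turn 1 \<epsilon> = \<epsilon>"
proof -
  assume e: "\<bar>\<epsilon>\<bar> \<le> 1"
  have pi: "1 < pi" using pi_gt3 by linarith
  show ?thesis
  proof (cases "0 < \<epsilon>")
    case True
    then have "0 < sin \<epsilon>" using e pi by (intro sin_gt_zero) linarith+
    then show ?thesis using True e pi by (simp add: turn_def arccos_cos)
  next
    case False
    then have "0 \<le> sin (- \<epsilon>)" using e pi by (intro sin_ge_zero) linarith+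
    moreover have "arccos (cos (- \<epsilon>)) = - \<epsilon>" using False e pi by (intro arccos_cos) linarith+
    ultimately show ?thesis by (simp add: turn_def)
  qed
qed

context flat_manifold
begin

text \<open>In terms of \<open>hinge_rotation\<close>, the inner product of the two velocities is
  the argument of \<open>arccos\<close> in \<open>turn\<close>, and the normal component of their
  difference is \<open>c * sin \<epsilon>\<close>, which decides the sign.\<close>

lemma turning_angle_crossing:
  assumes c: "crosses_at n K \<gamma> t f \<sigma> \<tau> c w" and e: "\<bar>hinge_angle n K \<nu> f\<bar> < 1"
  shows "turning_angle n K \<nu> \<gamma> t = turn c (hinge_angle n K \<nu> f)"
proof -
  let ?m = "conormal \<sigma> f" and ?m' = "conormal \<tau> f" and ?e = "hinge_angle n K \<nu> f"
  have A: "adjacent_at n K f \<sigma> \<tau>" and p: "\<gamma> t \<in> rel_interior f" and c0: "0 < c" and w: "w \<in> dirs f" and cw: "c\<^sup>2 + (norm w)\<^sup>2 = 1"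
    using c by (auto simp: crosses_at_def)
  note F = adjacent_facet[OF A]
  note R = hinge_rotation[OF A e]
  note v = crosses_velocity[OF c]
  have d0: "vector_derivative \<gamma> (at_left t) = w - c *\<^sub>R ?m" and d1: "vector_derivative \<gamma> (at_right t) = w + c *\<^sub>R ?m'"
    using v vector_derivative_velocity by blast+
  have wm: "w \<bullet> ?m = 0" "w \<bullet> ?m' = 0" using conormal(3)[OF F(1) w] conormal(3)[OF F(2) w] by auto
  have mm: "?m \<bullet> ?m = 1" "?m' \<bullet> ?m' = 1" using conormal_self F by auto
  have \<sigma>: "\<sigma> \<in> top_simplices n K" using F by simp
  have mN: "?m \<bullet> \<nu> \<sigma> = 0" using normal(2)[OF \<sigma>] conormal(2)[OF F(1)] by simp
  have NN: "\<nu> \<sigma> \<bullet> \<nu> \<sigma> = 1" using normal(1)[OF \<sigma>] by (simp add: norm_eq_1)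
  have mm': "?m \<bullet> ?m' = - cos ?e" unfolding R(1) using mN mm by (simp add: inner_diff_right)
  have m'N: "?m' \<bullet> \<nu> \<sigma> = sin ?e" unfolding R(1) using mN NN by (simp add: inner_diff_left)
  have ww: "w \<bullet> w = 1 - c\<^sup>2" using cw by (simp add: power2_norm_eq_inner)
  have n1: "norm (w - c *\<^sub>R ?m) = 1" "norm (w + c *\<^sub>R ?m') = 1"
    unfolding norm_eq_1 using wm mm ww
    by (simp_all add: inner_diff_left inner_diff_right inner_add_left inner_add_right inner_commute power2_eq_square)
  have "(w - c *\<^sub>R ?m) \<bullet> (w + c *\<^sub>R ?m') = 1 - c\<^sup>2 + c\<^sup>2 * cos ?e"
    using wm ww mm' by (simp add: inner_diff_left inner_diff_right inner_add_right inner_commute power2_eq_square)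
  then have va: "vangle (w - c *\<^sub>R ?m) (w + c *\<^sub>R ?m') = arccos (1 - c\<^sup>2 + c\<^sup>2 * cos ?e)"
    using n1 by (simp add: vangle_def)
  have in\<sigma>: "\<forall>\<^sub>F s in at_left t. \<gamma> s \<in> rel_interior \<sigma>"
  proof -
    let ?u = "c *\<^sub>R ?m - w"
    have "?u \<in> dirs \<sigma>" using w dirs_mono[of f \<sigma>] F conormal(2)[OF F(1)]
      by (intro subspace_diff[OF subspace_dirs] subspace_scale[OF subspace_dirs]) auto
    moreover have "0 < ?u \<bullet> ?m" using wm mm c0 by (simp add: inner_diff_left)
    ultimately obtain b where b: "0 < b" "\<And>r. 0 < r \<Longrightarrow> r < b \<Longrightarrow> \<gamma> t + r *\<^sub>R ?u \<in> rel_interior \<sigma>"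
      using inward[OF F(1) p] unfolding eventually_at_right_field by blast
    have "\<forall>\<^sub>F s in at_left t. t - b < s \<and> s < t"
      unfolding eventually_at_left_field using b(1) by (intro exI[of _ "t - b"]) auto
    moreover have "\<forall>\<^sub>F s in at_left t. \<gamma> s = \<gamma> t + (s - t) *\<^sub>R (w - c *\<^sub>R ?m)" using v(1) by (simp add: left_velocity_def)
    ultimately show ?thesis
    proof eventually_elim
      fix s assume s: "t - b < s \<and> s < t" and g: "\<gamma> s = \<gamma> t + (s - t) *\<^sub>R (w - c *\<^sub>R ?m)"
      have "(s - t) *\<^sub>R (w - c *\<^sub>R ?m) = (t - s) *\<^sub>R ?u" by (simp add: algebra_simps)
      then show "\<gamma> s \<in> rel_interior \<sigma>" using b(2)[of "t - s"] s g by simp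
    qed
  qed
  have "(SOME \<sigma>. \<sigma> \<in> top_simplices n K \<and> (\<forall>\<^sub>F s in at_left t. \<gamma> s \<in> rel_interior \<sigma>)) = \<sigma>"
  proof (rule some_equality)
    fix \<rho> assume \<rho>: "\<rho> \<in> top_simplices n K \<and> (\<forall>\<^sub>F s in at_left t. \<gamma> s \<in> rel_interior \<rho>)"
    then have "\<forall>\<^sub>F s in at_left t. \<gamma> s \<in> rel_interior \<rho>" by simp
    with in\<sigma> have "\<forall>\<^sub>F s in at_left t. \<rho> = \<sigma>"
      by eventually_elim (use rel_interior_eq top_in \<rho> \<sigma> in blast)
    then show "\<rho> = \<sigma>" by simp
  qed (use \<sigma> in\<sigma> in simp)
  moreover have "(w + c *\<^sub>R ?m' - (w - c *\<^sub>R ?m)) \<bullet> \<nu> \<sigma> = c * sin ?e"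
    using mN m'N by (simp add: inner_add_left)
  ultimately show ?thesis
    unfolding turning_angle_def d0 d1 Let_def va turn_def using c0 by (simp add: zero_less_mult_iff)
qed

section \<open>Itineraries and the data computed from them\<close>

text \<open>The signed time after which the line from \<open>p\<close> with velocity
  \<open>u\<close> meets the affine hull of \<open>f\<close> inside the hyperplane of
  \<open>\<sigma>\<close>. It is affine in \<open>p\<close>, which makes the arrival point an affine
  function of the starting point.\<close>

definition hit :: "'a set \<Rightarrow> 'a set \<Rightarrow> 'a \<Rightarrow> 'a \<Rightarrow> real" where
  "hit \<sigma> f u p = (conormal \<sigma> f \<bullet> ((SOME q. q \<in> f) - p)) / (conormal \<sigma> f \<bullet> u)"

text \<open>An itinerary is the list of the hinges crossed so far, the latest one first, by a line that starts at \<open>h\<close>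
  into \<open>\<tau>\<close>. The direction and the current simplex depend only on the itinerary, not on the starting point.\<close>
primrec side :: "'a set \<Rightarrow> 'a set list \<Rightarrow> 'a set" where
  "side \<tau> [] = \<tau>"
| "side \<tau> (f # fs) = other f (side \<tau> fs)"

primrec base :: "'a set \<Rightarrow> 'a set list \<Rightarrow> 'a set" where
  "base h [] = h"
| "base h (f # fs) = f"

text \<open>Unfolding: the component along \<open>f\<close> is kept, while the conormal component is
  transferred from one conormal to minus the other. The correction is a multiple of the sum of the
  two conormals, which vanishes at a flat hinge.\<close>

primrec direction :: "'a set \<Rightarrow> 'a set \<Rightarrow> 'a set list \<Rightarrow> 'a" where
  "direction h \<tau> [] = conormal \<tau> h"
| "direction h \<tau> (f # fs) = direction h \<tau> fs - (direction h \<tau> fs \<bullet> conormal (side \<tau> fs) f) *\<^sub>R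
     (conormal (side \<tau> fs) f + conormal (other f (side \<tau> fs)) f)"

primrec point_at :: "'a set \<Rightarrow> 'a set \<Rightarrow> 'a \<Rightarrow> 'a set list \<Rightarrow> 'a" where
  "point_at h \<tau> x [] = x"
| "point_at h \<tau> x (f # fs) = point_at h \<tau> x fs + hit (side \<tau> fs) f (direction h \<tau> fs) (point_at h \<tau> x fs) *\<^sub>R direction h \<tau> fs"

primrec time_at :: "'a set \<Rightarrow> 'a set \<Rightarrow> 'a \<Rightarrow> 'a set list \<Rightarrow> real" where
  "time_at h \<tau> x [] = 0"
| "time_at h \<tau> x (f # fs) = time_at h \<tau> x fs + hit (side \<tau> fs) f (direction h \<tau> fs) (point_at h \<tau> x fs)"

text \<open>Collects the conditions that do not involve the starting point. The sign condition says
  that the line heads towards \<open>f\<close>; the condition on vertices keeps it within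
  \<open>stars h\<close>.\<close>

primrec admissible :: "'a set \<Rightarrow> 'a set \<Rightarrow> 'a set list \<Rightarrow> bool" where
  "admissible h \<tau> [] = True"
| "admissible h \<tau> (f # fs) \<longleftrightarrow> admissible h \<tau> fs \<and> facet f (side \<tau> fs) \<and> (\<exists>v\<in>h \<inter> vertices K. v \<in> f) \<and>
     direction h \<tau> fs \<bullet> conormal (side \<tau> fs) f < 0"

text \<open>The conditions on the starting point. Only the hits are constrained; between two hits
  the line is inside the simplex by convexity.\<close>

primrec reach :: "'a set \<Rightarrow> 'a set \<Rightarrow> 'a \<Rightarrow> 'a set list \<Rightarrow> bool" where
  "reach h \<tau> x [] \<longleftrightarrow> x \<in> rel_interior h"
| "reach h \<tau> x (f # fs) \<longleftrightarrow> reach h \<tau> x fs \<and> 0 < hit (side \<tau> fs) f (direction h \<tau> fs) (point_at h \<tau> x fs) \<and>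
     point_at h \<tau> x (f # fs) \<in> rel_interior f"

text \<open>Measured on the outgoing side of the last hinge, where the empty itinerary also makes
  sense and gives the value 1. By \<open>cosine_Cons\<close> the incoming side gives the
  same.\<close>

definition cosine :: "'a set \<Rightarrow> 'a set \<Rightarrow> 'a set list \<Rightarrow> real" where
  "cosine h \<tau> fs = direction h \<tau> fs \<bullet> conormal (side \<tau> fs) (base h fs)"

lemma hit_eq:
  assumes F: "facet f \<sigma>" and um: "u \<bullet> conormal \<sigma> f \<noteq> 0" and q: "q \<in> f" "q = p + s *\<^sub>R u"
  shows "hit \<sigma> f u p = s"
proof -
  let ?q = "SOME q. q \<in> f"
  have q': "?q \<in> f" using q(1) by (rule someI)
  have "(?q - q) \<bullet> conormal \<sigma> f = 0" by (rule conormal(3)[OF F diff_in_dirs[OF q' q(1)]])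
  then have "conormal \<sigma> f \<bullet> (?q - p) = s * (conormal \<sigma> f \<bullet> u)"
    unfolding q(2) by (simp add: inner_diff_left inner_diff_right inner_add_right inner_commute)
  then show ?thesis using um by (simp add: hit_def inner_commute)
qed

lemma reach_base: "reach h \<tau> x fs \<Longrightarrow> point_at h \<tau> x fs \<in> rel_interior (base h fs)"
  by (cases fs) auto

lemma admissible_append: "admissible h \<tau> (ks @ fs) \<Longrightarrow> admissible h \<tau> fs"
  by (induction ks) auto

lemma reach_append: "reach h \<tau> x (ks @ fs) \<Longrightarrow> reach h \<tau> x fs"
  by (induction ks) auto

lemma time_at_append: "reach h \<tau> x (ks @ fs) \<Longrightarrow> time_at h \<tau> x fs \<le> time_at h \<tau> x (ks @ fs) \<and> (ks \<noteq> [] \<longrightarrow> time_at h \<tau> x fs < time_at h \<tau> x (ks @ fs))"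
  by (induction ks) auto

lemma time_at_pos: "reach h \<tau> x fs \<Longrightarrow> fs \<noteq> [] \<Longrightarrow> 0 < time_at h \<tau> x fs"
  using time_at_append[of h \<tau> x fs "[]"] by simp

lemma hit_affine: "a + b = 1 \<Longrightarrow> hit \<sigma> f u (a *\<^sub>R p + b *\<^sub>R q) = a * hit \<sigma> f u p + b * hit \<sigma> f u q"
proof -
  assume ab: "a + b = 1"
  let ?s = "SOME q. q \<in> f"
  have "?s - (a *\<^sub>R p + b *\<^sub>R q) = (a + b) *\<^sub>R ?s - (a *\<^sub>R p + b *\<^sub>R q)" using ab by simp
  also have "\<dots> = a *\<^sub>R (?s - p) + b *\<^sub>R (?s - q)" by (simp add: algebra_simps)
  finally show ?thesis unfolding hit_def by (simp add: inner_add_right add_divide_distrib)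
qed

lemma point_at_affine: "a + b = 1 \<Longrightarrow> point_at h \<tau> (a *\<^sub>R x + b *\<^sub>R y) fs = a *\<^sub>R point_at h \<tau> x fs + b *\<^sub>R point_at h \<tau> y fs"
  by (induction fs) (simp_all add: hit_affine algebra_simps)

lemma point_at_continuous: "continuous_on UNIV (\<lambda>x. point_at h \<tau> x fs)"
proof (induction fs)
  case (Cons f fs)
  show ?case
    unfolding point_at.simps hit_def divide_inverse by (intro continuous_intros Cons.IH)
qed simp

lemma point_at_measurable [measurable]: "(\<lambda>x. point_at h \<tau> x fs) \<in> borel_measurable borel"
  using point_at_continuous by (rule borel_measurable_continuous_onI)

lemma hit_measurable [measurable]: "(\<lambda>p. hit \<sigma> f u p) \<in> borel_measurable borel"
  unfolding hit_def by measurable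

lemma reach_borel: "{x. reach h \<tau> x fs} \<in> sets borel"
proof (induction fs)
  case Nil
  then show ?case by (simp add: rel_interior_borel)
next
  case (Cons f fs)
  have "{x. reach h \<tau> x (f # fs)} = {x. reach h \<tau> x fs} \<inter> {x \<in> space borel. 0 < hit (side \<tau> fs) f (direction h \<tau> fs) (point_at h \<tau> x fs)} \<inter>
      (\<lambda>x. point_at h \<tau> x (f # fs)) -` rel_interior f \<inter> space borel" by auto
  also have "\<dots> \<in> sets borel"
    using measurable_sets[OF point_at_measurable[of h \<tau> "f # fs"] rel_interior_borel, of f] Cons.IH
    by (intro sets.Int) (auto simp del: point_at.simps)
  finally show ?case .
qed

context
  fixes h \<tau>
  assumes F0: "facet h \<tau>"
begin

lemma admissible_invariants:
  "admissible h \<tau> fs \<Longrightarrow> facet (base h fs) (side \<tau> fs) \<and> direction h \<tau> fs \<in> dirs (side \<tau> fs) \<and> norm (direction h \<tau> fs) = 1 \<and>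
     0 < cosine h \<tau> fs"
proof (induction fs)
  case Nil
  then show ?case using F0 conormal[OF F0] conormal_self[OF F0] by (simp add: cosine_def)
next
  case (Cons f fs)
  let ?\<sigma> = "side \<tau> fs" and ?u = "direction h \<tau> fs"
  let ?m = "conormal ?\<sigma> f" and ?\<tau> = "other f ?\<sigma>"
  let ?m' = "conormal ?\<tau> f"
  have F: "facet f ?\<sigma>" and um: "?u \<bullet> ?m < 0" and u: "?u \<in> dirs ?\<sigma>" "norm ?u = 1" using Cons by auto
  have F': "facet f ?\<tau>" using adjacent_facet(2)[OF adjacent_other[OF F]] by simp
  define w where "w = ?u - (?u \<bullet> ?m) *\<^sub>R ?m"
  have w: "w \<in> dirs f"
    unfolding dirs_facet[OF F] w_def using u conormal(2)[OF F] conormal_self[OF F]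
    by (auto simp: inner_diff_left intro!: subspace_diff subspace_scale)
  have d: "direction h \<tau> (f # fs) = w - (?u \<bullet> ?m) *\<^sub>R ?m'" by (simp add: w_def algebra_simps)
  have wm: "w \<bullet> ?m = 0" "w \<bullet> ?m' = 0" using conormal(3)[OF F w] conormal(3)[OF F' w] by auto
  have "?u = w + (?u \<bullet> ?m) *\<^sub>R ?m" by (simp add: w_def)
  then have "(w + (?u \<bullet> ?m) *\<^sub>R ?m) \<bullet> (w + (?u \<bullet> ?m) *\<^sub>R ?m) = 1" using u(2) by (simp add: norm_eq_1)
  then have ww: "w \<bullet> w + (?u \<bullet> ?m) * (?u \<bullet> ?m) = 1"
    using wm(1) conormal_self[OF F] by (simp add: inner_add_left inner_add_right inner_commute[of ?m w])
  have "norm (direction h \<tau> (f # fs)) = 1"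
    unfolding norm_eq_1 d using wm(2) conormal_self[OF F'] ww
    by (simp add: inner_diff_left inner_diff_right inner_commute[of ?m' w])
  moreover have "direction h \<tau> (f # fs) \<in> dirs ?\<tau>"
    unfolding d using w dirs_mono[of f ?\<tau>] F' conormal(2)[OF F']
    by (intro subspace_diff[OF subspace_dirs] subspace_scale[OF subspace_dirs]) auto
  moreover have "direction h \<tau> (f # fs) \<bullet> ?m' = - (?u \<bullet> ?m)"
    unfolding d using wm(2) conormal_self[OF F'] by (simp add: inner_diff_left)
  ultimately show ?case using F' um by (simp add: cosine_def)
qed

lemma cosine_Cons:
  assumes "admissible h \<tau> (f # fs)"
  shows "cosine h \<tau> (f # fs) = - (direction h \<tau> fs \<bullet> conormal (side \<tau> fs) f)"
proof -
  let ?\<sigma> = "side \<tau> fs" and ?u = "direction h \<tau> fs"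
  let ?m = "conormal ?\<sigma> f" and ?m' = "conormal (other f ?\<sigma>) f"
  have F: "facet f ?\<sigma>" and u: "?u \<in> dirs ?\<sigma>" using assms admissible_invariants[of fs] by auto
  have F': "facet f (other f ?\<sigma>)" using adjacent_facet(2)[OF adjacent_other[OF F]] by simp
  have w: "?u - (?u \<bullet> ?m) *\<^sub>R ?m \<in> dirs f"
    unfolding dirs_facet[OF F] using u conormal(2)[OF F] conormal_self[OF F]
    by (auto simp: inner_diff_left intro!: subspace_diff subspace_scale)
  have "direction h \<tau> (f # fs) = (?u - (?u \<bullet> ?m) *\<^sub>R ?m) - (?u \<bullet> ?m) *\<^sub>R ?m'" by (simp add: algebra_simps)
  from arg_cong[where f = "\<lambda>z. z \<bullet> ?m'", OF this] show ?thesis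
    using conormal(3)[OF F' w] conormal_self[OF F'] by (simp add: cosine_def inner_diff_left del: direction.simps)
qed

lemma cosine_le_1: "admissible h \<tau> fs \<Longrightarrow> cosine h \<tau> fs \<le> 1"
  using admissible_invariants[of fs] conormal(1)[of "base h fs" "side \<tau> fs"] norm_cauchy_schwarz[of "direction h \<tau> fs" "conormal (side \<tau> fs) (base h fs)"]
  by (simp add: cosine_def)

lemma reach_segment:
  assumes "admissible h \<tau> fs" "reach h \<tau> x fs" "facet g (side \<tau> fs)"
    "point_at h \<tau> x fs + s *\<^sub>R direction h \<tau> fs \<in> g" "0 < r" "r < s"
  shows "point_at h \<tau> x fs + r *\<^sub>R direction h \<tau> fs \<in> rel_interior (side \<tau> fs)"
  using assms admissible_invariants[of fs] reach_base[of h \<tau> x fs]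
  by (intro open_segment_in_top[of "base h fs" "side \<tau> fs" g _ _ s]) (auto simp: cosine_def)

text \<open>Two lines with a common past leave the same simplex. If one facet were hit earlier than
  the other, that hit would be a point of the open simplex, which no open hinge contains.\<close>

lemma reach_same_length:
  assumes "admissible h \<tau> fs" "reach h \<tau> x fs" "admissible h \<tau> gs" "reach h \<tau> x gs" "length fs = length gs"
  shows "fs = gs"
  using assms
proof (induction fs arbitrary: gs)
  case Nil
  then show ?case by simp
next
  case (Cons f fs)
  then obtain g gs' where gs: "gs = g # gs'" by (cases gs) auto
  have eq: "fs = gs'" using Cons gs by auto
  let ?p = "point_at h \<tau> x fs" and ?u = "direction h \<tau> fs" and ?\<sigma> = "side \<tau> fs"
  define s r where "s = hit ?\<sigma> f ?u ?p" and "r = hit ?\<sigma> g ?u ?p"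
  have s: "0 < s" "?p + s *\<^sub>R ?u \<in> rel_interior f" "facet f ?\<sigma>"
    using Cons.prems by (auto simp: s_def)
  have r: "0 < r" "?p + r *\<^sub>R ?u \<in> rel_interior g" "facet g ?\<sigma>"
    using Cons.prems eq unfolding gs by (auto simp: r_def)
  have a: "admissible h \<tau> fs" "reach h \<tau> x fs" using Cons.prems by auto
  have "\<not> r < s"
  proof
    assume "r < s"
    then have "?p + r *\<^sub>R ?u \<in> rel_interior ?\<sigma>"
      using reach_segment[OF a s(3)] s(2) r(1) rel_interior_subset by blast
    then have "g = ?\<sigma>" using rel_interior_eq[OF _ _ r(2)] r(3) hinge_in top_in by blast
    then show False using r(3) hinge_not_top by auto
  qed
  moreover have "\<not> s < r"
  proof
    assume "s < r"
    then have "?p + s *\<^sub>R ?u \<in> rel_interior ?\<sigma>"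
      using reach_segment[OF a r(3)] r(2) s(1) rel_interior_subset by blast
    then have "f = ?\<sigma>" using rel_interior_eq[OF _ _ s(2)] s(3) hinge_in top_in by blast
    then show False using s(3) hinge_not_top by auto
  qed
  ultimately have "s = r" by simp
  then have "f = g" using rel_interior_eq[OF _ _ s(2)] r s hinge_in by blast
  then show ?case using eq gs by simp
qed

lemma reach_suffix:
  assumes "admissible h \<tau> fs" "reach h \<tau> x fs" "admissible h \<tau> gs" "reach h \<tau> x gs" "length fs \<le> length gs"
  shows "\<exists>ks. gs = ks @ fs"
proof -
  let ?gs = "drop (length gs - length fs) gs"
  have gs: "gs = take (length gs - length fs) gs @ ?gs" by simp
  have "admissible h \<tau> ?gs" "reach h \<tau> x ?gs"
    using assms(3,4) gs admissible_append reach_append by metis+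
  then have "fs = ?gs" using assms by (intro reach_same_length[OF assms(1,2)]) auto
  then show ?thesis using gs by metis
qed

lemma time_at_inj:
  assumes "admissible h \<tau> fs" "reach h \<tau> x fs" "admissible h \<tau> gs" "reach h \<tau> x gs" "time_at h \<tau> x fs = time_at h \<tau> x gs"
  shows "fs = gs"
proof -
  have "fs = gs" if *: "admissible h \<tau> fs" "reach h \<tau> x fs" "admissible h \<tau> gs" "reach h \<tau> x gs" "time_at h \<tau> x fs = time_at h \<tau> x gs"
    "length fs \<le> length gs" for fs gs
  proof -
    obtain ks where ks: "gs = ks @ fs" using reach_suffix[OF *(1-4,6)] by blast
    then have "ks = []" using time_at_append[of h \<tau> x ks fs] *(4,5) by auto
    then show ?thesis using ks by simp
  qed
  then show ?thesis using assms linear[of "length fs" "length gs"] by metis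
qed

section \<open>Correspondence between itineraries and crossings of the geodesic\<close>

text \<open>Induction with \<open>geodesic_continues\<close>. This direction allows the set of
  starting points of an itinerary to be described by \<open>reach\<close> alone.\<close>

lemma trajectory:
  assumes m: "maximal_geodesic (stars h) I \<gamma>" and I: "0 \<in> I" "\<gamma> 0 = x" "right_velocity \<gamma> 0 (conormal \<tau> h)"
  shows "admissible h \<tau> fs \<Longrightarrow> reach h \<tau> x fs \<Longrightarrow> time_at h \<tau> x fs \<in> I \<and> \<gamma> (time_at h \<tau> x fs) = point_at h \<tau> x fs \<and>
     right_velocity \<gamma> (time_at h \<tau> x fs) (direction h \<tau> fs) \<and>
     (\<forall>f gs. fs = f # gs \<longrightarrow> (\<exists>w. crosses_at n K \<gamma> (time_at h \<tau> x fs) f (side \<tau> gs) (side \<tau> fs) (cosine h \<tau> fs) w))"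
proof (induction fs)
  case Nil
  then show ?case using I by simp
next
  case (Cons f fs)
  let ?\<sigma> = "side \<tau> fs" and ?u = "direction h \<tau> fs" and ?t = "time_at h \<tau> x fs" and ?b = "base h fs"
  let ?s = "hit ?\<sigma> f ?u (point_at h \<tau> x fs)"
  have a: "admissible h \<tau> fs" "reach h \<tau> x fs" "facet f ?\<sigma>" "?u \<bullet> conormal ?\<sigma> f < 0" "0 < ?s" "point_at h \<tau> x (f # fs) \<in> rel_interior f"
    "\<exists>v\<in>h \<inter> vertices K. v \<in> f"
    using Cons.prems by auto
  have IH: "?t \<in> I" "\<gamma> ?t = point_at h \<tau> x fs" "right_velocity \<gamma> ?t ?u" using Cons.IH a by auto
  note inv = admissible_invariants[OF a(1), unfolded cosine_def]
  have A: "adjacent_at n K f ?\<sigma> (other f ?\<sigma>)" by (rule adjacent_other[OF a(3)])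
  have F': "facet f (other f ?\<sigma>)" using adjacent_facet(2)[OF A] .
  have W: "rel_interior s \<subseteq> stars h" if "s \<in> K" "f \<subseteq> s" for s
  proof -
    obtain v where "v \<in> h \<inter> vertices K" "v \<in> s" using a(7) \<open>f \<subseteq> s\<close> by blast
    then show ?thesis using stars_iff[OF \<open>s \<in> K\<close>] by blast
  qed
  have p: "\<gamma> ?t + ?s *\<^sub>R ?u \<in> rel_interior f" using IH(2) a(6) by simp
  have b: "\<gamma> ?t \<in> rel_interior ?b" using reach_base[OF a(2)] IH(2) by simp
  have K: "f \<in> K" "?\<sigma> \<in> K" "other f ?\<sigma> \<in> K" using a(3) F' hinge_in top_in by blast+
  have *: "?t + ?s \<in> I" "\<gamma> (?t + ?s) = \<gamma> ?t + ?s *\<^sub>R ?u"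
    "crosses_at n K \<gamma> (?t + ?s) f ?\<sigma> (other f ?\<sigma>) (- (?u \<bullet> conormal ?\<sigma> f)) (?u - (?u \<bullet> conormal ?\<sigma> f) *\<^sub>R conormal ?\<sigma> f)"
    by (rule geodesic_continues[OF m IH(1,3), of ?b ?\<sigma> f "other f ?\<sigma>" ?s]; use inv b A a p W K F' in blast)+
  have "right_velocity \<gamma> (?t + ?s) (direction h \<tau> (f # fs))"
    using crosses_velocity(2)[OF *(3)] by (simp add: algebra_simps)
  then show ?case
    using * IH(2) cosine_Cons[OF Cons.prems(1)] by auto
qed

text \<open>The converse of \<open>trajectory\<close>, by induction on the number of crossings up to
  \<open>t\<close>. The same count bounds the length of the itinerary.\<close>

lemma crossing_itinerary:
  assumes m: "maximal_geodesic (stars h) I \<gamma>" and I: "0 \<in> I" "\<gamma> 0 = x" "right_velocity \<gamma> 0 (conormal \<tau> h)"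
    and x: "x \<in> rel_interior h"
    and t: "t \<in> I" "0 < t" "f \<in> hinges n K" "\<gamma> t \<in> rel_interior f"
    and fin: "finite {s. 0 < s \<and> s \<le> t \<and> (\<exists>g\<in>hinges n K. \<gamma> s \<in> rel_interior g)}"
  shows "\<exists>fs. admissible h \<tau> (f # fs) \<and> reach h \<tau> x (f # fs) \<and> time_at h \<tau> x (f # fs) = t \<and>
      length (f # fs) \<le> card {s. 0 < s \<and> s \<le> t \<and> (\<exists>g\<in>hinges n K. \<gamma> s \<in> rel_interior g)} \<and>
      (\<forall>g\<in>set (f # fs). \<exists>s. 0 < s \<and> s \<le> t \<and> \<gamma> s \<in> rel_interior g)"
  using t fin
proof (induction "card {s. 0 < s \<and> s \<le> t \<and> (\<exists>g\<in>hinges n K. \<gamma> s \<in> rel_interior g)}" arbitrary: t f rule: less_induct)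
  case less
  let ?C = "\<lambda>t. {s. 0 < s \<and> s \<le> t \<and> (\<exists>g\<in>hinges n K. \<gamma> s \<in> rel_interior g)}"
  let ?S = "{s. 0 < s \<and> s < t \<and> (\<exists>g\<in>hinges n K. \<gamma> s \<in> rel_interior g)}"
  have g: "geodesic_in n K (stars h) I \<gamma>" using m by (simp add: maximal_geodesic_def)
  have CS: "?C t = insert t ?S" using less.prems by force
  have finS: "finite ?S" using less.prems(5) CS by simp
  \<comment> \<open>The itinerary up to the last crossing before \<open>t\<close>, or the empty one
    at time 0 if there is no crossing in between.\<close>
  have "\<exists>fs t'. admissible h \<tau> fs \<and> reach h \<tau> x fs \<and> time_at h \<tau> x fs = t' \<and> 0 \<le> t' \<and> t' < t \<and> length fs \<le> card ?S \<and>
      (\<forall>g\<in>set fs. \<exists>s. 0 < s \<and> s \<le> t \<and> \<gamma> s \<in> rel_interior g) \<and> (\<forall>s\<in>?S. s \<le> t')"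
  proof (cases "?S = {}")
    case True
    then show ?thesis using x less.prems by (intro exI[of _ "[]"] exI[of _ 0]) auto
  next
    case False
    define t' where "t' = Max ?S"
    have t': "t' \<in> ?S" "\<And>s. s \<in> ?S \<Longrightarrow> s \<le> t'"
      unfolding t'_def by (rule Max_in[OF finS False]) (rule Max_ge[OF finS])
    then obtain f' where f': "f' \<in> hinges n K" "\<gamma> t' \<in> rel_interior f'" by auto
    have "t' \<in> I" using g I less.prems t' unfolding geodesic_in_def is_interval_1
      by (metis (no_types, lifting) less_imp_le mem_Collect_eq)
    have sub: "?C t' \<subseteq> ?S" using t'(1) by auto
    have cS: "card (?C t') \<le> card ?S" using sub finS by (rule card_mono[rotated])
    moreover have "card (?C t) = Suc (card ?S)" unfolding CS using finS by simp
    ultimately have lt: "card (?C t') < card (?C t)" by simp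
    have fin': "finite (?C t')" using sub finS finite_subset by blast
    have "0 < t'" using t' by simp
    from less.hyps[OF lt \<open>t' \<in> I\<close> this f' fin'] obtain fs where
      fs: "admissible h \<tau> (f' # fs)" "reach h \<tau> x (f' # fs)" "time_at h \<tau> x (f' # fs) = t'" "length (f' # fs) \<le> card (?C t')"
        "\<forall>g\<in>set (f' # fs). \<exists>s. 0 < s \<and> s \<le> t' \<and> \<gamma> s \<in> rel_interior g" by blast
    have "\<forall>g\<in>set (f' # fs). \<exists>s. 0 < s \<and> s \<le> t \<and> \<gamma> s \<in> rel_interior g"
    proof
      fix g assume "g \<in> set (f' # fs)"
      then obtain s where "0 < s" "s \<le> t'" "\<gamma> s \<in> rel_interior g" using fs(5) by blast
      then show "\<exists>s. 0 < s \<and> s \<le> t \<and> \<gamma> s \<in> rel_interior g" using t'(1) by (intro exI[of _ s]) simp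
    qed
    then show ?thesis using fs t' cS by (intro exI[of _ "f' # fs"] exI[of _ t']) auto
  qed
  then obtain fs where fs: "admissible h \<tau> fs" "reach h \<tau> x fs" "0 \<le> time_at h \<tau> x fs" "time_at h \<tau> x fs < t" "length fs \<le> card ?S"
      "\<forall>g\<in>set fs. \<exists>s. 0 < s \<and> s \<le> t \<and> \<gamma> s \<in> rel_interior g" "\<forall>s\<in>?S. s \<le> time_at h \<tau> x fs" by blast
  let ?t = "time_at h \<tau> x fs" and ?u = "direction h \<tau> fs" and ?\<sigma> = "side \<tau> fs" and ?b = "base h fs" and ?p = "point_at h \<tau> x fs"
  have tr: "?t \<in> I" "\<gamma> ?t = ?p" "right_velocity \<gamma> ?t ?u"
    using trajectory[OF m I fs(1,2)] by auto
  note inv = admissible_invariants[OF fs(1), unfolded cosine_def]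
  have no: "\<gamma> s \<notin> rel_interior g" if "?t < s" "s < t" "g \<in> hinges n K" for s g
  proof
    assume "\<gamma> s \<in> rel_interior g"
    then have "s \<in> ?S" using that fs(3) by auto
    then show False using fs(7) that by auto
  qed
  obtain \<sigma> where \<sigma>: "\<sigma> \<in> top_simplices n K" "\<And>s. ?t < s \<Longrightarrow> s < t \<Longrightarrow> \<gamma> s \<in> rel_interior \<sigma> \<and> \<gamma> s = \<gamma> ?t + (s - ?t) *\<^sub>R ?u"
    "\<gamma> t = \<gamma> ?t + (t - ?t) *\<^sub>R ?u" "left_velocity \<gamma> t ?u"
    by (rule geodesic_between_hinges[OF g tr(1) less.prems(1) fs(4) _ tr(3)], erule (2) no, rule that; blast)
  \<comment> \<open>Just after the previous crossing the path lies in both open simplices.\<close>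
  have \<sigma>side: "\<sigma> = ?\<sigma>"
  proof -
    have "\<forall>\<^sub>F r in at_right 0. ?p + r *\<^sub>R ?u \<in> rel_interior ?\<sigma>"
      using inv reach_base[OF fs(2)] by (intro inward[of ?b]) auto
    moreover have "\<forall>\<^sub>F r in at_right 0. 0 < r \<and> r < t - ?t"
      unfolding eventually_at_right_field using fs(4) by (intro exI[of _ "t - ?t"]) auto
    ultimately have "\<forall>\<^sub>F r in at_right (0::real). \<sigma> = ?\<sigma>"
    proof eventually_elim
      fix r assume r: "?p + r *\<^sub>R ?u \<in> rel_interior ?\<sigma>" "0 < r \<and> r < t - ?t"
      have "?p + r *\<^sub>R ?u \<in> rel_interior \<sigma>" using \<sigma>(2)[of "?t + r"] r(2) tr(2) by auto
      then show "\<sigma> = ?\<sigma>" using r(1) rel_interior_eq \<sigma>(1) inv top_in by blast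
    qed
    then show ?thesis by simp
  qed
  have t\<sigma>: "\<gamma> t \<in> \<sigma>"
  proof -
    have "((\<lambda>s. \<gamma> ?t + (s - ?t) *\<^sub>R ?u) \<longlongrightarrow> \<gamma> ?t + (t - ?t) *\<^sub>R ?u) (at_left t)"
      by (intro tendsto_intros)
    moreover have "\<forall>\<^sub>F s in at_left t. \<gamma> ?t + (s - ?t) *\<^sub>R ?u \<in> \<sigma>"
      unfolding eventually_at_left_field using fs(4) \<sigma>(2) rel_interior_subset[of \<sigma>] by (metis subsetD)
    moreover have "closed \<sigma>" using \<sigma>(1) top_in closed_simplex by blast
    ultimately show ?thesis unfolding \<sigma>(3) using Lim_in_closed_set[of \<sigma>] by (metis trivial_limit_at_left_real)
  qed
  \<comment> \<open>The face \<open>f \<inter> \<sigma>\<close> of \<open>f\<close> contains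
    \<open>\<gamma> t\<close>, a point of the relative interior of \<open>f\<close>.\<close>
  have "f \<subseteq> \<sigma>"
  proof -
    have "(f \<inter> \<sigma>) face_of f" using complex(3) hinge_in less.prems(3) top_in \<sigma>(1) by blast
    moreover have "\<gamma> t \<in> (f \<inter> \<sigma>) \<inter> rel_interior f" using t\<sigma> less.prems(4) rel_interior_subset by blast
    ultimately have "f \<inter> \<sigma> = f" using face_of_disjoint_rel_interior by blast
    then show ?thesis by blast
  qed
  then have F: "facet f \<sigma>" using less.prems(3) \<sigma>(1) by simp
  have "straight_at n K \<gamma> t \<or> (\<exists>f \<sigma> \<tau> c w. crosses_at n K \<gamma> t f \<sigma> \<tau> c w)"
    using g less.prems(1) unfolding geodesic_in_def by blast
  moreover have "\<not> straight_at n K \<gamma> t"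
    using less.prems(3,4) rel_interior_eq hinge_in top_in hinge_not_top unfolding straight_at_def by metis
  ultimately obtain f0 \<sigma>0 \<tau>0 c w where c: "crosses_at n K \<gamma> t f0 \<sigma>0 \<tau>0 c w" by blast
  have f0: "f0 = f" using c less.prems(3,4) rel_interior_eq hinge_in unfolding crosses_at_def adjacent_at_def by metis
  have A0: "adjacent_at n K f \<sigma>0 \<tau>0" and c0: "0 < c" and w: "w \<in> dirs f" using c f0 by (auto simp: crosses_at_def)
  note F0' = adjacent_facet(1)[OF A0]
  have u: "?u = w - c *\<^sub>R conormal \<sigma>0 f"
    using left_velocity_unique[OF \<sigma>(4)] crosses_velocity(1)[OF c] f0 by simp
  have um: "?u \<bullet> conormal \<sigma>0 f = - c"
    unfolding u using conormal(3)[OF F0' w] conormal_self[OF F0'] by (simp add: inner_diff_left)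
  \<comment> \<open>Followed backwards from \<open>\<gamma> t\<close>, the path lies in both open
    simplices.\<close>
  have "\<sigma>0 = \<sigma>"
  proof -
    have "- ?u \<in> dirs \<sigma>0" unfolding u using w dirs_mono[of f \<sigma>0] F0' conormal(2)[OF F0']
      by (intro subspace_neg[OF subspace_dirs] subspace_diff[OF subspace_dirs] subspace_scale[OF subspace_dirs]) auto
    then have "\<forall>\<^sub>F r in at_right 0. \<gamma> t + r *\<^sub>R (- ?u) \<in> rel_interior \<sigma>0"
      using um c0 by (intro inward[OF F0' less.prems(4)]) auto
    moreover have "\<forall>\<^sub>F r in at_right 0. 0 < r \<and> r < t - ?t"
      unfolding eventually_at_right_field using fs(4) by (intro exI[of _ "t - ?t"]) auto
    ultimately have "\<forall>\<^sub>F r in at_right (0::real). \<sigma>0 = \<sigma>"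
    proof eventually_elim
      fix r assume r: "\<gamma> t + r *\<^sub>R (- ?u) \<in> rel_interior \<sigma>0" "0 < r \<and> r < t - ?t"
      have "\<gamma> (t - r) \<in> rel_interior \<sigma>" "\<gamma> (t - r) = \<gamma> ?t + (t - r - ?t) *\<^sub>R ?u" using \<sigma>(2)[of "t - r"] r(2) by auto
      then have "\<gamma> t + r *\<^sub>R (- ?u) \<in> rel_interior \<sigma>" unfolding \<sigma>(3) by (simp add: algebra_simps)
      then show "\<sigma>0 = \<sigma>" using r(1) rel_interior_eq \<sigma>(1) F0' top_in by blast
    qed
    then show ?thesis by simp
  qed
  then have um': "?u \<bullet> conormal \<sigma> f < 0" using um c0 by simp
  have "\<gamma> t \<in> f" using less.prems(4) rel_interior_subset by blast
  have hit: "hit ?\<sigma> f ?u ?p = t - ?t"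
    using \<sigma>(3) tr(2) F um' \<open>\<gamma> t \<in> f\<close> unfolding \<sigma>side[symmetric] by (intro hit_eq[of _ _ _ "\<gamma> t"]) auto
  have "\<gamma> t \<in> stars h" using g less.prems(1) unfolding geodesic_in_def by blast
  then have "\<exists>v\<in>h \<inter> vertices K. v \<in> f" using stars_iff less.prems(3,4) hinge_in by blast
  then have "admissible h \<tau> (f # fs)" using fs(1) F um' \<sigma>side by simp
  moreover have "reach h \<tau> x (f # fs)" using fs(2,4) hit \<sigma>(3) tr(2) less.prems(4) by simp
  moreover have "time_at h \<tau> x (f # fs) = t" using hit by simp
  moreover have "length (f # fs) \<le> card (?C t)" unfolding CS using fs(5) finS by simp
  moreover have "\<forall>g\<in>set (f # fs). \<exists>s. 0 < s \<and> s \<le> t \<and> \<gamma> s \<in> rel_interior g"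
    using fs(6) less.prems(2,4) by auto
  ultimately show ?case by blast
qed

section \<open>The arrival map: convexity, inverse and Jacobian\<close>

text \<open>Every condition in \<open>reach\<close> asks that an affine function of the starting
  point takes values in a convex set.\<close>

lemma reach_convex: "admissible h \<tau> fs \<Longrightarrow> convex {x. reach h \<tau> x fs}"
proof (induction fs)
  case Nil
  then show ?case using F0 convex_hinge by (simp add: convex_rel_interior)
next
  case (Cons f fs)
  have cf: "convex (rel_interior f)" using Cons.prems convex_hinge by (simp add: convex_rel_interior)
  show ?case
  proof (rule convexI)
    fix x y and a b :: real assume xy: "x \<in> {x. reach h \<tau> x (f # fs)}" "y \<in> {x. reach h \<tau> x (f # fs)}" and ab: "0 \<le> a" "0 \<le> b" "a + b = 1"
    have "reach h \<tau> (a *\<^sub>R x + b *\<^sub>R y) fs" using convexD[OF Cons.IH _ _ ab] Cons.prems xy by auto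
    moreover have "point_at h \<tau> (a *\<^sub>R x + b *\<^sub>R y) (f # fs) \<in> rel_interior f"
      unfolding point_at_affine[OF ab(3)] using xy by (intro convexD[OF cf _ _ ab]) (auto simp del: point_at.simps)
    moreover have "0 < hit (side \<tau> fs) f (direction h \<tau> fs) (point_at h \<tau> (a *\<^sub>R x + b *\<^sub>R y) fs)"
    proof -
      let ?H = "\<lambda>x. hit (side \<tau> fs) f (direction h \<tau> fs) (point_at h \<tau> x fs)"
      have "?H x \<in> {0<..}" "?H y \<in> {0<..}" using xy by auto
      then have "a *\<^sub>R ?H x + b *\<^sub>R ?H y \<in> {0<..}" by (rule convexD[OF convex_real_interval(3) _ _ ab])
      then show ?thesis unfolding point_at_affine[OF ab(3)] hit_affine[OF ab(3)] by simp
    qed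
    ultimately show "a *\<^sub>R x + b *\<^sub>R y \<in> {x. reach h \<tau> x (f # fs)}" by simp
  qed
qed

lemma point_at_hull:
  assumes "admissible h \<tau> fs" "x - y \<in> dirs h" "y \<in> h" "q \<in> base h fs"
  shows "point_at h \<tau> x fs - q \<in> dirs (base h fs)"
  using assms(1,4)
proof (induction fs arbitrary: q)
  case Nil
  have "x - q = (x - y) + (y - q)" by simp
  also have "\<dots> \<in> dirs h" using Nil assms by (intro subspace_add) (auto simp: diff_in_dirs)
  finally show ?case by simp
next
  case (Cons f fs)
  let ?\<sigma> = "side \<tau> fs" and ?u = "direction h \<tau> fs" and ?p = "point_at h \<tau> x fs"
  let ?m = "conormal ?\<sigma> f" and ?q = "SOME q. q \<in> f"
  have inv: "facet (base h fs) ?\<sigma>" "?u \<in> dirs ?\<sigma>" using admissible_invariants[of fs] Cons.prems by auto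
  have F: "facet f ?\<sigma>" "?u \<bullet> ?m < 0" using Cons.prems by auto
  have q: "q \<in> f" using Cons.prems by simp
  then have q': "?q \<in> f" by (rule someI)
  obtain r where r: "r \<in> base h fs" using inv hinge_nonempty by blast
  have "?p - r \<in> dirs (base h fs)" using Cons r by auto
  then have "?p - r \<in> dirs ?\<sigma>" using inv dirs_mono by blast
  moreover have "r - q \<in> dirs ?\<sigma>" using r q inv F by (intro diff_in_dirs) auto
  ultimately have "(?p - r) + (r - q) + hit ?\<sigma> f ?u ?p *\<^sub>R ?u \<in> dirs ?\<sigma>"
    using inv(2) by (intro subspace_add[OF subspace_dirs] subspace_scale[OF subspace_dirs])
  then have 1: "point_at h \<tau> x (f # fs) - q \<in> dirs ?\<sigma>" by (simp add: algebra_simps)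
  have "(?q - q) \<bullet> ?m = 0" by (rule conormal(3)[OF F(1) diff_in_dirs[OF q' q]])
  moreover have "hit ?\<sigma> f ?u ?p * (?u \<bullet> ?m) = (?q - ?p) \<bullet> ?m"
    using F(2) by (simp add: hit_def inner_commute)
  ultimately have "(point_at h \<tau> x (f # fs) - q) \<bullet> ?m = 0"
    by (simp add: inner_diff_left inner_add_left)
  then show ?case using 1 dirs_facet[OF F(1)] by simp
qed

text \<open>Each leg is undone by moving back along its direction to the previous hyperplane, which
  the direction meets transversally because the cosine is positive. The inverse yields injectivity
  and Borel images.\<close>

lemma point_at_inverse:
  assumes "admissible h \<tau> fs" "y \<in> h"
  shows "\<exists>\<rho>. continuous_on UNIV \<rho> \<and> (\<forall>x. x - y \<in> dirs h \<longrightarrow> \<rho> (point_at h \<tau> x fs) = x)"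
  using assms(1)
proof (induction fs)
  case Nil
  show ?case by (intro exI[of _ "\<lambda>x. x"]) auto
next
  case (Cons f fs)
  then obtain \<rho> where \<rho>: "continuous_on UNIV \<rho>" "\<And>x. x - y \<in> dirs h \<Longrightarrow> \<rho> (point_at h \<tau> x fs) = x" by auto
  let ?\<sigma> = "side \<tau> fs" and ?u = "direction h \<tau> fs" and ?b = "base h fs"
  let ?m = "conormal ?\<sigma> ?b"
  have inv: "facet ?b ?\<sigma>" "0 < ?u \<bullet> ?m" using admissible_invariants[of fs] Cons.prems by (auto simp: cosine_def)
  obtain q where q: "q \<in> ?b" using inv hinge_nonempty by blast
  define B where "B z = z - ((?m \<bullet> (z - q)) / (?m \<bullet> ?u)) *\<^sub>R ?u" for z
  have cB: "continuous_on UNIV B" unfolding B_def divide_inverse by (intro continuous_intros)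
  have "B (point_at h \<tau> x (f # fs)) = point_at h \<tau> x fs" if "x - y \<in> dirs h" for x
  proof -
    let ?p = "point_at h \<tau> x fs" and ?s = "hit ?\<sigma> f ?u (point_at h \<tau> x fs)"
    have "?p - q \<in> dirs ?b" using point_at_hull[OF _ that assms(2) q] Cons.prems by simp
    then have "(?p - q) \<bullet> ?m = 0" by (rule conormal(3)[OF inv(1)])
    then have "?m \<bullet> (?p + ?s *\<^sub>R ?u - q) = ?s * (?m \<bullet> ?u)"
      by (simp add: inner_diff_left inner_diff_right inner_add_right inner_commute)
    then have "?m \<bullet> (?p + ?s *\<^sub>R ?u - q) / (?m \<bullet> ?u) = ?s" using inv(2) by (simp add: inner_commute)
    then show ?thesis by (simp add: B_def)
  qed
  then show ?case using \<rho> cB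
    by (intro exI[of _ "\<lambda>z. \<rho> (B z)"] conjI continuous_on_compose2[OF \<rho>(1) cB]) (auto simp del: point_at.simps)
qed

text \<open>One use of \<open>flat_measure_project\<close> per leg. The factor at the start of a leg
  is the cosine supplied by the induction hypothesis, and the factor at its end is the next
  cosine.\<close>

lemma point_at_jacobian:
  assumes "admissible h \<tau> fs" "G \<in> sets borel"
  shows "emeasure (flat_measure h) ((\<lambda>x. point_at h \<tau> x fs) -` G) = ennreal (cosine h \<tau> fs) * emeasure (flat_measure (base h fs)) G"
  using assms
proof (induction fs arbitrary: G)
  case Nil
  then show ?case using conormal_self[OF F0] by (simp add: cosine_def)
next
  case (Cons f fs)
  let ?\<sigma> = "side \<tau> fs" and ?u = "direction h \<tau> fs" and ?b = "base h fs"
  let ?m = "conormal ?\<sigma> ?b" and ?m' = "conormal ?\<sigma> f" and ?q = "SOME q. q \<in> f"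
  have inv: "facet ?b ?\<sigma>" "?u \<in> dirs ?\<sigma>" "norm ?u = 1" "0 < ?u \<bullet> ?m" using admissible_invariants[of fs] Cons.prems by (auto simp: cosine_def)
  have F: "facet f ?\<sigma>" "?u \<bullet> ?m' < 0" using Cons.prems by auto
  obtain p where p: "p \<in> ?b" using inv hinge_nonempty by blast
  have q: "?q \<in> f" using hinge_nonempty F by (simp add: some_in_eq)
  define \<psi> where "\<psi> x = x + ((?m' \<bullet> (?q - x)) / (?m' \<bullet> ?u)) *\<^sub>R ?u" for x
  have "\<psi> \<in> borel_measurable borel" unfolding \<psi>_def by measurable
  then have \<psi>G: "\<psi> -` G \<in> sets borel" using measurable_sets[of \<psi> borel borel G] Cons.prems by simp
  have "(\<lambda>x. point_at h \<tau> x (f # fs)) -` G = (\<lambda>x. point_at h \<tau> x fs) -` (\<psi> -` G)"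
    by (simp add: vimage_def \<psi>_def hit_def)
  then have "emeasure (flat_measure h) ((\<lambda>x. point_at h \<tau> x (f # fs)) -` G) = ennreal (cosine h \<tau> fs) * emeasure (flat_measure ?b) (\<psi> -` G)"
    using Cons.IH[OF _ \<psi>G] Cons.prems by simp
  also have "ennreal (cosine h \<tau> fs) = ennreal \<bar>?u \<bullet> ?m\<bar>" using inv by (simp add: cosine_def)
  also have "\<dots> * emeasure (flat_measure ?b) (\<psi> -` G) = ennreal \<bar>?u \<bullet> ?m'\<bar> * emeasure (flat_measure f) G"
    unfolding \<psi>_def
  proof (rule flat_measure_project[OF subspace_dirs conormal(2,1)[OF inv(1)] conormal(2,1)[OF F(1)] inv(2,3) _ _ dirs_facet[OF inv(1)] dirs_facet[OF F(1)] p q])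
    show "?q - p \<in> dirs ?\<sigma>" using p q inv F by (intro diff_in_dirs) auto
  qed (use inv F Cons.prems in auto)
  also have "\<bar>?u \<bullet> ?m'\<bar> = cosine h \<tau> (f # fs)" using cosine_Cons[OF Cons.prems(1)] F by simp
  finally show ?case by simp
qed

end

end

section \<open>Second order estimates\<close>

text \<open>The separating normal has to lie in \<open>dirs S\<close> to define a slab there. Hence
  zero is separated from the set of differences, with a normal taken in the span of that
  set.\<close>

lemma emeasure_near_disjoint_convex:
  fixes U U' :: "'a::euclidean_space set"
  assumes q: "q \<in> S" and r: "0 < r" and \<eta>: "0 \<le> \<eta>"
    and U: "convex U" "convex U'" "U \<inter> U' = {}" "U \<subseteq> S" "U' \<subseteq> S"
    and X: "X \<subseteq> cball q r" "\<And>x. x \<in> X \<Longrightarrow> x \<in> U \<and> (\<exists>x'\<in>U'. norm (x - x') \<le> \<eta>)"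
  shows "emeasure (flat_measure S) X \<le> ennreal ((2 * r) ^ (dim (dirs S) - 1) * \<eta>)"
proof (cases "X = {}")
  case False
  then have ne: "U \<noteq> {}" "U' \<noteq> {}" using X(2) by auto
  let ?S = "{y - x | x y. x \<in> U \<and> y \<in> U'}"
  have "convex {x - y | x y. x \<in> U' \<and> y \<in> U}"
    using convex_differences[OF U(2,1)] by (simp add: UNION_singleton_eq_range full_SetCompr_eq) (auto simp: set_eq_iff elim!: back_subst[of convex])
  then have "convex ?S" by (rule back_subst[of convex]) auto
  moreover have "?S \<noteq> {}" using ne by blast
  moreover have "0 \<notin> ?S" using U(3) by auto
  ultimately obtain a where a: "a \<in> span ?S" "a \<noteq> 0" "\<And>s. s \<in> ?S \<Longrightarrow> 0 \<le> a \<bullet> s"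
    using separating_hyperplane_set_0_inspan[of ?S] by blast
  have "?S \<subseteq> dirs S" using U(4,5) diff_in_dirs by blast
  then have "span ?S \<subseteq> dirs S" by (intro span_minimal) auto
  then have aS: "a \<in> dirs S" using a(1) by blast
  define a' where "a' = (1 / norm a) *\<^sub>R a"
  have a': "a' \<in> dirs S" "norm a' = 1" using aS a(2) by (auto simp: a'_def subspace_scale)
  have sep: "a' \<bullet> x \<le> a' \<bullet> y" if "x \<in> U" "y \<in> U'" for x y
  proof -
    have "0 \<le> a \<bullet> (y - x)" using that by (intro a(3)) auto
    then show ?thesis using a(2) by (simp add: a'_def inner_diff_right divide_simps)
  qed
  \<comment> \<open>All of \<open>U\<close> lies below the level \<open>b\<close> and all of
    \<open>U'\<close> above it, so a point of \<open>U\<close> within \<open>\<eta>\<close> of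
    \<open>U'\<close> has level at least \<open>b - \<eta>\<close>.\<close>
  define b where "b = Sup ((\<lambda>x. a' \<bullet> x) ` U)"
  obtain y0 where y0: "y0 \<in> U'" using ne by auto
  have bdd: "bdd_above ((\<lambda>x. a' \<bullet> x) ` U)" using sep[OF _ y0] by (auto intro!: bdd_aboveI2)
  have "X \<subseteq> {x \<in> cball q r. (b - \<eta>) \<le> a' \<bullet> x \<and> a' \<bullet> x \<le> (b - \<eta>) + \<eta>}"
  proof
    fix x assume x: "x \<in> X"
    then obtain x' where x': "x \<in> U" "x' \<in> U'" "norm (x - x') \<le> \<eta>" using X(2) by blast
    have 1: "a' \<bullet> x \<le> b" unfolding b_def using x'(1) bdd by (intro cSup_upper) auto
    have "b \<le> a' \<bullet> x'" unfolding b_def using ne sep x'(2) by (intro cSup_least) auto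
    moreover have "a' \<bullet> x' - a' \<bullet> x \<le> norm a' * norm (x' - x)"
      unfolding inner_diff_right[symmetric] by (rule norm_cauchy_schwarz)
    ultimately have "b - \<eta> \<le> a' \<bullet> x" using x'(3) a'(2) by (simp add: norm_minus_commute)
    then show "x \<in> {x \<in> cball q r. (b - \<eta>) \<le> a' \<bullet> x \<and> a' \<bullet> x \<le> (b - \<eta>) + \<eta>}" using 1 x X(1) by auto
  qed
  then show ?thesis by (rule emeasure_flat_measure_slab[OF q a' r \<eta>])
qed simp

text \<open>Each crossing moves the normal by at most \<open>2 * e\<close>, and the projected
  direction by at most \<open>(normal_const N + 1) * e\<^sup>2\<close>. The extra unit in
  \<open>real N + 1\<close> pays for lines that start into the other simplex at \<open>h\<close>. In
  \<open>cosine_const\<close> the square stems from a product of two normal components, each at most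
  \<open>normal_const N * e\<close>.\<close>

definition normal_const :: "nat \<Rightarrow> real" where "normal_const N = 2 * (real N + 1)"
definition direction_const :: "nat \<Rightarrow> real" where "direction_const N = (real N + 1) * (normal_const N + 1)"
definition cosine_const :: "nat \<Rightarrow> real" where "cosine_const N = direction_const N + normal_const N * normal_const N"

lemma K_ge_1: "1 \<le> normal_const N" "1 \<le> direction_const N" "1 \<le> cosine_const N"
proof -
  show 1: "1 \<le> normal_const N" by (simp add: normal_const_def)
  have "1 * 1 \<le> (real N + 1) * (normal_const N + 1)" using 1 by (intro mult_mono) auto
  then show 2: "1 \<le> direction_const N" by (simp add: direction_const_def)
  have "0 \<le> normal_const N * normal_const N" by simp
  with 2 show "1 \<le> cosine_const N" unfolding cosine_const_def by linarith
qed

context flat_manifold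
begin

section \<open>Normals and directions along an itinerary\<close>

text \<open>The sum of the two conormals is \<open>sin \<epsilon>\<close> times the normal plus
  \<open>1 - cos \<epsilon>\<close> times a conormal: first order in the normal direction, second
  order in the tangential one. All later second order estimates rest on this.\<close>

lemma hinge_bend:
  assumes A: "adjacent_at n K f \<sigma> \<tau>" and e: "\<bar>hinge_angle n K \<nu> f\<bar> \<le> e" "e < 1"
  shows "norm (\<nu> \<tau> - \<nu> \<sigma>) \<le> 2 * e"
    and "\<exists>s k. conormal \<sigma> f + conormal \<tau> f = s *\<^sub>R \<nu> \<sigma> + k *\<^sub>R conormal \<sigma> f \<and> \<bar>s\<bar> \<le> e \<and> \<bar>k\<bar> \<le> e\<^sup>2"
proof -
  let ?\<epsilon> = "hinge_angle n K \<nu> f"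
  note R = hinge_rotation[OF A]
  note F = adjacent_facet[OF A]
  have e0: "0 \<le> e" using e by linarith
  have s: "\<bar>sin ?\<epsilon>\<bar> \<le> e" using abs_sin_x_le_abs_x[of ?\<epsilon>] e by linarith
  have "?\<epsilon>\<^sup>2 \<le> e\<^sup>2" using e(1) e0 by (simp add: abs_le_square_iff[symmetric])
  moreover have "1 - cos ?\<epsilon> \<le> ?\<epsilon>\<^sup>2" using one_minus_cos_le[of ?\<epsilon>] zero_le_power2[of ?\<epsilon>] by linarith
  ultimately have c: "\<bar>1 - cos ?\<epsilon>\<bar> \<le> e\<^sup>2" by simp
  have e2: "e\<^sup>2 \<le> e" using e0 e(2) by (simp add: power2_eq_square mult_left_le)
  have "\<nu> \<tau> - \<nu> \<sigma> = sin ?\<epsilon> *\<^sub>R conormal \<sigma> f - (1 - cos ?\<epsilon>) *\<^sub>R \<nu> \<sigma>"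
    using R(2) e by (simp add: algebra_simps)
  also have "norm \<dots> \<le> norm (sin ?\<epsilon> *\<^sub>R conormal \<sigma> f) + norm ((1 - cos ?\<epsilon>) *\<^sub>R \<nu> \<sigma>)" by (rule norm_triangle_ineq4)
  also have "\<dots> = \<bar>sin ?\<epsilon>\<bar> + \<bar>1 - cos ?\<epsilon>\<bar>" using conormal(1)[OF F(1)] normal(1) F by simp
  also have "\<dots> \<le> 2 * e" using s c e2 by linarith
  finally show "norm (\<nu> \<tau> - \<nu> \<sigma>) \<le> 2 * e" .
  have "conormal \<sigma> f + conormal \<tau> f = sin ?\<epsilon> *\<^sub>R \<nu> \<sigma> + (1 - cos ?\<epsilon>) *\<^sub>R conormal \<sigma> f"
    using R(1) e by (simp add: algebra_simps)
  then show "\<exists>s k. conormal \<sigma> f + conormal \<tau> f = s *\<^sub>R \<nu> \<sigma> + k *\<^sub>R conormal \<sigma> f \<and> \<bar>s\<bar> \<le> e \<and> \<bar>k\<bar> \<le> e\<^sup>2"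
    using s c by blast
qed

definition tangential :: "'a set \<Rightarrow> 'a \<Rightarrow> 'a" where
  "tangential \<rho> x = x - (x \<bullet> \<nu> \<rho>) *\<^sub>R \<nu> \<rho>"

lemma tangential_linear: "tangential \<rho> (x + y) = tangential \<rho> x + tangential \<rho> y" "tangential \<rho> (x - y) = tangential \<rho> x - tangential \<rho> y"
    "tangential \<rho> (k *\<^sub>R x) = k *\<^sub>R tangential \<rho> x" "tangential \<rho> (- x) = - tangential \<rho> x"
  by (simp_all add: tangential_def algebra_simps inner_add_left inner_diff_left)

lemma norm_tang: "\<rho> \<in> top_simplices n K \<Longrightarrow> norm (tangential \<rho> x) \<le> norm x"
proof -
  assume "\<rho> \<in> top_simplices n K"
  then have N: "\<nu> \<rho> \<bullet> \<nu> \<rho> = 1" using normal(1) by (simp add: norm_eq_1)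
  have "tangential \<rho> x \<bullet> tangential \<rho> x = x \<bullet> x - (x \<bullet> \<nu> \<rho>) * (x \<bullet> \<nu> \<rho>)"
    unfolding tangential_def using N by (simp add: inner_diff_left inner_diff_right inner_commute[of "\<nu> \<rho>" x])
  then have "(norm (tangential \<rho> x))\<^sup>2 \<le> (norm x)\<^sup>2" by (simp add: power2_norm_eq_inner)
  then show ?thesis by (rule power2_le_imp_le) simp
qed

lemma tangential_dirs: "\<rho> \<in> top_simplices n K \<Longrightarrow> x \<in> dirs \<rho> \<Longrightarrow> tangential \<rho> x = x"
  using normal(2)[of \<rho> x] by (simp add: tangential_def)

text \<open>\<open>\<sigma>0\<close> and \<open>\<tau>0\<close> are the two simplices at \<open>h\<close>; directions are compared with \<open>conormal \<tau>0 h\<close>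
  after projection along the normal of \<open>\<tau>0\<close>.\<close>
context
  fixes h \<sigma>0 \<tau>0 :: "'a set" and e :: real and N :: nat and H :: "'a set set"
  assumes A0: "adjacent_at n K h \<sigma>0 \<tau>0"
    and e: "0 \<le> e" "e < 1" and h: "h \<in> H" and H: "\<forall>f\<in>H. \<bar>hinge_angle n K \<nu> f\<bar> \<le> e"
begin

definition bounded_itinerary :: "'a set \<Rightarrow> 'a set list \<Rightarrow> bool" where
  "bounded_itinerary \<tau> fs \<longleftrightarrow> (\<tau> = \<sigma>0 \<or> \<tau> = \<tau>0) \<and> admissible h \<tau> fs \<and> set fs \<subseteq> H \<and> length fs \<le> N"

text \<open>Compared with \<open>u0\<close>, lines that start into \<open>\<sigma>0\<close> run
  backwards.\<close>

definition side_sign :: "'a set \<Rightarrow> real" where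
  "side_sign \<tau> = (if \<tau> = \<tau>0 then 1 else - 1)"

abbreviation "u0 \<equiv> conormal \<tau>0 h"

lemma \<tau>0_top: "\<tau>0 \<in> top_simplices n K" and F\<tau>0: "facet h \<tau>0" and F\<sigma>0: "facet h \<sigma>0"
  using A0 by (auto simp: adjacent_at_def)

lemma bounded_itinerary_facet: "bounded_itinerary \<tau> fs \<Longrightarrow> facet h \<tau>"
  using F\<tau>0 F\<sigma>0 by (auto simp: bounded_itinerary_def)

lemma bounded_itinerary_tl: "bounded_itinerary \<tau> (f # fs) \<Longrightarrow> bounded_itinerary \<tau> fs"
  by (auto simp: bounded_itinerary_def)

lemma bounded_itinerary_inv:
  assumes "bounded_itinerary \<tau> fs"
  shows "facet (base h fs) (side \<tau> fs)" "direction h \<tau> fs \<in> dirs (side \<tau> fs)" "norm (direction h \<tau> fs) = 1" "0 < cosine h \<tau> fs"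
  using admissible_invariants[OF bounded_itinerary_facet[OF assms], of fs] assms by (auto simp: bounded_itinerary_def)

lemma bounded_itinerary_Cons:
  assumes "bounded_itinerary \<tau> (f # fs)"
  shows "facet f (side \<tau> fs)" "adjacent_at n K f (side \<tau> fs) (side \<tau> (f # fs))" "f \<in> H"
    "direction h \<tau> fs \<bullet> conormal (side \<tau> fs) f < 0" "cosine h \<tau> (f # fs) = - (direction h \<tau> fs \<bullet> conormal (side \<tau> fs) f)"
  using assms adjacent_other[of f "side \<tau> fs"] cosine_Cons[OF bounded_itinerary_facet[OF assms], of f fs] by (auto simp: bounded_itinerary_def)

lemma u0: "norm u0 = 1" "tangential \<tau>0 u0 = u0" "u0 \<bullet> \<nu> \<tau>0 = 0"
  using conormal(1,2)[OF F\<tau>0] tangential_dirs[OF \<tau>0_top] normal(2)[OF \<tau>0_top] by auto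

lemma tangential_normal: "tangential \<tau>0 (\<nu> \<tau>0) = 0"
  using normal(1)[OF \<tau>0_top] by (simp add: tangential_def norm_eq_1)

lemma normal_close:
  "bounded_itinerary \<tau> fs \<Longrightarrow> norm (\<nu> (side \<tau> fs) - \<nu> \<tau>0) \<le> 2 * (real (length fs) + 1) * e"
proof (induction fs)
  case Nil
  show ?case
  proof (cases "\<tau> = \<tau>0")
    case False
    then have "\<tau> = \<sigma>0" using Nil by (simp add: bounded_itinerary_def)
    then show ?thesis using hinge_bend(1)[OF adjacent_sym[OF A0] H[rule_format, OF h] e(2)] by simp
  qed (use e in simp)
next
  case (Cons f fs)
  note I = bounded_itinerary_Cons[OF Cons.prems]
  have "norm (\<nu> (side \<tau> (f # fs)) - \<nu> \<tau>0) \<le> norm (\<nu> (side \<tau> (f # fs)) - \<nu> (side \<tau> fs)) + norm (\<nu> (side \<tau> fs) - \<nu> \<tau>0)"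
    by (rule norm_diff_triangle_le[OF order_refl order_refl])
  also have "\<dots> \<le> 2 * e + 2 * (real (length fs) + 1) * e"
    using hinge_bend(1)[OF I(2) H[rule_format, OF I(3)] e(2)] Cons.IH[rule_format, OF bounded_itinerary_tl[OF Cons.prems]] by (rule add_mono)
  finally show ?case by (simp add: algebra_simps)
qed

lemma normal_close': "bounded_itinerary \<tau> fs \<Longrightarrow> norm (\<nu> (side \<tau> fs) - \<nu> \<tau>0) \<le> normal_const N * e"
proof -
  assume I: "bounded_itinerary \<tau> fs"
  have "2 * (real (length fs) + 1) * e \<le> normal_const N * e"
    unfolding normal_const_def using I e by (intro mult_right_mono) (auto simp: bounded_itinerary_def)
  then show ?thesis using normal_close[OF I] by linarith
qed

lemma inner_normal_small:
  assumes I: "bounded_itinerary \<tau> fs" and x: "x \<in> dirs (side \<tau> fs)" "norm x = 1"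
  shows "\<bar>x \<bullet> \<nu> \<tau>0\<bar> \<le> normal_const N * e"
proof -
  have "x \<bullet> \<nu> (side \<tau> fs) = 0" using normal(2) bounded_itinerary_inv(1)[OF I] x by blast
  then have "\<bar>x \<bullet> \<nu> \<tau>0\<bar> = \<bar>x \<bullet> (\<nu> (side \<tau> fs) - \<nu> \<tau>0)\<bar>" by (simp add: inner_diff_right)
  also have "\<dots> \<le> norm x * norm (\<nu> (side \<tau> fs) - \<nu> \<tau>0)" by (rule Cauchy_Schwarz_ineq2)
  also have "\<dots> \<le> normal_const N * e" using x normal_close'[OF I] by simp
  finally show ?thesis .
qed

text \<open>A bend is a bounded multiple of \<open>s\<close> times the current normal plus
  \<open>k\<close> times a conormal, where \<open>s\<close> is O(e) and \<open>k\<close> is O(e^2).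
  The current normal is O(e)-close to \<open>\<nu> \<tau>0\<close>, so projection along
  \<open>\<nu> \<tau>0\<close> leaves only O(e) of it and the first term also becomes
  O(e^2).\<close>

lemma direction_close:
  "bounded_itinerary \<tau> fs \<Longrightarrow> norm (tangential \<tau>0 (direction h \<tau> fs) - side_sign \<tau> *\<^sub>R u0) \<le> (real (length fs) + 1) * ((normal_const N + 1) * e\<^sup>2)"
proof (induction fs)
  case Nil
  show ?case
  proof (cases "\<tau> = \<tau>0")
    case True
    then show ?thesis using u0 e K_ge_1(1)[of N] by (simp add: side_sign_def)
  next
    case False
    then have \<tau>: "\<tau> = \<sigma>0" using Nil by (simp add: bounded_itinerary_def)
    \<comment> \<open>A line into \<open>\<sigma>0\<close> starts with the other conormal of
      \<open>h\<close>, which by the same expansion is \<open>- u0\<close> up to O(e^2) after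
      projection.\<close>
    obtain s k where sk: "conormal \<tau>0 h + conormal \<sigma>0 h = s *\<^sub>R \<nu> \<tau>0 + k *\<^sub>R conormal \<tau>0 h" "\<bar>k\<bar> \<le> e\<^sup>2"
      using hinge_bend(2)[OF adjacent_sym[OF A0] H[rule_format, OF h] e(2)] by blast
    have "tangential \<tau>0 (conormal \<sigma>0 h) - (- 1) *\<^sub>R u0 = tangential \<tau>0 (conormal \<tau>0 h + conormal \<sigma>0 h)"
      using u0(2) by (simp add: tangential_linear)
    also have "\<dots> = k *\<^sub>R u0" unfolding sk using u0(2) tangential_normal by (simp add: tangential_linear)
    also have "norm \<dots> \<le> 1 * e\<^sup>2" using sk(2) u0(1) by simp
    also have "\<dots> \<le> (normal_const N + 1) * e\<^sup>2" using K_ge_1(1)[of N] by (intro mult_right_mono) auto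
    finally show ?thesis using \<tau> False by (simp add: side_sign_def)
  qed
next
  case (Cons f fs)
  note I = bounded_itinerary_Cons[OF Cons.prems] and J = bounded_itinerary_tl[OF Cons.prems]
  note inv = bounded_itinerary_inv[OF J]
  let ?\<sigma> = "side \<tau> fs" and ?u = "direction h \<tau> fs"
  let ?m = "conormal ?\<sigma> f"
  have \<sigma>: "?\<sigma> \<in> top_simplices n K" using inv by simp
  obtain s k where sk: "?m + conormal (side \<tau> (f # fs)) f = s *\<^sub>R \<nu> ?\<sigma> + k *\<^sub>R ?m" "\<bar>s\<bar> \<le> e" "\<bar>k\<bar> \<le> e\<^sup>2"
    using hinge_bend(2)[OF I(2) H[rule_format, OF I(3)] e(2)] by blast
  have m1: "norm ?m = 1" using conormal(1)[OF I(1)] .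
  have um: "\<bar>?u \<bullet> ?m\<bar> \<le> 1" using Cauchy_Schwarz_ineq2[of ?u ?m] inv(3) m1 by simp
  have "tangential \<tau>0 (\<nu> ?\<sigma>) = tangential \<tau>0 (\<nu> ?\<sigma> - \<nu> \<tau>0)" using tangential_normal by (simp add: tangential_linear)
  then have tn: "norm (tangential \<tau>0 (\<nu> ?\<sigma>)) \<le> normal_const N * e"
    using norm_tang[OF \<tau>0_top, of "\<nu> ?\<sigma> - \<nu> \<tau>0"] normal_close'[OF J] by simp
  have "norm (tangential \<tau>0 (?m + conormal (side \<tau> (f # fs)) f)) \<le> norm (s *\<^sub>R tangential \<tau>0 (\<nu> ?\<sigma>)) + norm (k *\<^sub>R tangential \<tau>0 ?m)"
    unfolding sk tangential_linear by (rule norm_triangle_ineq)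
  also have "\<dots> = \<bar>s\<bar> * norm (tangential \<tau>0 (\<nu> ?\<sigma>)) + \<bar>k\<bar> * norm (tangential \<tau>0 ?m)" by simp
  also have "\<dots> \<le> e * (normal_const N * e) + e\<^sup>2 * 1"
    using sk(2,3) tn norm_tang[OF \<tau>0_top, of ?m] m1 e by (intro add_mono mult_mono) auto
  also have "\<dots> = (normal_const N + 1) * e\<^sup>2" by (simp add: power2_eq_square algebra_simps)
  finally have B: "norm (tangential \<tau>0 (?m + conormal (side \<tau> (f # fs)) f)) \<le> (normal_const N + 1) * e\<^sup>2" .
  have "direction h \<tau> (f # fs) = ?u - (?u \<bullet> ?m) *\<^sub>R (?m + conormal (side \<tau> (f # fs)) f)" by simp
  then have "tangential \<tau>0 (direction h \<tau> (f # fs)) - side_sign \<tau> *\<^sub>R u0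
      = (tangential \<tau>0 ?u - side_sign \<tau> *\<^sub>R u0) - (?u \<bullet> ?m) *\<^sub>R tangential \<tau>0 (?m + conormal (side \<tau> (f # fs)) f)"
    by (simp only: tangential_linear) (simp add: algebra_simps)
  also have "norm \<dots> \<le> norm (tangential \<tau>0 ?u - side_sign \<tau> *\<^sub>R u0) + norm ((?u \<bullet> ?m) *\<^sub>R tangential \<tau>0 (?m + conormal (side \<tau> (f # fs)) f))"
    by (rule norm_triangle_ineq4)
  also have "\<dots> \<le> (real (length fs) + 1) * ((normal_const N + 1) * e\<^sup>2) + 1 * ((normal_const N + 1) * e\<^sup>2)"
    using Cons.IH[rule_format, OF J] um B unfolding norm_scaleR by (intro add_mono mult_mono) auto
  finally show ?case by (simp add: algebra_simps)
qed

lemma direction_close': "bounded_itinerary \<tau> fs \<Longrightarrow> norm (tangential \<tau>0 (direction h \<tau> fs) - side_sign \<tau> *\<^sub>R u0) \<le> direction_const N * e\<^sup>2"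
proof -
  assume I: "bounded_itinerary \<tau> fs"
  have "(real (length fs) + 1) * ((normal_const N + 1) * e\<^sup>2) \<le> (real N + 1) * ((normal_const N + 1) * e\<^sup>2)"
    using I K_ge_1(1)[of N] by (intro mult_right_mono) (auto simp: bounded_itinerary_def)
  then show ?thesis using direction_close[OF I] by (simp add: direction_const_def mult.assoc)
qed

lemma abs_sgn0 [simp]: "\<bar>side_sign \<tau>\<bar> = 1" "side_sign \<tau> * side_sign \<tau> = 1"
  by (simp_all add: side_sign_def)

section \<open>Displacements along the lines\<close>

text \<open>A displacement \<open>d\<close> along one of the lines, or between two points on the two halves of a line.\<close>
definition along :: "real \<Rightarrow> 'a \<Rightarrow> bool" where
  "along t d \<longleftrightarrow> norm (tangential \<tau>0 d - t *\<^sub>R u0) \<le> \<bar>t\<bar> * (direction_const N * e\<^sup>2) \<and> \<bar>d \<bullet> \<nu> \<tau>0\<bar> \<le> \<bar>t\<bar> * (normal_const N * e)"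

text \<open>The errors are proportional to \<open>\<bar>t\<bar>\<close>, so they add up correctly
  only if the parameters have the same sign.\<close>

lemma along_add:
  assumes "along s c" "along t d" "0 \<le> s * t" shows "along (s + t) (c + d)"
proof -
  have st: "\<bar>s + t\<bar> = \<bar>s\<bar> + \<bar>t\<bar>" using assms(3) by (auto simp: zero_le_mult_iff)
  have "tangential \<tau>0 (c + d) - (s + t) *\<^sub>R u0 = (tangential \<tau>0 c - s *\<^sub>R u0) + (tangential \<tau>0 d - t *\<^sub>R u0)"
    by (simp add: tangential_linear algebra_simps)
  then have "norm (tangential \<tau>0 (c + d) - (s + t) *\<^sub>R u0) \<le> norm (tangential \<tau>0 c - s *\<^sub>R u0) + norm (tangential \<tau>0 d - t *\<^sub>R u0)"
    using norm_triangle_ineq by metis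
  moreover have "\<bar>(c + d) \<bullet> \<nu> \<tau>0\<bar> \<le> \<bar>c \<bullet> \<nu> \<tau>0\<bar> + \<bar>d \<bullet> \<nu> \<tau>0\<bar>" by (simp add: inner_add_left abs_triangle_ineq)
  ultimately show ?thesis
    using assms(1,2) unfolding along_def st distrib_right by linarith
qed

lemma along_uminus: "along t d \<Longrightarrow> along (- t) (- d)"
  unfolding along_def by (simp add: tangential_linear norm_minus_commute)

lemma along_dirn:
  assumes I: "bounded_itinerary \<tau> fs" shows "along (side_sign \<tau> * s) (s *\<^sub>R direction h \<tau> fs)"
proof -
  have "tangential \<tau>0 (s *\<^sub>R direction h \<tau> fs) - (side_sign \<tau> * s) *\<^sub>R u0 = s *\<^sub>R (tangential \<tau>0 (direction h \<tau> fs) - side_sign \<tau> *\<^sub>R u0)"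
    by (simp add: tangential_linear algebra_simps)
  then have "norm (tangential \<tau>0 (s *\<^sub>R direction h \<tau> fs) - (side_sign \<tau> * s) *\<^sub>R u0) \<le> \<bar>s\<bar> * (direction_const N * e\<^sup>2)"
    using direction_close'[OF I] by (simp add: mult_left_mono)
  moreover have "\<bar>(s *\<^sub>R direction h \<tau> fs) \<bullet> \<nu> \<tau>0\<bar> \<le> \<bar>s\<bar> * (normal_const N * e)"
    using inner_normal_small[OF I bounded_itinerary_inv(2,3)[OF I]] by (simp add: abs_mult mult_left_mono)
  ultimately show ?thesis by (simp add: along_def abs_mult)
qed

lemma along_trajectory:
  "bounded_itinerary \<tau> (ks @ fs) \<Longrightarrow> reach h \<tau> x (ks @ fs) \<Longrightarrow>
    along (side_sign \<tau> * (time_at h \<tau> x (ks @ fs) - time_at h \<tau> x fs)) (point_at h \<tau> x (ks @ fs) - point_at h \<tau> x fs)"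
proof (induction ks)
  case Nil
  then show ?case by (simp add: along_def tangential_def)
next
  case (Cons f ks)
  have I: "bounded_itinerary \<tau> (ks @ fs)" using Cons.prems bounded_itinerary_tl by simp
  have r: "reach h \<tau> x (ks @ fs)" using Cons.prems by simp
  let ?s = "hit (side \<tau> (ks @ fs)) f (direction h \<tau> (ks @ fs)) (point_at h \<tau> x (ks @ fs))"
  have s: "0 < ?s" using Cons.prems by simp
  have T: "time_at h \<tau> x fs \<le> time_at h \<tau> x (ks @ fs)" using time_at_append[OF r] by simp
  have "along (side_sign \<tau> * (time_at h \<tau> x (ks @ fs) - time_at h \<tau> x fs) + side_sign \<tau> * ?s)
      ((point_at h \<tau> x (ks @ fs) - point_at h \<tau> x fs) + ?s *\<^sub>R direction h \<tau> (ks @ fs))"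
    using Cons.IH[rule_format, OF I r] along_dirn[OF I]
  proof (rule along_add)
    have "side_sign \<tau> * (time_at h \<tau> x (ks @ fs) - time_at h \<tau> x fs) * (side_sign \<tau> * ?s) = (side_sign \<tau> * side_sign \<tau>) * ((time_at h \<tau> x (ks @ fs) - time_at h \<tau> x fs) * ?s)"
      by (simp only: mult_ac)
    also have "0 \<le> \<dots>" using T s by simp
    finally show "0 \<le> side_sign \<tau> * (time_at h \<tau> x (ks @ fs) - time_at h \<tau> x fs) * (side_sign \<tau> * ?s)" .
  qed
  then show ?case by (simp add: algebra_simps)
qed

lemma along_point:
  assumes "bounded_itinerary \<tau> fs" "reach h \<tau> x fs" shows "along (side_sign \<tau> * time_at h \<tau> x fs) (point_at h \<tau> x fs - x)"
  using along_trajectory[of \<tau> fs "[]" x] assms by simp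

lemma inner_tang: "x \<bullet> y = tangential \<tau>0 x \<bullet> y + (x \<bullet> \<nu> \<tau>0) * (y \<bullet> \<nu> \<tau>0)"
  by (simp add: tangential_def inner_diff_left inner_diff_right inner_commute)

text \<open>The tangential parts differ by \<open>direction_const N * e\<^sup>2\<close> per unit of
  \<open>t\<close>; the normal parts enter only through a product of two terms of order
  \<open>e\<close>. The sum is \<open>cosine_const\<close>.\<close>

lemma inner_along:
  assumes a: "along t d" and m: "norm m = 1" "\<bar>m \<bullet> \<nu> \<tau>0\<bar> \<le> normal_const N * e"
  shows "\<bar>d \<bullet> m - t * (u0 \<bullet> m)\<bar> \<le> \<bar>t\<bar> * (cosine_const N * e\<^sup>2)"
proof -
  have "d \<bullet> m - t * (u0 \<bullet> m) = (tangential \<tau>0 d - t *\<^sub>R u0) \<bullet> m + (d \<bullet> \<nu> \<tau>0) * (m \<bullet> \<nu> \<tau>0)"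
    by (subst inner_tang) (simp add: inner_diff_left)
  then have "\<bar>d \<bullet> m - t * (u0 \<bullet> m)\<bar> \<le> \<bar>(tangential \<tau>0 d - t *\<^sub>R u0) \<bullet> m\<bar> + \<bar>d \<bullet> \<nu> \<tau>0\<bar> * \<bar>m \<bullet> \<nu> \<tau>0\<bar>"
    by (metis abs_mult abs_triangle_ineq)
  also have "\<bar>(tangential \<tau>0 d - t *\<^sub>R u0) \<bullet> m\<bar> \<le> norm (tangential \<tau>0 d - t *\<^sub>R u0) * norm m" by (rule Cauchy_Schwarz_ineq2)
  also have "\<dots> \<le> \<bar>t\<bar> * (direction_const N * e\<^sup>2)" using a m by (simp add: along_def)
  also have "\<bar>d \<bullet> \<nu> \<tau>0\<bar> * \<bar>m \<bullet> \<nu> \<tau>0\<bar> \<le> (\<bar>t\<bar> * (normal_const N * e)) * (normal_const N * e)"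
    using a m(2) e K_ge_1(1)[of N] by (intro mult_mono) (auto simp: along_def)
  finally show ?thesis by (simp add: cosine_const_def algebra_simps power2_eq_square)
qed

lemma cosine_u0:
  assumes I: "bounded_itinerary \<tau> (f # fs)"
  shows "\<bar>cosine h \<tau> (f # fs) - \<bar>u0 \<bullet> conormal (side \<tau> fs) f\<bar>\<bar> \<le> cosine_const N * e\<^sup>2"
proof -
  note C = bounded_itinerary_Cons[OF I] and J = bounded_itinerary_tl[OF I]
  let ?m = "conormal (side \<tau> fs) f" and ?u = "direction h \<tau> fs"
  have m: "norm ?m = 1" "\<bar>?m \<bullet> \<nu> \<tau>0\<bar> \<le> normal_const N * e"
    using conormal(1,2)[OF C(1)] inner_normal_small[OF J] by auto
  have "\<bar>?u \<bullet> ?m - side_sign \<tau> * (u0 \<bullet> ?m)\<bar> \<le> cosine_const N * e\<^sup>2"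
    using inner_along[OF along_dirn[OF J, of 1] m] by simp
  moreover have "\<bar>side_sign \<tau> * (u0 \<bullet> ?m)\<bar> = \<bar>u0 \<bullet> ?m\<bar>" by (simp add: abs_mult)
  moreover have "cosine h \<tau> (f # fs) = \<bar>?u \<bullet> ?m\<bar>" using C(4,5) by simp
  ultimately show ?thesis by linarith
qed

text \<open>Two itineraries may cross \<open>f\<close> in opposite directions. Then the conormals
  are opposite up to \<open>hinge_bend\<close>, and the first order part of that is a normal almost
  orthogonal to \<open>u0\<close>.\<close>

lemma u0_conormal_sides:
  assumes I: "bounded_itinerary \<tau> (f # fs)" and J: "bounded_itinerary \<tau>' (f # gs)"
  shows "\<bar>\<bar>u0 \<bullet> conormal (side \<tau> fs) f\<bar> - \<bar>u0 \<bullet> conormal (side \<tau>' gs) f\<bar>\<bar> \<le> (normal_const N + 1) * e\<^sup>2"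
proof (cases "side \<tau> fs = side \<tau>' gs")
  case True
  then show ?thesis using e K_ge_1(1)[of N] by simp
next
  case False
  note C = bounded_itinerary_Cons[OF I] and C' = bounded_itinerary_Cons[OF J]
  have A: "adjacent_at n K f (side \<tau> fs) (side \<tau>' gs)"
    using adjacent_cases[OF C(2) C'(1)] False C(2) by metis
  let ?m = "conormal (side \<tau> fs) f" and ?m' = "conormal (side \<tau>' gs) f" and ?\<sigma> = "side \<tau> fs"
  obtain s k where sk: "?m + ?m' = s *\<^sub>R \<nu> ?\<sigma> + k *\<^sub>R ?m" "\<bar>s\<bar> \<le> e" "\<bar>k\<bar> \<le> e\<^sup>2"
    using hinge_bend(2)[OF A H[rule_format, OF C(3)] e(2)] by blast
  have "u0 \<bullet> ?m + u0 \<bullet> ?m' = s * (u0 \<bullet> \<nu> ?\<sigma>) + k * (u0 \<bullet> ?m)"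
    unfolding inner_add_right[symmetric] sk by (simp add: inner_add_right)
  moreover have "\<bar>s * (u0 \<bullet> \<nu> ?\<sigma>)\<bar> \<le> e * (normal_const N * e)"
  proof -
    have "\<bar>u0 \<bullet> \<nu> ?\<sigma>\<bar> = \<bar>u0 \<bullet> (\<nu> ?\<sigma> - \<nu> \<tau>0)\<bar>" using u0(3) by (simp add: inner_diff_right)
    also have "\<dots> \<le> norm u0 * norm (\<nu> ?\<sigma> - \<nu> \<tau>0)" by (rule Cauchy_Schwarz_ineq2)
    also have "\<dots> \<le> normal_const N * e" using u0(1) normal_close'[OF bounded_itinerary_tl[OF I]] by simp
    finally show ?thesis using sk(2) e unfolding abs_mult by (intro mult_mono) auto
  qed
  moreover have "\<bar>k * (u0 \<bullet> ?m)\<bar> \<le> e\<^sup>2 * 1"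
  proof -
    have "\<bar>u0 \<bullet> ?m\<bar> \<le> 1" using Cauchy_Schwarz_ineq2[of u0 ?m] u0(1) conormal(1)[OF C(1)] by simp
    then show ?thesis unfolding abs_mult using sk(3) by (intro mult_mono) auto
  qed
  moreover have "e * (normal_const N * e) + e\<^sup>2 * 1 = (normal_const N + 1) * e\<^sup>2" by (simp add: power2_eq_square algebra_simps)
  ultimately show ?thesis by linarith
qed

lemma cosine_close:
  assumes I: "bounded_itinerary \<tau> (f # fs)" and J: "bounded_itinerary \<tau>' (f # gs)"
  shows "\<bar>cosine h \<tau> (f # fs) - cosine h \<tau>' (f # gs)\<bar> \<le> (2 * cosine_const N + (normal_const N + 1)) * e\<^sup>2"
proof -
  have "(2 * cosine_const N + (normal_const N + 1)) * e\<^sup>2 = cosine_const N * e\<^sup>2 + cosine_const N * e\<^sup>2 + (normal_const N + 1) * e\<^sup>2" by (simp add: algebra_simps)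
  then show ?thesis using cosine_u0[OF I] cosine_u0[OF J] u0_conormal_sides[OF I J] by linarith
qed

text \<open>A displacement along \<open>f\<close> is orthogonal to its conormal, so
  \<open>t * (u0 \<bullet> m)\<close> is bounded by the error term. That term is proportional to
  \<open>t\<close> too, so \<open>t\<close> cancels and no lower bound on it is required.\<close>

lemma flat_crossing:
  assumes I: "bounded_itinerary \<tau> (f # fs)" and a: "along t d" "t \<noteq> 0" "d \<in> dirs f"
  shows "cosine h \<tau> (f # fs) \<le> 2 * cosine_const N * e\<^sup>2"
proof -
  note C = bounded_itinerary_Cons[OF I] and J = bounded_itinerary_tl[OF I]
  let ?m = "conormal (side \<tau> fs) f"
  have m: "norm ?m = 1" "\<bar>?m \<bullet> \<nu> \<tau>0\<bar> \<le> normal_const N * e"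
    using conormal(1,2)[OF C(1)] inner_normal_small[OF J] by auto
  have "d \<bullet> ?m = 0" using conormal(3)[OF C(1) a(3)] .
  then have "\<bar>t\<bar> * \<bar>u0 \<bullet> ?m\<bar> \<le> \<bar>t\<bar> * (cosine_const N * e\<^sup>2)" using inner_along[OF a(1) m] by (simp add: abs_mult)
  then have "\<bar>u0 \<bullet> ?m\<bar> \<le> cosine_const N * e\<^sup>2" using a(2) by simp
  then show ?thesis using cosine_u0[OF I] by linarith
qed

text \<open>Two crossings of \<open>f\<close> by the line through one starting point differ by a
  displacement along \<open>f\<close>, to which \<open>flat_crossing\<close> applies. The two cases
  are crossings on the same half of the line and on opposite halves.\<close>

lemma double_crossing:
  assumes I: "bounded_itinerary \<tau> (f # fs)" and J: "bounded_itinerary \<tau>' (f # gs)" and r: "reach h \<tau> x (f # fs)" "reach h \<tau>' x (f # gs)"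
    and ne: "(\<tau>, f # fs) \<noteq> (\<tau>', f # gs)"
  shows "cosine h \<tau> (f # fs) \<le> 2 * cosine_const N * e\<^sup>2"
proof -
  have pf: "point_at h \<tau> x (f # fs) \<in> f" "point_at h \<tau>' x (f # gs) \<in> f"
    using r rel_interior_subset by auto
  let ?t = "time_at h \<tau> x (f # fs)" and ?t' = "time_at h \<tau>' x (f # gs)"
  have t: "0 < ?t" "0 < ?t'" using time_at_pos[OF r(1)] time_at_pos[OF r(2)] by auto
  show ?thesis
  proof (cases "\<tau> = \<tau>'")
    case True
    then have ne': "f # fs \<noteq> f # gs" using ne by simp
    have *: "\<exists>t d. along t d \<and> t \<noteq> 0 \<and> d \<in> dirs f"
      if J: "bounded_itinerary \<tau> (f # gs)" and r': "reach h \<tau> x (f # gs)" and r: "reach h \<tau> x (f # fs)" and I: "bounded_itinerary \<tau> (f # fs)" and l: "length (f # fs) \<le> length (f # gs)"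
        and ne': "f # fs \<noteq> f # gs" for fs gs
    proof -
      have "point_at h \<tau> x (f # fs) \<in> f" "point_at h \<tau> x (f # gs) \<in> f"
        using r r' rel_interior_subset by auto
      then have d: "point_at h \<tau> x (f # gs) - point_at h \<tau> x (f # fs) \<in> dirs f" by (intro diff_in_dirs)
      obtain ks where ks: "f # gs = ks @ (f # fs)"
        using reach_suffix[OF bounded_itinerary_facet[OF I] _ r _ r' l] I J unfolding bounded_itinerary_def by blast
      then have "ks \<noteq> []" using ne' by auto
      then have "time_at h \<tau> x (f # fs) < time_at h \<tau> x (f # gs)"
        using time_at_append[of h \<tau> x ks "f # fs"] r' unfolding ks by simp
      moreover have "along (side_sign \<tau> * (time_at h \<tau> x (f # gs) - time_at h \<tau> x (f # fs))) (point_at h \<tau> x (f # gs) - point_at h \<tau> x (f # fs))"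
        using along_trajectory[of \<tau> ks "f # fs" x] J r' unfolding ks by simp
      moreover have "side_sign \<tau> \<noteq> 0" by (simp add: side_sign_def)
      ultimately show ?thesis using d
        by (intro exI[of _ "side_sign \<tau> * (time_at h \<tau> x (f # gs) - time_at h \<tau> x (f # fs))"] exI[of _ "point_at h \<tau> x (f # gs) - point_at h \<tau> x (f # fs)"]) auto
    qed
    have "\<exists>t d. along t d \<and> t \<noteq> 0 \<and> d \<in> dirs f"
    proof (cases "length (f # fs) \<le> length (f # gs)")
      case True
      then show ?thesis using *[of gs fs] I J r ne' \<open>\<tau> = \<tau>'\<close> by blast
    next
      case False
      then show ?thesis using *[of fs gs] I J r ne' \<open>\<tau> = \<tau>'\<close> by fastforce
    qed
    then show ?thesis using flat_crossing[OF I] by blast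
  next
    case False
    \<comment> \<open>Going from the second crossing back to \<open>x\<close> and on to the first
      one never changes direction, so the two times add.\<close>
    then have sg: "side_sign \<tau> = - side_sign \<tau>'" using I J by (auto simp: side_sign_def bounded_itinerary_def)
    have "along (- (side_sign \<tau>' * ?t')) (- (point_at h \<tau>' x (f # gs) - x))"
      by (rule along_uminus[OF along_point[OF J r(2)]])
    then have "along (side_sign \<tau> * ?t') (x - point_at h \<tau>' x (f # gs))" using sg by simp
    from along_add[OF along_point[OF I r(1)] this]
    have "along (side_sign \<tau> * ?t + side_sign \<tau> * ?t') (point_at h \<tau> x (f # fs) - x + (x - point_at h \<tau>' x (f # gs)))"
      using t by (cases "\<tau> = \<tau>0") (simp_all add: side_sign_def del: point_at.simps time_at.simps)
    then have "along (side_sign \<tau> * (?t + ?t')) (point_at h \<tau> x (f # fs) - point_at h \<tau>' x (f # gs))"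
      by (simp add: distrib_left del: point_at.simps time_at.simps)
    moreover have "side_sign \<tau> * (?t + ?t') \<noteq> 0" using t by (simp add: side_sign_def del: time_at.simps)
    ultimately show ?thesis using flat_crossing[OF I] diff_in_dirs[OF pf] by blast
  qed
qed

text \<open>As in \<open>flat_crossing\<close>, but the conormal is \<open>u0\<close> itself, and
  \<open>u0 \<bullet> u0 = 1\<close> cannot be small.\<close>

lemma no_return:
  assumes I: "bounded_itinerary \<tau> (h # fs)" and r: "reach h \<tau> x (h # fs)" and small: "cosine_const N * e\<^sup>2 < 1"
  shows False
proof -
  let ?t = "time_at h \<tau> x (h # fs)"
  have t: "0 < ?t" using time_at_pos[OF r] by simp
  have "reach h \<tau> x []" using reach_append[of h \<tau> x "h # fs" "[]"] r by simp
  then have x: "x \<in> h" using rel_interior_subset by auto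
  have "point_at h \<tau> x (h # fs) \<in> h" using r rel_interior_subset by auto
  then have "point_at h \<tau> x (h # fs) - x \<in> dirs h" using x by (intro diff_in_dirs)
  then have d: "(point_at h \<tau> x (h # fs) - x) \<bullet> u0 = 0" by (rule conormal(3)[OF F\<tau>0])
  have u: "norm u0 = 1" "\<bar>u0 \<bullet> \<nu> \<tau>0\<bar> \<le> normal_const N * e" "u0 \<bullet> u0 = 1" using u0 e K_ge_1(1)[of N] by (auto simp: norm_eq_1)
  have "\<bar>side_sign \<tau> * ?t\<bar> \<le> \<bar>side_sign \<tau> * ?t\<bar> * (cosine_const N * e\<^sup>2)"
    using inner_along[OF along_point[OF I r] u(1,2)] unfolding d u(3) by simp
  then have "?t \<le> ?t * (cosine_const N * e\<^sup>2)" using t by (simp add: abs_mult del: time_at.simps)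
  also have "\<dots> < ?t * 1" using t small by (intro mult_strict_left_mono)
  finally show False by simp
qed

text \<open>The two displacements to the common arrival point are multiples of \<open>u0\<close> up
  to O(e^2) after projection. The difference of the starting points is orthogonal to
  \<open>u0\<close>, so the multiples drop out and only the errors remain.\<close>

lemma start_points_close:
  assumes I: "bounded_itinerary \<tau> fs" and J: "bounded_itinerary \<tau>' gs" and r: "reach h \<tau> x fs" "reach h \<tau>' x' gs"
    and eq: "point_at h \<tau> x fs = point_at h \<tau>' x' gs"
    and D: "norm (point_at h \<tau> x fs - x) \<le> D" "norm (point_at h \<tau> x fs - x') \<le> D" and small: "2 * (direction_const N * e\<^sup>2) \<le> 1"
  shows "norm (x - x') \<le> 4 * D * direction_const N * e\<^sup>2"
proof -
  let ?y = "point_at h \<tau> x fs"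
  define t where "t = side_sign \<tau> * time_at h \<tau> x fs"
  define t' where "t' = side_sign \<tau>' * time_at h \<tau>' x' gs"
  have a: "along t (?y - x)" "along t' (?y - x')"
    using along_point[OF I r(1)] along_point[OF J r(2)] eq by (auto simp: t_def t'_def)
  \<comment> \<open>The diameter bounds the displacement and not the time. Since
    \<open>direction_const N * e\<^sup>2\<close> is at most 1/2, the time is at most twice as
    large.\<close>
  have tD: "\<bar>t\<bar> \<le> 2 * D" if "along t d" "norm d \<le> D" for t d
  proof -
    have "\<bar>t\<bar> = norm (t *\<^sub>R u0)" using u0 by simp
    also have "\<dots> \<le> norm (tangential \<tau>0 d) + norm (tangential \<tau>0 d - t *\<^sub>R u0)" by (metis norm_triangle_sub norm_minus_commute)
    also have "norm (tangential \<tau>0 d) \<le> D" using norm_tang[OF \<tau>0_top, of d] that(2) by linarith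
    also have "norm (tangential \<tau>0 d - t *\<^sub>R u0) \<le> \<bar>t\<bar> * (direction_const N * e\<^sup>2)" using that(1) by (simp add: along_def)
    finally have "\<bar>t\<bar> \<le> D + \<bar>t\<bar> * (direction_const N * e\<^sup>2)" by simp
    moreover have "\<bar>t\<bar> * (2 * (direction_const N * e\<^sup>2)) \<le> \<bar>t\<bar> * 1" using small by (rule mult_left_mono) simp
    ultimately show ?thesis by simp
  qed
  have "reach h \<tau> x []" "reach h \<tau>' x' []"
    using reach_append[of h \<tau> x fs "[]"] reach_append[of h \<tau>' x' gs "[]"] r by simp_all
  then have "x \<in> h" "x' \<in> h" using rel_interior_subset by auto
  then have xx: "x - x' \<in> dirs h" by (rule diff_in_dirs)
  define w where "w = x - x'"
  have "w \<in> dirs \<tau>0" unfolding w_def using xx dirs_mono F\<tau>0 by blast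
  then have tw: "tangential \<tau>0 w = w" by (rule tangential_dirs[OF \<tau>0_top])
  have wu: "w \<bullet> u0 = 0" unfolding w_def by (rule conormal(3)[OF F\<tau>0 xx])
  define E where "E = (tangential \<tau>0 (?y - x') - t' *\<^sub>R u0) - (tangential \<tau>0 (?y - x) - t *\<^sub>R u0)"
  have "w = tangential \<tau>0 ((?y - x') - (?y - x))" using tw by (simp add: w_def)
  also have "\<dots> = (t' - t) *\<^sub>R u0 + E" unfolding tangential_linear E_def by (simp add: algebra_simps)
  finally have wE: "w = (t' - t) *\<^sub>R u0 + E" .
  have "norm E \<le> norm (tangential \<tau>0 (?y - x') - t' *\<^sub>R u0) + norm (tangential \<tau>0 (?y - x) - t *\<^sub>R u0)"
    unfolding E_def by (rule norm_triangle_ineq4)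
  also have "\<dots> \<le> \<bar>t'\<bar> * (direction_const N * e\<^sup>2) + \<bar>t\<bar> * (direction_const N * e\<^sup>2)" using a by (simp add: along_def add_mono)
  also have "\<dots> \<le> (2 * D) * (direction_const N * e\<^sup>2) + (2 * D) * (direction_const N * e\<^sup>2)"
    using tD[OF a(1) D(1)] tD[OF a(2) D(2)] K_ge_1(2)[of N] by (intro add_mono mult_right_mono) auto
  finally have nE: "norm E \<le> 4 * D * direction_const N * e\<^sup>2" by simp
  have "w \<bullet> w = w \<bullet> ((t' - t) *\<^sub>R u0 + E)" using wE by simp
  then have "w \<bullet> w = w \<bullet> E" using wu by (simp add: inner_add_right)
  then have "norm w * norm w \<le> norm w * norm E" using norm_cauchy_schwarz[of w E] by (simp add: norm_eq_square power2_norm_eq_inner flip: power2_eq_square)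
  then have "norm w \<le> norm E" by (cases "w = 0") auto
  then show ?thesis using nE by (simp add: w_def)
qed

end

end

section \<open>The lines through a hinge region\<close>

context flat_manifold
begin

lemma crossing_unique:
  assumes c: "crosses_at n K \<gamma> t f \<sigma> \<tau> c w" and c': "crosses_at n K \<gamma> t f' \<sigma>' \<tau>' c' w'"
  shows "f' = f" "c' = c"
proof -
  have A: "adjacent_at n K f \<sigma> \<tau>" "w \<in> dirs f" "0 < c" "c\<^sup>2 + (norm w)\<^sup>2 = 1" "\<gamma> t \<in> rel_interior f"
    and A': "adjacent_at n K f' \<sigma>' \<tau>'" "w' \<in> dirs f'" "0 < c'" "c'\<^sup>2 + (norm w')\<^sup>2 = 1" "\<gamma> t \<in> rel_interior f'"
    using c c' by (auto simp: crosses_at_def)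
  note F = adjacent_facet[OF A(1)] and F' = adjacent_facet[OF A'(1)]
  show ff: "f' = f" using A(5) A'(5) F F' rel_interior_eq hinge_in by blast
  have "w - c *\<^sub>R conormal \<sigma> f = w' - c' *\<^sub>R conormal \<sigma>' f"
    using left_velocity_unique[OF crosses_velocity(1)[OF c] crosses_velocity(1)[OF c']] ff by simp
  then have "w - w' = c *\<^sub>R conormal \<sigma> f - c' *\<^sub>R conormal \<sigma>' f" by (simp add: algebra_simps)
  then have "(w - w') \<bullet> (w - w') = (w - w') \<bullet> (c *\<^sub>R conormal \<sigma> f - c' *\<^sub>R conormal \<sigma>' f)" by simp
  also have "\<dots> = 0"
    using conormal(3)[OF F(1)] conormal(3)[OF F'(1)] A(2) A'(2) ff by (simp add: inner_diff_left inner_diff_right)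
  finally have "w = w'" by simp
  then have "c'\<^sup>2 = c\<^sup>2" using A(4) A'(4) by simp
  then show "c' = c" using A(3) A'(3) by (simp add: power2_eq_iff_nonneg)
qed

lemma geodesic_crosses:
  assumes "geodesic_in n K W I \<gamma>" "t \<in> I" "f \<in> hinges n K" "\<gamma> t \<in> rel_interior f"
  shows "\<exists>\<sigma> \<tau> c w. crosses_at n K \<gamma> t f \<sigma> \<tau> c w"
proof -
  have "straight_at n K \<gamma> t \<or> (\<exists>f \<sigma> \<tau> c w. crosses_at n K \<gamma> t f \<sigma> \<tau> c w)"
    using assms unfolding geodesic_in_def by blast
  moreover have "\<not> straight_at n K \<gamma> t"
    using assms(3,4) rel_interior_eq hinge_in top_in hinge_not_top unfolding straight_at_def by metis
  ultimately obtain f0 \<sigma> \<tau> c w where c: "crosses_at n K \<gamma> t f0 \<sigma> \<tau> c w" by blast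
  then have "f0 = f" using assms(3,4) rel_interior_eq hinge_in unfolding crosses_at_def adjacent_at_def by metis
  then show ?thesis using c by blast
qed

lemma finite_vertices: "h \<in> hinges n K \<Longrightarrow> finite (h \<inter> vertices K)"
proof -
  assume h: "h \<in> hinges n K"
  have "polytope h" using hinge_in(2)[OF h] simplex_imp_polytope by blast
  then have "finite {F. F face_of h}" by (rule finite_polytope_faces)
  moreover have "(\<lambda>v. {v}) ` (h \<inter> vertices K) \<subseteq> {F. F face_of h}"
    using face_of_sub[OF _ hinge_in(1)[OF h]] by (auto simp: vertices_def)
  ultimately have "finite ((\<lambda>v. {v}) ` (h \<inter> vertices K))" by (rule finite_subset[rotated])
  then show ?thesis by (rule finite_imageD) (simp add: inj_on_def)
qed

end

text \<open>The Bonferroni inequality with every pair counted twice, which only weakens the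
  bound.\<close>

lemma sum_measure_le_Union:
  assumes "finite J" "\<And>i. i \<in> J \<Longrightarrow> G i \<in> fmeasurable M"
  shows "(\<Sum>i\<in>J. measure M (G i)) \<le> measure M (\<Union>i\<in>J. G i) + (\<Sum>i\<in>J. \<Sum>j\<in>J - {i}. measure M (G i \<inter> G j))"
  using assms
proof (induction J)
  case (insert a J)
  have U: "(\<Union>i\<in>J. G i) \<in> fmeasurable M" using insert by (intro fmeasurable.finite_UN) auto
  have Ga: "G a \<in> fmeasurable M" using insert by simp
  have "measure M (G a \<union> (\<Union>i\<in>J. G i)) = measure M (G a) + measure M (\<Union>i\<in>J. G i) - measure M (G a \<inter> (\<Union>i\<in>J. G i))"
    using measure_Un3[OF Ga U] .
  moreover have "measure M (G a \<inter> (\<Union>i\<in>J. G i)) \<le> (\<Sum>i\<in>J. measure M (G a \<inter> G i))"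
  proof -
    have "G a \<inter> (\<Union>i\<in>J. G i) = (\<Union>i\<in>J. G a \<inter> G i)" by blast
    moreover have "measure M (\<Union>i\<in>J. G a \<inter> G i) \<le> (\<Sum>i\<in>J. measure M (G a \<inter> G i))"
      using insert by (intro measure_UNION_le) (auto intro!: fmeasurableD)
    ultimately show ?thesis by simp
  qed
  moreover have "(\<Sum>i\<in>J. \<Sum>j\<in>J - {i}. measure M (G i \<inter> G j)) \<le> (\<Sum>i\<in>J. \<Sum>j\<in>insert a J - {i}. measure M (G i \<inter> G j))"
    using insert by (intro sum_mono sum_mono2) auto
  moreover have "insert a J - {a} = J" using insert by auto
  ultimately show ?case using insert by simp
qed simp

text \<open>The conditions in \<open>e_small\<close> serve, in this order, the rotation formula at
  the hinges, \<open>no_return\<close>, and \<open>start_points_close\<close>.\<close>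

locale hinge_lines = flat_manifold n K \<nu>
  for n :: nat and K :: "'a::euclidean_space set set" and \<nu> +
  fixes V :: "'a \<Rightarrow> 'a set" and h :: "'a set" and \<gamma> :: "'a \<Rightarrow> real \<Rightarrow> 'a" and I :: "'a \<Rightarrow> real set"
    and N :: nat and D e :: real and \<sigma>0 \<tau>0 :: "'a set" and A H VR
  assumes tess: "dual_tessellation n K V"
    and lines: "orthogonal_lines n K V h \<gamma> I"
    and A: "A = hinge_region K V h \<gamma> I"
    and H: "H = hinges_meeting n K A"
    and VR: "VR = vertex_regions_of K V h"
    and bounded: "region_bounded_by n K A h \<gamma> I N D"
    and angles: "\<forall>f\<in>H. \<bar>hinge_angle n K \<nu> f\<bar> \<le> e"
    and sides: "adjacent_at n K h \<sigma>0 \<tau>0"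
    and e_pos: "0 \<le> e" and e_small: "e < 1" "cosine_const N * e\<^sup>2 < 1" "2 * (direction_const N * e\<^sup>2) \<le> 1"
begin

lemma h_hinge: "h \<in> hinges n K"
  using sides by (auto simp: adjacent_at_def)

lemma VR_borel: "VR \<in> sets borel"
  unfolding VR vertex_regions_of_def using finite_vertices[OF h_hinge] tess
  by (intro sets.finite_UN) (auto simp: dual_tessellation_def)

lemma ri_h: "rel_interior h \<subseteq> A"
  using lines by (simp add: orthogonal_lines_def A)

lemma A_VR: "A \<subseteq> VR"
  by (auto simp: A VR hinge_region_def)

lemma line_in_A: "x \<in> rel_interior h \<Longrightarrow> t \<in> I x \<Longrightarrow> \<gamma> x t \<in> A \<longleftrightarrow> \<gamma> x t \<in> VR"
  by (auto simp: A VR hinge_region_def)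

lemma H_hinges: "f \<in> H \<Longrightarrow> f \<in> hinges n K"
  by (simp add: H hinges_meeting_def)

lemma hH: "h \<in> H"
  using ri_h ri_hinge_nonempty[OF h_hinge] h_hinge by (auto simp: H hinges_meeting_def)

lemma finite_H: "finite H" "card H \<le> N"
  using bounded by (auto simp: H region_bounded_by_def)

lemma D_bound: "p \<in> A \<Longrightarrow> q \<in> A \<Longrightarrow> dist p q \<le> D"
  using bounded by (simp add: region_bounded_by_def)

abbreviation "itinerary \<equiv> bounded_itinerary h \<sigma>0 \<tau>0 N H"

lemmas itinerary_def = bounded_itinerary_def[OF sides e_pos e_small(1) hH angles]

lemma angles1: "f \<in> H \<Longrightarrow> \<bar>hinge_angle n K \<nu> f\<bar> < 1"
  using angles e_small by force

text \<open>Applied to a line and to the line with the opposite orientation.\<close>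
lemma half_line:
  assumes x: "x \<in> rel_interior h" and m: "maximal_geodesic (stars h) J g" and J: "0 \<in> J" "g 0 = x"
    and c0: "crosses_at n K g 0 h \<sigma> \<tau> 1 0"
    and gVR: "\<forall>t\<in>J. g t \<in> VR \<longrightarrow> g t \<in> A"
    and iv: "is_interval {t \<in> J. g t \<in> VR}"
    and fin: "finite {t \<in> J. g t \<in> VR \<and> (\<exists>f\<in>hinges n K. g t \<in> rel_interior f)}"
      "card {t \<in> J. g t \<in> VR \<and> (\<exists>f\<in>hinges n K. g t \<in> rel_interior f)} \<le> N"
  shows "bij_betw (\<lambda>fs. time_at h \<tau> x fs) {fs. fs \<noteq> [] \<and> itinerary \<tau> fs \<and> reach h \<tau> x fs \<and> point_at h \<tau> x fs \<in> VR}
      {t \<in> J. g t \<in> VR \<and> (\<exists>f\<in>hinges n K. g t \<in> rel_interior f) \<and> 0 < t}"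
    and "\<And>f fs. itinerary \<tau> (f # fs) \<Longrightarrow> reach h \<tau> x (f # fs) \<Longrightarrow>
      time_at h \<tau> x (f # fs) \<in> J \<and> g (time_at h \<tau> x (f # fs)) = point_at h \<tau> x (f # fs) \<and>
      (\<exists>\<sigma> \<tau>' w. crosses_at n K g (time_at h \<tau> x (f # fs)) f \<sigma> \<tau>' (cosine h \<tau> (f # fs)) w)"
proof -
  let ?CT = "{t \<in> J. g t \<in> VR \<and> (\<exists>f\<in>hinges n K. g t \<in> rel_interior f)}"
  have adj: "adjacent_at n K h \<sigma> \<tau>" using c0 by (simp add: crosses_at_def)
  have F: "facet h \<tau>" using adjacent_facet(2)[OF adj] .
  have \<tau>: "\<tau> = \<sigma>0 \<or> \<tau> = \<tau>0" using adjacent_cases[OF sides F] .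
  have rv: "right_velocity g 0 (conormal \<tau> h)" using crosses_velocity(2)[OF c0] by simp
  note tr = trajectory[OF F m J rv]
  show 2: "time_at h \<tau> x (f # fs) \<in> J \<and> g (time_at h \<tau> x (f # fs)) = point_at h \<tau> x (f # fs) \<and>
      (\<exists>\<sigma> \<tau>' w. crosses_at n K g (time_at h \<tau> x (f # fs)) f \<sigma> \<tau>' (cosine h \<tau> (f # fs)) w)"
    if "itinerary \<tau> (f # fs)" "reach h \<tau> x (f # fs)" for f fs
  proof -
    have "admissible h \<tau> (f # fs)" using that(1) by (simp add: itinerary_def del: admissible.simps)
    from tr[OF this that(2)] show ?thesis by blast
  qed
  show "bij_betw (\<lambda>fs. time_at h \<tau> x fs) {fs. fs \<noteq> [] \<and> itinerary \<tau> fs \<and> reach h \<tau> x fs \<and> point_at h \<tau> x fs \<in> VR}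
      {t \<in> J. g t \<in> VR \<and> (\<exists>f\<in>hinges n K. g t \<in> rel_interior f) \<and> 0 < t}"
    unfolding bij_betw_def
  proof (intro conjI set_eqI iffI)
    show "inj_on (\<lambda>fs. time_at h \<tau> x fs) {fs. fs \<noteq> [] \<and> itinerary \<tau> fs \<and> reach h \<tau> x fs \<and> point_at h \<tau> x fs \<in> VR}"
      using time_at_inj[OF F] by (intro inj_onI) (auto simp: itinerary_def)
  next
    fix t assume "t \<in> (\<lambda>fs. time_at h \<tau> x fs) ` {fs. fs \<noteq> [] \<and> itinerary \<tau> fs \<and> reach h \<tau> x fs \<and> point_at h \<tau> x fs \<in> VR}"
    then obtain fs where fs: "fs \<noteq> []" "itinerary \<tau> fs" "reach h \<tau> x fs" "point_at h \<tau> x fs \<in> VR" "t = time_at h \<tau> x fs" by auto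
    obtain f gs where fgs: "fs = f # gs" using fs(1) by (cases fs) auto
    note * = 2[OF fs(2,3)[unfolded fgs]]
    have "f \<in> hinges n K" using fs(2) fgs H_hinges by (auto simp: itinerary_def)
    moreover have "point_at h \<tau> x fs \<in> rel_interior f" using fs(3) fgs by auto
    ultimately show "t \<in> {t \<in> J. g t \<in> VR \<and> (\<exists>f\<in>hinges n K. g t \<in> rel_interior f) \<and> 0 < t}"
      using * fs(4) time_at_pos[OF fs(3,1)] unfolding fs(5) fgs by auto
  next
    fix t assume "t \<in> {t \<in> J. g t \<in> VR \<and> (\<exists>f\<in>hinges n K. g t \<in> rel_interior f) \<and> 0 < t}"
    then obtain f where t: "t \<in> J" "g t \<in> VR" "0 < t" "f \<in> hinges n K" "g t \<in> rel_interior f" by auto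
    let ?C = "{s. 0 < s \<and> s \<le> t \<and> (\<exists>g'\<in>hinges n K. g s \<in> rel_interior g')}"
    have x0: "0 \<in> {t \<in> J. g t \<in> VR}" using J x ri_h A_VR by auto
    \<comment> \<open>Since the line meets the region in a segment, every earlier crossing also lies
      in the region. Hence the crossings up to \<open>t\<close> number at most \<open>N\<close>, and
      their hinges belong to \<open>H\<close>.\<close>
    have seg: "s \<in> J \<and> g s \<in> VR" if "0 < s" "s \<le> t" for s
    proof -
      have "t \<in> {t \<in> J. g t \<in> VR}" using t by simp
      then have "s \<in> {t \<in> J. g t \<in> VR}"
        using iv x0 that unfolding is_interval_1 by (meson less_imp_le)
      then show ?thesis by simp
    qed
    have sub: "?C \<subseteq> ?CT" using seg by auto
    have finC: "finite ?C" using sub fin(1) by (rule finite_subset)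
    have cN: "card ?C \<le> N" using card_mono[OF fin(1) sub] fin(2) by linarith
    from crossing_itinerary[OF F m J rv x t(1,3,4,5) finC] obtain fs where
      fs: "admissible h \<tau> (f # fs)" "reach h \<tau> x (f # fs)" "time_at h \<tau> x (f # fs) = t" "length (f # fs) \<le> card ?C"
        "\<forall>g'\<in>set (f # fs). \<exists>s. 0 < s \<and> s \<le> t \<and> g s \<in> rel_interior g'" by blast
    have admH: "g' \<in> hinges n K" if "admissible h \<tau> ks" "g' \<in> set ks" for ks g'
      using that by (induction ks) auto
    have "g' \<in> H" if "g' \<in> set (f # fs)" for g'
    proof -
      obtain s where s: "0 < s" "s \<le> t" "g s \<in> rel_interior g'" using fs(5) \<open>g' \<in> set (f # fs)\<close> by blast
      then have "g s \<in> A" using seg[of s] gVR by blast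
      then show ?thesis using s(3) admH[OF fs(1) \<open>g' \<in> set (f # fs)\<close>] by (auto simp: H hinges_meeting_def)
    qed
    then have it: "itinerary \<tau> (f # fs)"
      using \<tau> fs(1) order_trans[OF fs(4) cN] unfolding itinerary_def by blast
    have "point_at h \<tau> x (f # fs) = g t" using 2[OF it fs(2)] fs(3) by simp
    then have "f # fs \<in> {fs. fs \<noteq> [] \<and> itinerary \<tau> fs \<and> reach h \<tau> x fs \<and> point_at h \<tau> x fs \<in> VR}"
      using it fs(2) t(2) by (simp del: point_at.simps reach.simps)
    then show "t \<in> (\<lambda>fs. time_at h \<tau> x fs) ` {fs. fs \<noteq> [] \<and> itinerary \<tau> fs \<and> reach h \<tau> x fs \<and> point_at h \<tau> x fs \<in> VR}"
      using fs(3) by blast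
  qed
qed

section \<open>From crossing times to sums over itineraries\<close>

lemma line:
  assumes x: "x \<in> rel_interior h"
  shows "maximal_geodesic (stars h) (I x) (\<gamma> x)" "0 \<in> I x" "\<gamma> x 0 = x" "\<exists>\<sigma> \<tau>. crosses_at n K (\<gamma> x) 0 h \<sigma> \<tau> 1 0"
    "is_interval {t \<in> I x. \<gamma> x t \<in> VR}"
    "crossing_times n K A (\<gamma> x) (I x) = {t \<in> I x. \<gamma> x t \<in> VR \<and> (\<exists>f\<in>hinges n K. \<gamma> x t \<in> rel_interior f)}"
    "finite (crossing_times n K A (\<gamma> x) (I x))" "card (crossing_times n K A (\<gamma> x) (I x)) \<le> N"
proof -
  have o: "orthogonal_geodesic n K h x (\<gamma> x) (I x)" "is_interval {t \<in> I x. \<gamma> x t \<in> A}"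
    using lines x by (auto simp: orthogonal_lines_def A)
  show "maximal_geodesic (stars h) (I x) (\<gamma> x)" "0 \<in> I x" "\<gamma> x 0 = x" "\<exists>\<sigma> \<tau>. crosses_at n K (\<gamma> x) 0 h \<sigma> \<tau> 1 0"
    using o(1) unfolding orthogonal_geodesic_def maximal_geodesic_def Let_def by blast+
  have "{t \<in> I x. \<gamma> x t \<in> VR} = {t \<in> I x. \<gamma> x t \<in> A}" using line_in_A[OF x] by auto
  then show "is_interval {t \<in> I x. \<gamma> x t \<in> VR}" using o(2) by simp
  show "crossing_times n K A (\<gamma> x) (I x) = {t \<in> I x. \<gamma> x t \<in> VR \<and> (\<exists>f\<in>hinges n K. \<gamma> x t \<in> rel_interior f)}"
    unfolding crossing_times_def using line_in_A[OF x] by auto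
  show "finite (crossing_times n K A (\<gamma> x) (I x))" "card (crossing_times n K A (\<gamma> x) (I x)) \<le> N"
    using bounded x by (auto simp: region_bounded_by_def)
qed

text \<open>The simplex that the path \<open>\<gamma> x\<close> enters at time zero may depend on
  \<open>x\<close> in an arbitrary way; \<open>orient\<close> converts travel times into parameters
  of the path.\<close>

definition forward :: "'a \<Rightarrow> 'a set \<Rightarrow> bool" where
  "forward x \<tau> \<longleftrightarrow> (\<exists>\<sigma>. crosses_at n K (\<gamma> x) 0 h \<sigma> \<tau> 1 0)"

definition orient :: "'a \<Rightarrow> 'a set \<Rightarrow> real" where
  "orient x \<tau> = (if forward x \<tau> then 1 else - 1)"

lemma forward_sides:
  assumes x: "x \<in> rel_interior h"
  shows "forward x \<sigma>0 \<longleftrightarrow> \<not> forward x \<tau>0"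
proof -
  obtain \<sigma> \<tau> where c: "crosses_at n K (\<gamma> x) 0 h \<sigma> \<tau> 1 0" using line(4)[OF x] by blast
  have adj: "adjacent_at n K h \<sigma> \<tau>" using c by (simp add: crosses_at_def)
  have "\<tau>' = \<tau>" if c': "crosses_at n K (\<gamma> x) 0 h \<sigma>' \<tau>' 1 0" for \<sigma>' \<tau>'
  proof -
    have "conormal \<tau>' h = conormal \<tau> h"
      using right_velocity_unique[OF crosses_velocity(2)[OF c] crosses_velocity(2)[OF c']] by simp
    moreover have adj': "adjacent_at n K h \<sigma>' \<tau>'" using c' by (simp add: crosses_at_def)
    have "\<tau>' = \<sigma> \<or> \<tau>' = \<tau>" using adjacent_cases[OF adj adjacent_facet(2)[OF adj']] .
    ultimately show ?thesis using conormal_distinct[OF adj] by auto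
  qed
  then have "forward x \<rho> \<longleftrightarrow> \<rho> = \<tau>" for \<rho> using c unfolding forward_def by blast
  moreover have "\<tau> = \<sigma>0 \<or> \<tau> = \<tau>0" using adjacent_cases[OF sides adjacent_facet(2)[OF adj]] .
  moreover have "\<sigma>0 \<noteq> \<tau>0" using sides by (simp add: adjacent_at_def)
  ultimately show ?thesis by blast
qed

text \<open>If the path enters \<open>\<tau>\<close> at time zero, \<open>half_line\<close> applies
  directly; otherwise it applies to the reversed path, and times change sign.\<close>

lemma oriented_line:
  assumes x: "x \<in> rel_interior h" and \<tau>: "\<tau> = \<sigma>0 \<or> \<tau> = \<tau>0"
  shows "bij_betw (\<lambda>fs. orient x \<tau> * time_at h \<tau> x fs) {fs. fs \<noteq> [] \<and> itinerary \<tau> fs \<and> reach h \<tau> x fs \<and> point_at h \<tau> x fs \<in> VR}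
      {t \<in> crossing_times n K A (\<gamma> x) (I x). 0 < orient x \<tau> * t}"
    and "\<And>f fs. itinerary \<tau> (f # fs) \<Longrightarrow> reach h \<tau> x (f # fs) \<Longrightarrow>
      orient x \<tau> * time_at h \<tau> x (f # fs) \<in> I x \<and> \<gamma> x (orient x \<tau> * time_at h \<tau> x (f # fs)) = point_at h \<tau> x (f # fs) \<and>
      (\<exists>\<sigma> \<tau>' w. crosses_at n K (\<gamma> x) (orient x \<tau> * time_at h \<tau> x (f # fs)) f \<sigma> \<tau>' (cosine h \<tau> (f # fs)) w)"
proof -
  note L = line[OF x]
  let ?S = "{fs. fs \<noteq> [] \<and> itinerary \<tau> fs \<and> reach h \<tau> x fs \<and> point_at h \<tau> x fs \<in> VR}"
  have "bij_betw (\<lambda>fs. orient x \<tau> * time_at h \<tau> x fs) ?S {t \<in> crossing_times n K A (\<gamma> x) (I x). 0 < orient x \<tau> * t} \<and>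
    (\<forall>f fs. itinerary \<tau> (f # fs) \<longrightarrow> reach h \<tau> x (f # fs) \<longrightarrow>
      orient x \<tau> * time_at h \<tau> x (f # fs) \<in> I x \<and> \<gamma> x (orient x \<tau> * time_at h \<tau> x (f # fs)) = point_at h \<tau> x (f # fs) \<and>
      (\<exists>\<sigma> \<tau>' w. crosses_at n K (\<gamma> x) (orient x \<tau> * time_at h \<tau> x (f # fs)) f \<sigma> \<tau>' (cosine h \<tau> (f # fs)) w))"
  proof (cases "forward x \<tau>")
    case True
    then obtain \<sigma> where c: "crosses_at n K (\<gamma> x) 0 h \<sigma> \<tau> 1 0" unfolding forward_def by blast
    have o: "orient x \<tau> = 1" using True by (simp add: orient_def)
    have gA: "\<forall>t\<in>I x. \<gamma> x t \<in> VR \<longrightarrow> \<gamma> x t \<in> A" using line_in_A[OF x] by blast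
    note HL = half_line[OF x L(1,2,3) c gA L(5) L(7,8)[unfolded L(6)]]
    have "{t \<in> I x. \<gamma> x t \<in> VR \<and> (\<exists>f\<in>hinges n K. \<gamma> x t \<in> rel_interior f) \<and> 0 < t}
        = {t \<in> crossing_times n K A (\<gamma> x) (I x). 0 < t}" unfolding L(6) by auto
    then show ?thesis unfolding o mult_1 using HL by auto
  next
    case False
    have o: "orient x \<tau> = - 1" using False by (simp add: orient_def)
    obtain \<sigma>' \<tau>' where c: "crosses_at n K (\<gamma> x) 0 h \<sigma>' \<tau>' 1 0" using L(4) by blast
    have adj: "adjacent_at n K h \<sigma>' \<tau>'" using c by (simp add: crosses_at_def)
    have "\<tau> \<noteq> \<tau>'" using False c unfolding forward_def by blast
    moreover have "facet h \<tau>" using \<tau> adjacent_facet[OF sides] by blast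
    ultimately have "\<tau> = \<sigma>'" using adjacent_cases[OF adj] by blast
    then have c: "crosses_at n K (\<lambda>s. \<gamma> x (- s)) 0 h \<tau>' \<tau> 1 0" using crosses_reverse[OF c] by simp
    let ?g = "\<lambda>s. \<gamma> x (- s)" and ?J = "uminus ` I x"
    have Jiff: "t \<in> ?J \<longleftrightarrow> - t \<in> I x" for t by force
    have "{t \<in> ?J. ?g t \<in> VR} = uminus ` {t \<in> I x. \<gamma> x t \<in> VR}" by (force simp: image_iff)
    then have iv: "is_interval {t \<in> ?J. ?g t \<in> VR}" using L(5) by simp
    have CT: "{t \<in> ?J. ?g t \<in> VR \<and> (\<exists>f\<in>hinges n K. ?g t \<in> rel_interior f)} = uminus ` crossing_times n K A (\<gamma> x) (I x)"
      unfolding L(6) by (force simp: image_iff)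
    have fin: "finite {t \<in> ?J. ?g t \<in> VR \<and> (\<exists>f\<in>hinges n K. ?g t \<in> rel_interior f)}"
      "card {t \<in> ?J. ?g t \<in> VR \<and> (\<exists>f\<in>hinges n K. ?g t \<in> rel_interior f)} \<le> N"
      unfolding CT using L(7,8) by (auto simp: card_image)
    have gA: "\<forall>t\<in>?J. ?g t \<in> VR \<longrightarrow> ?g t \<in> A" using line_in_A[OF x] by auto
    have J0: "0 \<in> ?J" "?g 0 = x" using L by (auto simp: Jiff)
    note HL = half_line[OF x maximal_geodesic_reverse[OF L(1)] J0 c gA iv fin]
    let ?T = "{t \<in> ?J. ?g t \<in> VR \<and> (\<exists>f\<in>hinges n K. ?g t \<in> rel_interior f) \<and> 0 < t}"
    have T: "uminus ` ?T = {t \<in> crossing_times n K A (\<gamma> x) (I x). 0 < orient x \<tau> * t}"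
      unfolding L(6) o by (force simp: image_iff)
    have "bij_betw uminus ?T (uminus ` ?T)" by (rule inj_on_imp_bij_betw) simp
    from bij_betw_trans[OF HL(1) this] have "bij_betw (\<lambda>fs. orient x \<tau> * time_at h \<tau> x fs) ?S {t \<in> crossing_times n K A (\<gamma> x) (I x). 0 < orient x \<tau> * t}"
      unfolding T by (simp add: o comp_def)
    moreover have "orient x \<tau> * time_at h \<tau> x (f # fs) \<in> I x \<and> \<gamma> x (orient x \<tau> * time_at h \<tau> x (f # fs)) = point_at h \<tau> x (f # fs) \<and>
      (\<exists>\<sigma> \<tau>' w. crosses_at n K (\<gamma> x) (orient x \<tau> * time_at h \<tau> x (f # fs)) f \<sigma> \<tau>' (cosine h \<tau> (f # fs)) w)"
      if it: "itinerary \<tau> (f # fs)" "reach h \<tau> x (f # fs)" for f fs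
    proof -
      let ?t = "time_at h \<tau> x (f # fs)"
      obtain \<sigma>1 \<tau>1 w where c1: "?t \<in> ?J" "?g ?t = point_at h \<tau> x (f # fs)" "crosses_at n K ?g ?t f \<sigma>1 \<tau>1 (cosine h \<tau> (f # fs)) w"
        using HL(2)[OF it] by blast
      have "crosses_at n K (\<gamma> x) (- ?t) f \<tau>1 \<sigma>1 (cosine h \<tau> (f # fs)) (- w)"
        using crosses_reverse[OF c1(3)] by simp
      moreover have "- ?t \<in> I x" "\<gamma> x (- ?t) = point_at h \<tau> x (f # fs)" using c1(1,2) by (auto simp only: Jiff)
      ultimately show ?thesis unfolding o mult_minus1 by blast
    qed
    ultimately show ?thesis by blast
  qed
  then show "bij_betw (\<lambda>fs. orient x \<tau> * time_at h \<tau> x fs) ?S {t \<in> crossing_times n K A (\<gamma> x) (I x). 0 < orient x \<tau> * t}"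
    and "\<And>f fs. itinerary \<tau> (f # fs) \<Longrightarrow> reach h \<tau> x (f # fs) \<Longrightarrow>
      orient x \<tau> * time_at h \<tau> x (f # fs) \<in> I x \<and> \<gamma> x (orient x \<tau> * time_at h \<tau> x (f # fs)) = point_at h \<tau> x (f # fs) \<and>
      (\<exists>\<sigma> \<tau>' w. crosses_at n K (\<gamma> x) (orient x \<tau> * time_at h \<tau> x (f # fs)) f \<sigma> \<tau>' (cosine h \<tau> (f # fs)) w)" by blast+
qed

definition itins :: "('a set \<times> 'a set list) set" where
  "itins = {i. itinerary (fst i) (snd i) \<and> snd i \<noteq> []}"

text \<open>Independent of the paths \<open>\<gamma>\<close>, hence Borel; membership in the hinge
  region becomes membership of the arrival point in \<open>VR\<close>.\<close>

definition starts :: "'a set \<times> 'a set list \<Rightarrow> 'a set" where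
  "starts i = {x. reach h (fst i) x (snd i) \<and> point_at h (fst i) x (snd i) \<in> VR}"

abbreviation "final i \<equiv> hd (snd i)"
abbreviation "crossing_cos i \<equiv> cosine h (fst i) (snd i)"
abbreviation "arrival i \<equiv> (\<lambda>x. point_at h (fst i) x (snd i))"
abbreviation "bend i \<equiv> turn (crossing_cos i) (hinge_angle n K \<nu> (final i))"

lemma itins_Cons:
  assumes "i \<in> itins" obtains \<tau> f fs where "i = (\<tau>, f # fs)" "itinerary \<tau> (f # fs)" "facet h \<tau>" "f \<in> H" "facet f (side \<tau> fs)"
    "admissible h \<tau> (f # fs)"
proof -
  obtain \<tau> fs' where i: "i = (\<tau>, fs')" by fastforce
  then obtain f fs where "fs' = f # fs" using assms by (cases fs') (auto simp: itins_def)
  then have i: "i = (\<tau>, f # fs)" using i by simp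
  have it: "itinerary \<tau> (f # fs)" using assms i by (simp add: itins_def)
  show thesis
    by (rule that[OF i it bounded_itinerary_facet[OF sides e_pos e_small(1) hH angles it]])
      (use it in \<open>auto simp: itinerary_def\<close>)
qed

lemma finite_itins: "finite itins" "card itins \<le> 2 * (\<Sum>k\<le>N. N ^ k)"
proof -
  let ?L = "{fs. set fs \<subseteq> H \<and> length fs \<le> N}"
  have sub: "itins \<subseteq> {\<sigma>0, \<tau>0} \<times> ?L" by (auto simp: itins_def itinerary_def)
  have finL: "finite ?L" by (rule finite_lists_length_le[OF finite_H(1)])
  then have fin: "finite ({\<sigma>0, \<tau>0} \<times> ?L)" by simp
  show "finite itins" using sub fin by (rule finite_subset)
  have "card itins \<le> card ({\<sigma>0, \<tau>0} \<times> ?L)" by (rule card_mono[OF fin sub])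
  also have "\<dots> = card {\<sigma>0, \<tau>0} * card ?L" by (rule card_cartesian_product)
  also have "\<dots> \<le> 2 * (\<Sum>k\<le>N. card H ^ k)"
    using card_lists_length_le[OF finite_H(1), of N] by (intro mult_mono) (auto simp: card_insert_if)
  also have "\<dots> \<le> 2 * (\<Sum>k\<le>N. N ^ k)"
    using finite_H(2) by (intro mult_left_mono sum_mono power_mono) auto
  finally show "card itins \<le> 2 * (\<Sum>k\<le>N. N ^ k)" .
qed

lemma crossing_zero:
  assumes x: "x \<in> rel_interior h"
  shows "0 \<in> crossing_times n K A (\<gamma> x) (I x)" "turning_angle n K \<nu> (\<gamma> x) 0 = hinge_angle n K \<nu> h"
proof -
  show "0 \<in> crossing_times n K A (\<gamma> x) (I x)"
    unfolding crossing_times_def using line(2,3)[OF x] ri_h x h_hinge by auto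
  obtain \<sigma> \<tau> where "crosses_at n K (\<gamma> x) 0 h \<sigma> \<tau> 1 0" using line(4)[OF x] by blast
  from turning_angle_crossing[OF this angles1[OF hH]]
  show "turning_angle n K \<nu> (\<gamma> x) 0 = hinge_angle n K \<nu> h"
    using turn_1 angles1[OF hH] by simp
qed

text \<open>The crossing times split into zero, which belongs to \<open>h\<close>, and the times on
  either half of the line, each in bijection with itineraries. On the right-hand side only
  indicators of Borel sets depend on \<open>x\<close>, which settles integrability.\<close>

lemma segment_curvature_itins:
  assumes x: "x \<in> rel_interior h"
  shows "segment_curvature n K \<nu> A (\<gamma> x) (I x) = hinge_angle n K \<nu> h + (\<Sum>i\<in>itins. indicator (starts i) x * bend i)"
proof -
  let ?CT = "crossing_times n K A (\<gamma> x) (I x)" and ?ta = "turning_angle n K \<nu> (\<gamma> x)"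
  let ?S = "\<lambda>\<tau>. {fs. fs \<noteq> [] \<and> itinerary \<tau> fs \<and> reach h \<tau> x fs \<and> point_at h \<tau> x fs \<in> VR}"
  let ?T = "\<lambda>\<tau>. {t \<in> ?CT. 0 < orient x \<tau> * t}"
  have fin: "finite ?CT" using line(7)[OF x] .
  have half: "(\<Sum>t\<in>?T \<tau>. ?ta t) = (\<Sum>fs\<in>?S \<tau>. bend (\<tau>, fs))" if \<tau>: "\<tau> = \<sigma>0 \<or> \<tau> = \<tau>0" for \<tau>
  proof -
    have "(\<Sum>t\<in>?T \<tau>. ?ta t) = (\<Sum>fs\<in>?S \<tau>. ?ta (orient x \<tau> * time_at h \<tau> x fs))"
      by (rule sum.reindex_bij_betw[OF oriented_line(1)[OF x \<tau>], symmetric])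
    also have "\<dots> = (\<Sum>fs\<in>?S \<tau>. bend (\<tau>, fs))"
    proof (rule sum.cong[OF refl])
      fix fs assume fs: "fs \<in> ?S \<tau>"
      then obtain f gs where fg: "fs = f # gs" by (cases fs) auto
      then obtain \<sigma> \<tau>' w where c: "crosses_at n K (\<gamma> x) (orient x \<tau> * time_at h \<tau> x fs) f \<sigma> \<tau>' (cosine h \<tau> fs) w"
        using oriented_line(2)[OF x \<tau>, of f gs] fs by blast
      have "f \<in> H" using fs fg by (auto simp: itinerary_def)
      from turning_angle_crossing[OF c angles1[OF this]]
      show "?ta (orient x \<tau> * time_at h \<tau> x fs) = bend (\<tau>, fs)" by (simp add: fg)
    qed
    finally show ?thesis .
  qed
  have oo: "orient x \<sigma>0 = - orient x \<tau>0" "orient x \<tau>0 \<noteq> 0" using forward_sides[OF x] by (auto simp: orient_def)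
  have split: "?CT = insert 0 (?T \<sigma>0 \<union> ?T \<tau>0)"
    using crossing_zero(1)[OF x] oo by (auto simp: mult_less_0_iff zero_less_mult_iff)
  have "segment_curvature n K \<nu> A (\<gamma> x) (I x) = ?ta 0 + (\<Sum>t\<in>?T \<sigma>0 \<union> ?T \<tau>0. ?ta t)"
    unfolding segment_curvature_def by (subst split, subst sum.insert) (use fin in auto)
  also have "(\<Sum>t\<in>?T \<sigma>0 \<union> ?T \<tau>0. ?ta t) = (\<Sum>t\<in>?T \<sigma>0. ?ta t) + (\<Sum>t\<in>?T \<tau>0. ?ta t)"
    by (rule sum.union_disjoint) (use fin oo in auto)
  also have "\<dots> = (\<Sum>fs\<in>?S \<sigma>0. bend (\<sigma>0, fs)) + (\<Sum>fs\<in>?S \<tau>0. bend (\<tau>0, fs))" using half by simp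
  also have "\<dots> = (\<Sum>i\<in>Pair \<sigma>0 ` ?S \<sigma>0. bend i) + (\<Sum>i\<in>Pair \<tau>0 ` ?S \<tau>0. bend i)"
    by (simp add: sum.reindex inj_on_def)
  also have "\<dots> = (\<Sum>i\<in>Pair \<sigma>0 ` ?S \<sigma>0 \<union> Pair \<tau>0 ` ?S \<tau>0. bend i)"
  proof (rule sum.union_disjoint[symmetric])
    have "Pair \<sigma>0 ` ?S \<sigma>0 \<subseteq> itins" "Pair \<tau>0 ` ?S \<tau>0 \<subseteq> itins" by (auto simp: itins_def)
    then show "finite (Pair \<sigma>0 ` ?S \<sigma>0)" "finite (Pair \<tau>0 ` ?S \<tau>0)" using finite_itins(1) finite_subset by blast+
  qed (use sides in \<open>auto simp: adjacent_at_def\<close>)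
  also have "Pair \<sigma>0 ` ?S \<sigma>0 \<union> Pair \<tau>0 ` ?S \<tau>0 = {i \<in> itins. x \<in> starts i}"
    by (auto simp: itins_def starts_def itinerary_def)
  also have "(\<Sum>i\<in>{i \<in> itins. x \<in> starts i}. bend i) = (\<Sum>i\<in>itins. if x \<in> starts i then bend i else 0)"
    by (rule sum.inter_filter[OF finite_itins(1)])
  also have "\<dots> = (\<Sum>i\<in>itins. indicator (starts i) x * bend i)"
    by (rule sum.cong) (simp_all add: indicator_def)
  finally show ?thesis using crossing_zero(2)[OF x] by simp
qed

lemma bounded_itinerary_of_crossing:
  assumes x: "x \<in> rel_interior h" and t: "t \<in> I x" "\<gamma> x t \<in> A" "\<gamma> x t \<in> rel_interior f" and f: "f \<in> hinges n K" "f \<noteq> h"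
  shows "\<exists>i\<in>itins. final i = f \<and> x \<in> starts i \<and> arrival i x = \<gamma> x t \<and> (\<exists>\<sigma> \<tau> w. crosses_at n K (\<gamma> x) t f \<sigma> \<tau> (crossing_cos i) w)"
proof -
  have CT: "t \<in> crossing_times n K A (\<gamma> x) (I x)" using t f by (auto simp: crossing_times_def)
  have "t \<noteq> 0"
  proof
    assume "t = 0"
    then have "x \<in> rel_interior f" using t line(3)[OF x] by simp
    then show False using rel_interior_eq x f h_hinge hinge_in by blast
  qed
  moreover have "orient x \<sigma>0 = - orient x \<tau>0" "orient x \<tau>0 \<noteq> 0" using forward_sides[OF x] by (auto simp: orient_def)
  ultimately have "0 < orient x \<sigma>0 * t \<or> 0 < orient x \<tau>0 * t" by (auto simp: mult_less_0_iff zero_less_mult_iff)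
  then obtain \<tau> where \<tau>: "\<tau> = \<sigma>0 \<or> \<tau> = \<tau>0" "0 < orient x \<tau> * t" by blast
  have "t \<in> (\<lambda>fs. orient x \<tau> * time_at h \<tau> x fs) ` {fs. fs \<noteq> [] \<and> itinerary \<tau> fs \<and> reach h \<tau> x fs \<and> point_at h \<tau> x fs \<in> VR}"
    using oriented_line(1)[OF x \<tau>(1)] CT \<tau>(2) unfolding bij_betw_def by blast
  then obtain fs where fs: "fs \<noteq> []" "itinerary \<tau> fs" "reach h \<tau> x fs" "point_at h \<tau> x fs \<in> VR" "t = orient x \<tau> * time_at h \<tau> x fs" by blast
  obtain f' gs where fg: "fs = f' # gs" using fs(1) by (cases fs) auto
  obtain \<sigma> \<tau>' w where c: "\<gamma> x t = point_at h \<tau> x fs" "crosses_at n K (\<gamma> x) t f' \<sigma> \<tau>' (cosine h \<tau> fs) w"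
    using oriented_line(2)[OF x \<tau>(1) fs(2,3)[unfolded fg]] unfolding fs(5) fg by blast
  have "f' = f" using c(2) f(1) t(3) rel_interior_eq hinge_in unfolding crosses_at_def adjacent_at_def by metis
  then show ?thesis
    using fs c fg by (intro bexI[of _ "(\<tau>, fs)"]) (auto simp: itins_def starts_def simp del: point_at.simps reach.simps)
qed

lemma arrival_in_A:
  assumes i: "i \<in> itins" and x: "x \<in> starts i"
  shows "arrival i x \<in> A" "arrival i x \<in> rel_interior (final i)" "x \<in> rel_interior h"
proof -
  obtain \<tau> f fs where i': "i = (\<tau>, f # fs)" "itinerary \<tau> (f # fs)" "facet h \<tau>" "f \<in> H" by (rule itins_Cons[OF i])
  have r: "reach h \<tau> x (f # fs)" "point_at h \<tau> x (f # fs) \<in> VR" using x i' by (simp_all add: starts_def)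
  have "reach h \<tau> x []" using reach_append[of h \<tau> x "f # fs" "[]"] r(1) by simp
  then show xh: "x \<in> rel_interior h" by simp
  have "\<tau> = \<sigma>0 \<or> \<tau> = \<tau>0" using i'(2) by (auto simp: itinerary_def)
  from oriented_line(2)[OF xh this i'(2) r(1)] have "point_at h \<tau> x (f # fs) \<in> A"
    using line_in_A[OF xh] r(2) by metis
  then show "arrival i x \<in> A" using i' by simp
  show "arrival i x \<in> rel_interior (final i)" using r(1) i' by simp
qed

lemma starts_borel: "i \<in> itins \<Longrightarrow> starts i \<in> sets borel"
proof -
  assume i: "i \<in> itins"
  obtain \<tau> f fs where i': "i = (\<tau>, f # fs)" "facet h \<tau>" by (rule itins_Cons[OF i])
  have "starts i = {x. reach h \<tau> x (f # fs)} \<inter> ((\<lambda>x. point_at h \<tau> x (f # fs)) -` VR \<inter> space borel)"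
    using i' by (auto simp: starts_def)
  also have "\<dots> \<in> sets borel"
    using reach_borel measurable_sets[OF point_at_measurable VR_borel] by (rule sets.Int)
  finally show ?thesis .
qed

text \<open>With the continuous left inverse \<open>\<rho>\<close>, the image is the preimage of a
  Borel set under \<open>\<rho>\<close> intersected with the closed set on which
  \<open>arrival i\<close> undoes \<open>\<rho>\<close>.\<close>

lemma arrivals_borel:
  assumes i: "i \<in> itins"
  shows "arrival i ` starts i \<in> sets borel" "inj_on (arrival i) {x. \<exists>y\<in>h. x - y \<in> dirs h}"
proof -
  obtain \<tau> f fs where i': "i = (\<tau>, f # fs)" "facet h \<tau>" "admissible h \<tau> (f # fs)" by (rule itins_Cons[OF i])
  obtain y where y: "y \<in> h" using hinge_nonempty[OF h_hinge] by auto
  obtain \<rho> where \<rho>: "continuous_on UNIV \<rho>" "\<And>x. x - y \<in> dirs h \<Longrightarrow> \<rho> (arrival i x) = x"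
    using point_at_inverse[OF i'(2,3) y] i' by auto
  have xh: "x - y \<in> dirs h" if "x \<in> starts i" for x
  proof (rule diff_in_dirs[OF _ y])
    show "x \<in> h" using arrival_in_A(3)[OF i that] rel_interior_subset by blast
  qed
  have "x - y \<in> dirs h" if "y' \<in> h" "x - y' \<in> dirs h" for x y'
    using subspace_add[OF subspace_dirs that(2) diff_in_dirs[OF that(1) y]] by simp
  then show "inj_on (arrival i) {x. \<exists>y\<in>h. x - y \<in> dirs h}"
    by (intro inj_on_inverseI[where g = \<rho>] \<rho>(2)) blast
  have "arrival i ` starts i = \<rho> -` starts i \<inter> {z. arrival i (\<rho> z) = z}"
  proof (intro equalityI subsetI)
    fix z assume "z \<in> arrival i ` starts i"
    then show "z \<in> \<rho> -` starts i \<inter> {z. arrival i (\<rho> z) = z}" using \<rho>(2) xh by auto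
  next
    fix z assume "z \<in> \<rho> -` starts i \<inter> {z. arrival i (\<rho> z) = z}"
    then have "\<rho> z \<in> starts i" "z = arrival i (\<rho> z)" by auto
    then show "z \<in> arrival i ` starts i" by (rule rev_image_eqI)
  qed
  moreover have "\<rho> -` starts i \<in> sets borel"
    using measurable_sets[OF borel_measurable_continuous_onI[OF \<rho>(1)] starts_borel[OF i]] by simp
  moreover have "closed {z. arrival i (\<rho> z) = z}"
  proof (rule closed_Collect_eq)
    have "continuous_on UNIV (arrival i)" unfolding i'(1) fst_conv snd_conv by (rule point_at_continuous)
    then show "continuous_on UNIV (\<lambda>z. arrival i (\<rho> z))" by (rule continuous_on_compose2[OF _ \<rho>(1)]) simp
  qed simp
  ultimately show "arrival i ` starts i \<in> sets borel" by auto
qed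

text \<open>The arrival map is injective only on the affine hull of \<open>h\<close>, so the
  preimage of the image agrees with the original set almost everywhere and not everywhere.\<close>

lemma jacobian:
  assumes i: "i \<in> itins" and Y: "Y \<in> sets borel"
  shows "emeasure (flat_measure h) {x \<in> starts i. arrival i x \<in> Y} =
    ennreal (crossing_cos i) * emeasure (flat_measure (final i)) (arrival i ` starts i \<inter> Y)"
proof -
  obtain \<tau> f fs where i': "i = (\<tau>, f # fs)" "facet h \<tau>" "admissible h \<tau> (f # fs)" by (rule itins_Cons[OF i])
  obtain y where y: "y \<in> h" using hinge_nonempty[OF h_hinge] by auto
  let ?G = "arrival i ` starts i \<inter> Y"
  have G: "?G \<in> sets borel" using arrivals_borel(1)[OF i] Y by simp
  have m: "arrival i \<in> borel_measurable borel" unfolding i'(1) fst_conv snd_conv by (rule point_at_measurable)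
  have "emeasure (flat_measure h) (arrival i -` ?G) = ennreal (crossing_cos i) * emeasure (flat_measure (final i)) ?G"
    using point_at_jacobian[OF i'(2,3) G] i' by simp
  moreover have "emeasure (flat_measure h) {x \<in> starts i. arrival i x \<in> Y} = emeasure (flat_measure h) (arrival i -` ?G)"
  proof (rule emeasure_eq_AE)
    show "AE x in flat_measure h. (x \<in> {x \<in> starts i. arrival i x \<in> Y}) = (x \<in> arrival i -` ?G)"
      using AE_flat_measure[OF y]
    proof eventually_elim
      fix x assume x: "x - y \<in> dirs h"
      show "(x \<in> {x \<in> starts i. arrival i x \<in> Y}) = (x \<in> arrival i -` ?G)"
      proof
        assume "x \<in> arrival i -` ?G"
        then obtain x' where x': "x' \<in> starts i" "arrival i x = arrival i x'" "arrival i x \<in> Y" by auto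
        have "x' \<in> h" using arrival_in_A(3)[OF i x'(1)] rel_interior_subset by blast
        then have "x' - y \<in> dirs h" using diff_in_dirs y by blast
        then have "x = x'" using inj_onD[OF arrivals_borel(2)[OF i] x'(2)] x y by blast
        then show "x \<in> {x \<in> starts i. arrival i x \<in> Y}" using x' by simp
      qed auto
    qed
    have "arrival i -` Y \<in> sets borel" using measurable_sets[OF m Y] by simp
    then have "starts i \<inter> arrival i -` Y \<in> sets borel" using starts_borel[OF i] by (rule sets.Int[rotated])
    moreover have "{x \<in> starts i. arrival i x \<in> Y} = starts i \<inter> arrival i -` Y" by auto
    ultimately show "{x \<in> starts i. arrival i x \<in> Y} \<in> sets (flat_measure h)" by simp
    show "arrival i -` ?G \<in> sets (flat_measure h)" using measurable_sets[OF m G] by simp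
  qed
  ultimately show ?thesis by simp
qed

end

section \<open>The curvature integral\<close>

text \<open>The volume of a ball of radius \<open>\<bar>D\<bar> + 1\<close> around a point of the
  region, which contains the region. This radius is positive for every real
  \<open>D\<close>.\<close>

definition vol_const :: "nat \<Rightarrow> real \<Rightarrow> real" where
  "vol_const n D = unit_ball_vol (real (n - 1)) * (\<bar>D\<bar> + 1) ^ (n - 1)"

text \<open>The slab bound inside that ball, for the width from \<open>start_points_close\<close>
  without its factor \<open>e\<^sup>2\<close>.\<close>

definition slab_const :: "nat \<Rightarrow> nat \<Rightarrow> real \<Rightarrow> real" where
  "slab_const n N D = (2 * (\<bar>D\<bar> + 1)) ^ (n - 1 - 1) * (4 * \<bar>D\<bar> * direction_const N)"

definition angle_const :: "nat \<Rightarrow> real" where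
  "angle_const N = 2 * cosine_const N + (normal_const N + 1)"

definition count_const :: "nat \<Rightarrow> real" where
  "count_const N = real (2 * (\<Sum>k\<le>N. N ^ k))"

text \<open>Three sources of error: replacing each turning angle by a common cosine times the hinge
  angle; the case of a small cosine; and, for a larger cosine, replacing the Jacobians by a common
  one and neglecting overlaps.\<close>

definition hinge_const :: "nat \<Rightarrow> nat \<Rightarrow> real \<Rightarrow> real" where
  "hinge_const n N D = count_const N * (1 + angle_const N) * vol_const n D
     + (angle_const N + 2 * cosine_const N) * (count_const N + 1) * vol_const n D
     + (count_const N * (angle_const N * vol_const n D)
       + count_const N * (count_const N * (angle_const N * vol_const n D + slab_const n N D)))"

lemma const_nonneg: "0 \<le> vol_const n D" "0 \<le> slab_const n N D" "1 \<le> angle_const N" "0 \<le> count_const N"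
  using K_ge_1(1-3)[of N] by (simp_all add: vol_const_def slab_const_def angle_const_def count_const_def del: of_nat_sum)

context hinge_lines
begin

lemma crossing_cos_bounds: "i \<in> itins \<Longrightarrow> 0 < crossing_cos i \<and> crossing_cos i \<le> 1"
proof -
  assume i: "i \<in> itins"
  obtain \<tau> f fs where i': "i = (\<tau>, f # fs)" "facet h \<tau>" "admissible h \<tau> (f # fs)" by (rule itins_Cons[OF i])
  show ?thesis using admissible_invariants[OF i'(2,3)] cosine_le_1[OF i'(2,3)] i'(1) by simp
qed

lemma emeasure_in_A:
  assumes f: "f \<in> H" and X: "X \<subseteq> A"
  shows "emeasure (flat_measure f) X \<le> ennreal (vol_const n D)"
proof -
  obtain q where q: "q \<in> rel_interior f" "q \<in> A" using f by (auto simp: H hinges_meeting_def)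
  then have qf: "q \<in> f" using rel_interior_subset by blast
  have "X \<subseteq> cball q (\<bar>D\<bar> + 1)" using D_bound[OF q(2)] X by fastforce
  from emeasure_flat_measure_bounded[OF qf _ _ this]
  show ?thesis using dim_hinge[OF H_hinges[OF f]] by (simp add: vol_const_def subspace_0)
qed

lemma measure_in_A:
  assumes "f \<in> H" "X \<subseteq> A"
  shows "measure (flat_measure f) X \<le> vol_const n D" "X \<in> sets borel \<Longrightarrow> X \<in> fmeasurable (flat_measure f)"
  using emeasure_in_A[OF assms] const_nonneg(1)[of n D]
  by (auto simp: measure_def fmeasurable_def intro!: enn2real_leI intro: le_less_trans)

lemma starts_in_A: "i \<in> itins \<Longrightarrow> starts i \<subseteq> A"
  using arrival_in_A(3) ri_h by blast

lemma arrivals_in_A: "i \<in> itins \<Longrightarrow> arrival i ` starts i \<subseteq> A"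
  using arrival_in_A(1) by blast

lemma final_in_H: "i \<in> itins \<Longrightarrow> final i \<in> H"
  by (erule itins_Cons) simp

lemma measure_jacobian:
  assumes i: "i \<in> itins" and Y: "Y \<in> sets borel"
  shows "measure (flat_measure h) {x \<in> starts i. arrival i x \<in> Y} = crossing_cos i * measure (flat_measure (final i)) (arrival i ` starts i \<inter> Y)"
  unfolding measure_def jacobian[OF i Y] using crossing_cos_bounds[OF i] by (simp add: enn2real_mult)

lemma measure_starts:
  "i \<in> itins \<Longrightarrow> measure (flat_measure h) (starts i) = crossing_cos i * measure (flat_measure (final i)) (arrival i ` starts i)"
  using measure_jacobian[of i UNIV] by simp

lemma hinge_cover:
  assumes f: "f \<in> H" "f \<noteq> h"
  shows "rel_interior f \<inter> A = (\<Union>i\<in>{i \<in> itins. final i = f}. arrival i ` starts i)"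
proof (intro equalityI subsetI)
  fix y assume y: "y \<in> rel_interior f \<inter> A"
  then obtain x t where x: "x \<in> rel_interior h" "t \<in> I x" "y = \<gamma> x t" by (auto simp: A hinge_region_def)
  obtain i where "i \<in> itins" "final i = f" "x \<in> starts i" "arrival i x = y"
    using bounded_itinerary_of_crossing[OF x(1,2) _ _ H_hinges[OF f(1)] f(2)] y x(3) by blast
  then show "y \<in> (\<Union>i\<in>{i \<in> itins. final i = f}. arrival i ` starts i)" by blast
next
  fix y assume "y \<in> (\<Union>i\<in>{i \<in> itins. final i = f}. arrival i ` starts i)"
  then show "y \<in> rel_interior f \<inter> A" using arrival_in_A(1,2) by blast
qed

text \<open>By \<open>no_return\<close>; thus \<open>h\<close> contributes only its own crossing at
  time zero.\<close>

lemma starts_empty: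
  assumes i: "i \<in> itins" and h: "final i = h" shows "starts i = {}"
proof -
  obtain \<tau> f fs where i': "i = (\<tau>, f # fs)" "itinerary \<tau> (f # fs)" by (rule itins_Cons[OF i])
  have "\<not> reach h \<tau> x (f # fs)" for x
    using no_return[OF sides e_pos e_small(1) hH angles, of N \<tau> fs x] i' h e_small(2) by auto
  then show ?thesis using i' by (simp add: starts_def del: reach.simps)
qed

lemma crossing_cos_close:
  assumes "i \<in> itins" "j \<in> itins" "final i = final j"
  shows "\<bar>crossing_cos i - crossing_cos j\<bar> \<le> angle_const N * e\<^sup>2"
proof -
  obtain \<tau> f fs where i: "i = (\<tau>, f # fs)" "itinerary \<tau> (f # fs)" by (rule itins_Cons[OF assms(1)])
  obtain \<tau>' f' gs where j: "j = (\<tau>', f' # gs)" "itinerary \<tau>' (f' # gs)" by (rule itins_Cons[OF assms(2)])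
  have "f' = f" using assms(3) i j by simp
  then show ?thesis
    using cosine_close[OF sides e_pos e_small(1) hH angles i(2)] i(1) j by (simp add: angle_const_def del: direction.simps)
qed

text \<open>The bound \<open>big\<close> contradicts \<open>double_crossing\<close>, so the two
  convex sets of starting points are disjoint. A common arrival point then forces a start close to
  the other set, and the slab estimate applies.\<close>

lemma overlap_small:
  assumes i: "i \<in> itins" and j: "j \<in> itins" and ne: "i \<noteq> j" and f: "final i = final j" and big: "2 * cosine_const N * e\<^sup>2 < crossing_cos i"
  shows "measure (flat_measure h) {x \<in> starts i. arrival i x \<in> arrival j ` starts j} \<le> slab_const n N D * e\<^sup>2"
proof -
  obtain \<tau> f fs where i': "i = (\<tau>, f # fs)" "itinerary \<tau> (f # fs)" "facet h \<tau>" "f \<in> H" "facet f (side \<tau> fs)" "admissible h \<tau> (f # fs)"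
    by (rule itins_Cons[OF i])
  obtain \<tau>' f' gs where j': "j = (\<tau>', f' # gs)" "itinerary \<tau>' (f' # gs)" "facet h \<tau>'" "f' \<in> H" "facet f' (side \<tau>' gs)" "admissible h \<tau>' (f' # gs)"
    by (rule itins_Cons[OF j])
  have ff: "f' = f" using assms(4) i' j' by simp
  note ctx = sides e_pos e_small(1) hH angles
  let ?U = "{x. reach h \<tau> x (f # fs)}" and ?U' = "{x. reach h \<tau>' x (f' # gs)}"
  let ?X = "{x \<in> starts i. arrival i x \<in> arrival j ` starts j}"
  obtain q where q: "q \<in> rel_interior h" using ri_hinge_nonempty[OF h_hinge] by auto
  have Uh: "?U \<subseteq> h" "?U' \<subseteq> h"
    using reach_append[of h \<tau> _ "f # fs" "[]"] reach_append[of h \<tau>' _ "f' # gs" "[]"] rel_interior_subset[of h] by auto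
  have disj: "?U \<inter> ?U' = {}"
  proof (rule ccontr)
    assume "?U \<inter> ?U' \<noteq> {}"
    then obtain x where x: "reach h \<tau> x (f # fs)" "reach h \<tau>' x (f # gs)" using ff by blast
    have "crossing_cos i \<le> 2 * cosine_const N * e\<^sup>2"
      using double_crossing[OF ctx i'(2) j'(2)[unfolded ff] x] ne i' j' ff by simp
    then show False using big by simp
  qed
  have X: "x \<in> ?U \<and> (\<exists>x'\<in>?U'. norm (x - x') \<le> 4 * \<bar>D\<bar> * direction_const N * e\<^sup>2)" if x: "x \<in> ?X" for x
  proof -
    obtain x' where x': "x \<in> starts i" "x' \<in> starts j" "arrival i x = arrival j x'" using x by blast
    have r: "reach h \<tau> x (f # fs)" "reach h \<tau>' x' (f' # gs)" using x' i' j' by (simp_all add: starts_def)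
    have "arrival i x \<in> A" "x \<in> A" "x' \<in> A" using arrival_in_A(1)[OF i x'(1)] starts_in_A i j x' by blast+
    then have "norm (arrival i x - x) \<le> \<bar>D\<bar>" "norm (arrival i x - x') \<le> \<bar>D\<bar>"
      using D_bound[of "arrival i x" x] D_bound[of "arrival i x" x'] by (simp_all add: dist_norm)
    then have "norm (x - x') \<le> 4 * \<bar>D\<bar> * direction_const N * e\<^sup>2"
      using start_points_close[OF ctx i'(2) j'(2) r _ _ _ e_small(3)] x'(3) i'(1) j'(1) by simp
    then show ?thesis using r by blast
  qed
  have "?X \<subseteq> cball q (\<bar>D\<bar> + 1)"
  proof
    fix x assume "x \<in> ?X"
    then have "x \<in> A" using starts_in_A[OF i] by blast
    then show "x \<in> cball q (\<bar>D\<bar> + 1)" using D_bound[of q x] q ri_h by fastforce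
  qed
  have qh: "q \<in> h" using q rel_interior_subset by blast
  have nn: "0 \<le> 4 * \<bar>D\<bar> * direction_const N * e\<^sup>2" using K_ge_1(2)[of N] by simp
  have r0: "0 < \<bar>D\<bar> + 1" by simp
  have "emeasure (flat_measure h) ?X \<le> ennreal ((2 * (\<bar>D\<bar> + 1)) ^ (dim (dirs h) - 1) * (4 * \<bar>D\<bar> * direction_const N * e\<^sup>2))"
    by (rule emeasure_near_disjoint_convex[OF qh r0 nn reach_convex[OF i'(3,6)] reach_convex[OF j'(3,6)] disj Uh \<open>?X \<subseteq> cball q (\<bar>D\<bar> + 1)\<close> X])
  also have "(2 * (\<bar>D\<bar> + 1)) ^ (dim (dirs h) - 1) * (4 * \<bar>D\<bar> * direction_const N * e\<^sup>2) = slab_const n N D * e\<^sup>2"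
    using dim_hinge[OF h_hinge] by (simp add: slab_const_def)
  finally show ?thesis
    unfolding measure_def using const_nonneg(2)[of n N D] by (intro enn2real_leI) auto
qed

section \<open>The error estimate and its summation\<close>

text \<open>The arbitrary itinerary \<open>k\<close> supplies the reference cosine
  \<open>\<kappa>\<close>. The sum is first compared with \<open>\<kappa> * \<epsilon>\<close> times
  the total volume of the starting sets, and that volume with \<open>\<kappa>\<close> times the
  volume \<open>W\<close> of the crossing points.\<close>

lemma hinge_contribution:
  assumes f: "f \<in> H" "f \<noteq> h" and k: "k \<in> itins" "final k = f"
  shows "\<bar>(\<Sum>i\<in>{i \<in> itins. final i = f}. bend i * measure (flat_measure h) (starts i))
      - measure (flat_measure f) (rel_interior f \<inter> A) * (crossing_cos k)\<^sup>2 * hinge_angle n K \<nu> f\<bar> \<le> hinge_const n N D * e ^ 3"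
proof -
  let ?J = "{i \<in> itins. final i = f}"
  let ?m = "\<lambda>i. measure (flat_measure h) (starts i)" and ?G = "\<lambda>i. arrival i ` starts i" and ?\<mu> = "measure (flat_measure f)"
  let ?\<epsilon> = "hinge_angle n K \<nu> f"
  define \<kappa> where "\<kappa> = crossing_cos k"
  define M where "M = vol_const n D"
  define a where "a = angle_const N"
  define C where "C = count_const N"
  define S where "S = slab_const n N D"
  define W where "W = ?\<mu> (rel_interior f \<inter> A)"
  note cst = const_nonneg(1)[of n D, folded M_def] const_nonneg(2)[of n N D, folded S_def] const_nonneg(3)[of N, folded a_def] const_nonneg(4)[of N, folded C_def]
  have \<kappa>: "0 < \<kappa>" "\<kappa> \<le> 1" using crossing_cos_bounds[OF k(1)] by (auto simp: \<kappa>_def)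
  have finJ: "finite ?J" using finite_itins(1) by simp
  have cJ: "real (card ?J) \<le> C"
  proof -
    have "card ?J \<le> card itins" using finite_itins(1) by (intro card_mono) auto
    then have "card ?J \<le> 2 * (\<Sum>k\<le>N. N ^ k)" using finite_itins(2) by linarith
    then show ?thesis unfolding C_def count_const_def by (rule of_nat_mono)
  qed
  have sumC: "(\<Sum>i\<in>?J. F i) \<le> C * B" if "\<And>i. i \<in> ?J \<Longrightarrow> F i \<le> B" "0 \<le> B" for F and B :: real
  proof -
    have "(\<Sum>i\<in>?J. F i) \<le> real (card ?J) * B" using that(1) by (rule sum_bounded_above)
    also have "\<dots> \<le> C * B" using cJ that(2) by (rule mult_right_mono)
    finally show ?thesis .
  qed
  have W: "0 \<le> W" "W \<le> M" unfolding W_def M_def using measure_in_A(1)[OF f(1)] by auto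
  have m: "0 \<le> ?m i" "?m i \<le> M" if "i \<in> ?J" for i
    unfolding M_def using measure_in_A(1)[OF hH starts_in_A] that by auto
  have eps: "\<bar>?\<epsilon>\<bar> \<le> e" using angles f(1) by blast
  have e1: "e ^ 2 * e = e ^ 3" "e * e ^ 2 = e ^ 3" by (simp_all add: power2_eq_square power3_eq_cube)
  have clo: "\<bar>crossing_cos i - \<kappa>\<bar> \<le> a * e\<^sup>2" if "i \<in> ?J" for i
    using crossing_cos_close[of i k] that k unfolding \<kappa>_def a_def by simp
  \<comment> \<open>The linear approximation of \<open>turn\<close> costs \<open>e ^ 3\<close>;
    exchanging the cosine for \<open>\<kappa>\<close> costs O(e^2), multiplied by the hinge
    angle.\<close>
  have T1: "\<bar>(\<Sum>i\<in>?J. bend i * ?m i) - \<kappa> * ?\<epsilon> * (\<Sum>i\<in>?J. ?m i)\<bar> \<le> C * (((1 + a) * M) * e ^ 3)"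
  proof -
    have eq: "(\<Sum>i\<in>?J. bend i * ?m i) - \<kappa> * ?\<epsilon> * (\<Sum>i\<in>?J. ?m i) = (\<Sum>i\<in>?J. (bend i - \<kappa> * ?\<epsilon>) * ?m i)"
      by (simp add: sum_distrib_left sum_subtractf left_diff_distrib)
    have "(\<Sum>i\<in>?J. \<bar>(bend i - \<kappa> * ?\<epsilon>) * ?m i\<bar>) \<le> C * (((1 + a) * M) * e ^ 3)"
    proof (rule sumC)
      fix i assume i: "i \<in> ?J"
      have "\<bar>bend i - crossing_cos i * ?\<epsilon>\<bar> \<le> \<bar>?\<epsilon>\<bar> ^ 3"
        using turn_approx[of "crossing_cos i" ?\<epsilon>] crossing_cos_bounds[of i] i eps e_small(1) by auto
      also have "\<dots> \<le> e ^ 3" using eps by (intro power_mono) auto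
      finally have 1: "\<bar>bend i - crossing_cos i * ?\<epsilon>\<bar> \<le> e ^ 3" .
      have "\<bar>crossing_cos i * ?\<epsilon> - \<kappa> * ?\<epsilon>\<bar> = \<bar>crossing_cos i - \<kappa>\<bar> * \<bar>?\<epsilon>\<bar>" by (simp only: left_diff_distrib[symmetric] abs_mult)
      also have "\<dots> \<le> (a * e\<^sup>2) * e" using clo[OF i] eps cst(3) by (intro mult_mono) auto
      also have "\<dots> = a * e ^ 3" using e1 by simp
      finally have "\<bar>bend i - \<kappa> * ?\<epsilon>\<bar> \<le> e ^ 3 + a * e ^ 3" using 1 by linarith
      then have "\<bar>bend i - \<kappa> * ?\<epsilon>\<bar> * \<bar>?m i\<bar> \<le> (e ^ 3 + a * e ^ 3) * M"
        using m[OF i] cst(3) e_pos by (intro mult_mono) auto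
      then show "\<bar>(bend i - \<kappa> * ?\<epsilon>) * ?m i\<bar> \<le> ((1 + a) * M) * e ^ 3"
        unfolding abs_mult by (simp add: algebra_simps)
    qed (use cst e_pos in simp)
    then show ?thesis unfolding eq by (rule order_trans[OF sum_abs])
  qed
  have mM: "(\<Sum>i\<in>?J. ?m i) \<le> C * M" "0 \<le> (\<Sum>i\<in>?J. ?m i)"
    using sumC[of ?m M] m cst by (auto intro: sum_nonneg)
  have T2: "\<bar>\<kappa> * ?\<epsilon> * (\<Sum>i\<in>?J. ?m i) - W * \<kappa>\<^sup>2 * ?\<epsilon>\<bar>
      \<le> (a + 2 * cosine_const N) * (C + 1) * M * e ^ 3 + (C * (a * M) + C * (C * (a * M + S))) * e ^ 3"
  \<comment> \<open>The threshold leaves room for the difference \<open>a * e\<^sup>2\<close>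
    between cosines: above it, every itinerary ending at \<open>f\<close> has a cosine larger than
    \<open>2 * cosine_const N * e\<^sup>2\<close>, as \<open>overlap_small\<close> demands.\<close>
  proof (cases "\<kappa> \<le> (a + 2 * cosine_const N) * e\<^sup>2")
    case True
    have eq: "\<kappa> * ?\<epsilon> * (\<Sum>i\<in>?J. ?m i) - W * \<kappa>\<^sup>2 * ?\<epsilon> = (\<kappa> * ?\<epsilon>) * ((\<Sum>i\<in>?J. ?m i) - W * \<kappa>)"
      by (simp add: power2_eq_square algebra_simps)
    have abs_eq: "\<bar>\<kappa> * ?\<epsilon> * (\<Sum>i\<in>?J. ?m i) - W * \<kappa>\<^sup>2 * ?\<epsilon>\<bar> = (\<kappa> * \<bar>?\<epsilon>\<bar>) * \<bar>(\<Sum>i\<in>?J. ?m i) - W * \<kappa>\<bar>"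
      unfolding eq using \<kappa> by (simp add: abs_mult)
    \<comment> \<open>Below the threshold \<open>\<kappa> * \<bar>\<epsilon>\<bar>\<close> is
      already cubic, so a crude bound on the other factor is enough.\<close>
    have "(\<kappa> * \<bar>?\<epsilon>\<bar>) * \<bar>(\<Sum>i\<in>?J. ?m i) - W * \<kappa>\<bar> \<le> (((a + 2 * cosine_const N) * e\<^sup>2) * e) * (C * M + M)"
    proof (rule mult_mono)
      show "\<kappa> * \<bar>?\<epsilon>\<bar> \<le> ((a + 2 * cosine_const N) * e\<^sup>2) * e" using True eps \<kappa> by (intro mult_mono) auto
      have "0 \<le> W * \<kappa>" "W * \<kappa> \<le> M * 1" using W \<kappa> cst mult_mono[of W M \<kappa> 1] by auto
      then show "\<bar>(\<Sum>i\<in>?J. ?m i) - W * \<kappa>\<bar> \<le> C * M + M" using mM cst by (simp add: abs_le_iff)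
      show "0 \<le> (a + 2 * cosine_const N) * e\<^sup>2 * e" using True \<kappa> e_pos by simp
    qed simp
    also have "\<dots> = (a + 2 * cosine_const N) * (C + 1) * M * (e\<^sup>2 * e)" by (simp add: algebra_simps)
    also have "\<dots> = (a + 2 * cosine_const N) * (C + 1) * M * e ^ 3" unfolding e1 ..
    also have "\<dots> \<le> (a + 2 * cosine_const N) * (C + 1) * M * e ^ 3 + (C * (a * M) + C * (C * (a * M + S))) * e ^ 3"
      using cst e_pos by simp
    finally show ?thesis unfolding abs_eq .
  next
    case False
    have big: "2 * cosine_const N * e\<^sup>2 < crossing_cos i" if "i \<in> ?J" for i
      using clo[OF that] False by (simp add: distrib_right)
    have Gb: "?G i \<in> sets borel" if "i \<in> ?J" for i using arrivals_borel(1) that by simp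
    have GA: "?G i \<subseteq> A" if "i \<in> ?J" for i using arrivals_in_A that by simp
    have Gf: "?G i \<in> fmeasurable (flat_measure f)" if "i \<in> ?J" for i
      using measure_in_A(2)[OF f(1) GA[OF that] Gb[OF that]] .
    have close: "\<bar>?m i - \<kappa> * ?\<mu> (?G i)\<bar> \<le> a * M * e\<^sup>2" if i: "i \<in> ?J" for i
    proof -
      have "?m i = crossing_cos i * ?\<mu> (?G i)" using measure_starts i by simp
      then have "\<bar>?m i - \<kappa> * ?\<mu> (?G i)\<bar> = \<bar>crossing_cos i - \<kappa>\<bar> * ?\<mu> (?G i)" by (simp add: abs_mult flip: left_diff_distrib)
      also have "\<dots> \<le> (a * e\<^sup>2) * M"
        using clo[OF i] measure_in_A(1)[OF f(1) GA[OF i]] cst unfolding M_def by (intro mult_mono) auto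
      finally show ?thesis by (simp add: mult_ac)
    qed
    \<comment> \<open>The Jacobian turns \<open>crossing_cos i\<close> times the overlap in
      \<open>f\<close> into a set of starting points. The volume of the overlap itself is not
      bounded, since that would require dividing by a possibly small cosine.\<close>
    have pair: "\<kappa> * ?\<mu> (?G i \<inter> ?G j) \<le> (a * M + S) * e\<^sup>2" if i: "i \<in> ?J" and j: "j \<in> ?J - {i}" for i j
    proof -
      have ij: "i \<in> itins" "final i = f" "j \<in> itins" "final j = f" "i \<noteq> j" using i j by auto
      have "crossing_cos i * ?\<mu> (?G i \<inter> ?G j) = measure (flat_measure h) {x \<in> starts i. arrival i x \<in> ?G j}"
        using measure_jacobian[OF ij(1) arrivals_borel(1)[OF ij(3)]] ij(2) by simp
      also have "\<dots> \<le> S * e\<^sup>2"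
        unfolding S_def using overlap_small[OF ij(1,3,5) _ big[OF i]] ij(2,4) by simp
      finally have 1: "crossing_cos i * ?\<mu> (?G i \<inter> ?G j) \<le> S * e\<^sup>2" .
      have "(\<kappa> - crossing_cos i) * ?\<mu> (?G i \<inter> ?G j) \<le> (a * e\<^sup>2) * M"
      proof (rule mult_mono)
        show "\<kappa> - crossing_cos i \<le> a * e\<^sup>2" using clo[OF i] by linarith
        show "?\<mu> (?G i \<inter> ?G j) \<le> M" unfolding M_def using GA[OF i] by (intro measure_in_A(1)[OF f(1)]) auto
      qed (use cst in auto)
      then show ?thesis using 1 by (simp add: algebra_simps)
    qed
    have Wu: "W = ?\<mu> (\<Union>i\<in>?J. ?G i)" unfolding W_def hinge_cover[OF f] ..
    have up: "W \<le> (\<Sum>i\<in>?J. ?\<mu> (?G i))"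
      unfolding Wu using finJ Gb by (intro measure_UNION_le) auto
    have lo: "(\<Sum>i\<in>?J. ?\<mu> (?G i)) \<le> W + (\<Sum>i\<in>?J. \<Sum>j\<in>?J - {i}. ?\<mu> (?G i \<inter> ?G j))"
      unfolding Wu by (rule sum_measure_le_Union[OF finJ Gf])
    have lo': "\<kappa> * (\<Sum>i\<in>?J. ?\<mu> (?G i)) - \<kappa> * W \<le> C * (C * ((a * M + S) * e\<^sup>2))"
    proof -
      have "\<kappa> * (\<Sum>i\<in>?J. ?\<mu> (?G i)) - \<kappa> * W \<le> \<kappa> * (\<Sum>i\<in>?J. \<Sum>j\<in>?J - {i}. ?\<mu> (?G i \<inter> ?G j))"
        using mult_left_mono[OF lo, of \<kappa>] \<kappa> by (simp add: distrib_left)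
      also have "\<dots> = (\<Sum>i\<in>?J. \<Sum>j\<in>?J - {i}. \<kappa> * ?\<mu> (?G i \<inter> ?G j))" by (simp add: sum_distrib_left)
      also have "\<dots> \<le> C * (C * ((a * M + S) * e\<^sup>2))"
      proof (rule sumC)
        fix i assume i: "i \<in> ?J"
        have "(\<Sum>j\<in>?J - {i}. \<kappa> * ?\<mu> (?G i \<inter> ?G j)) \<le> real (card (?J - {i})) * ((a * M + S) * e\<^sup>2)"
          using pair[OF i] by (rule sum_bounded_above)
        also have "\<dots> \<le> C * ((a * M + S) * e\<^sup>2)"
        proof (rule mult_right_mono)
          have "card (?J - {i}) \<le> card ?J" using finJ by (intro card_mono) auto
          then show "real (card (?J - {i})) \<le> C" using cJ by linarith
        qed (use cst in simp)
        finally show "(\<Sum>j\<in>?J - {i}. \<kappa> * ?\<mu> (?G i \<inter> ?G j)) \<le> C * ((a * M + S) * e\<^sup>2)" .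
      qed (use cst in simp)
      finally show ?thesis .
    qed
    have eq: "(\<Sum>i\<in>?J. ?m i) - \<kappa> * (\<Sum>i\<in>?J. ?\<mu> (?G i)) = (\<Sum>i\<in>?J. ?m i - \<kappa> * ?\<mu> (?G i))"
      by (simp add: sum_subtractf sum_distrib_left)
    have "(\<Sum>i\<in>?J. \<bar>?m i - \<kappa> * ?\<mu> (?G i)\<bar>) \<le> C * (a * M * e\<^sup>2)" using close cst by (intro sumC) auto
    then have d1: "\<bar>(\<Sum>i\<in>?J. ?m i) - \<kappa> * (\<Sum>i\<in>?J. ?\<mu> (?G i))\<bar> \<le> C * (a * M * e\<^sup>2)"
      unfolding eq by (rule order_trans[OF sum_abs])
    \<comment> \<open>Subadditivity gives one side of the comparison with \<open>W\<close>; the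
      Bonferroni bound \<open>lo'\<close> gives the other.\<close>
    have "0 \<le> \<kappa> * (\<Sum>i\<in>?J. ?\<mu> (?G i)) - \<kappa> * W" using mult_left_mono[OF up, of \<kappa>] \<kappa> by simp
    then have d: "\<bar>(\<Sum>i\<in>?J. ?m i) - \<kappa> * W\<bar> \<le> C * (a * M * e\<^sup>2) + C * (C * ((a * M + S) * e\<^sup>2))"
      using d1 lo' by linarith
    have eq: "\<kappa> * ?\<epsilon> * (\<Sum>i\<in>?J. ?m i) - W * \<kappa>\<^sup>2 * ?\<epsilon> = (\<kappa> * ?\<epsilon>) * ((\<Sum>i\<in>?J. ?m i) - \<kappa> * W)"
      by (simp add: power2_eq_square algebra_simps)
    have abs_eq: "\<bar>\<kappa> * ?\<epsilon> * (\<Sum>i\<in>?J. ?m i) - W * \<kappa>\<^sup>2 * ?\<epsilon>\<bar> = (\<kappa> * \<bar>?\<epsilon>\<bar>) * \<bar>(\<Sum>i\<in>?J. ?m i) - \<kappa> * W\<bar>"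
      unfolding eq using \<kappa> by (simp add: abs_mult)
    have "(\<kappa> * \<bar>?\<epsilon>\<bar>) * \<bar>(\<Sum>i\<in>?J. ?m i) - \<kappa> * W\<bar> \<le> (1 * e) * (C * (a * M * e\<^sup>2) + C * (C * ((a * M + S) * e\<^sup>2)))"
      using d \<kappa> eps e_pos by (intro mult_mono) auto
    also have "\<dots> = (C * (a * M) + C * (C * (a * M + S))) * (e * e\<^sup>2)" by (simp add: algebra_simps)
    also have "\<dots> = (C * (a * M) + C * (C * (a * M + S))) * e ^ 3" unfolding e1 ..
    also have "\<dots> \<le> (a + 2 * cosine_const N) * (C + 1) * M * e ^ 3 + (C * (a * M) + C * (C * (a * M + S))) * e ^ 3"
      using cst e_pos K_ge_1(3)[of N] by simp
    finally show ?thesis unfolding abs_eq .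
  qed
  have "hinge_const n N D * e ^ 3 = C * (((1 + a) * M) * e ^ 3) +
      ((a + 2 * cosine_const N) * (C + 1) * M * e ^ 3 + (C * (a * M) + C * (C * (a * M + S))) * e ^ 3)"
    by (simp add: hinge_const_def M_def a_def C_def S_def algebra_simps)
  then show ?thesis using T1 T2 unfolding W_def[symmetric] \<kappa>_def[symmetric] by linarith
qed

lemma integral_segment_curvature:
  "(LINT x:rel_interior h|flat_measure h. segment_curvature n K \<nu> A (\<gamma> x) (I x)) =
    measure (flat_measure h) (rel_interior h) * hinge_angle n K \<nu> h + (\<Sum>i\<in>itins. bend i * measure (flat_measure h) (starts i))"
proof -
  let ?\<mu> = "flat_measure h"
  have fin: "X \<in> sets ?\<mu> \<and> emeasure ?\<mu> X < \<infinity>" if "X \<in> sets borel" "X \<subseteq> A" for X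
    using measure_in_A(2)[OF hH that(2,1)] by (simp add: fmeasurable_def)
  have hf: "integrable ?\<mu> (indicat_real (rel_interior h))"
    using fin[OF rel_interior_borel ri_h] by simp
  have sf: "integrable ?\<mu> (indicat_real (starts i))" if "i \<in> itins" for i
    using fin[OF starts_borel[OF that] starts_in_A[OF that]] by simp
  have "(LINT x:rel_interior h|?\<mu>. segment_curvature n K \<nu> A (\<gamma> x) (I x)) =
      (LINT x|?\<mu>. indicat_real (rel_interior h) x * hinge_angle n K \<nu> h + (\<Sum>i\<in>itins. indicat_real (starts i) x * bend i))"
    unfolding set_lebesgue_integral_def
  proof (rule Bochner_Integration.integral_cong[OF refl])
    fix x
    show "indicat_real (rel_interior h) x *\<^sub>R segment_curvature n K \<nu> A (\<gamma> x) (I x) =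
      indicat_real (rel_interior h) x * hinge_angle n K \<nu> h + (\<Sum>i\<in>itins. indicat_real (starts i) x * bend i)"
    proof (cases "x \<in> rel_interior h")
      case True
      then show ?thesis using segment_curvature_itins[OF True] by simp
    next
      case False
      then have "x \<notin> starts i" if "i \<in> itins" for i using arrival_in_A(3)[OF that] by blast
      then show ?thesis using False by simp
    qed
  qed
  also have "\<dots> = (LINT x|?\<mu>. indicat_real (rel_interior h) x * hinge_angle n K \<nu> h) + (LINT x|?\<mu>. (\<Sum>i\<in>itins. indicat_real (starts i) x * bend i))"
    using hf sf by (intro Bochner_Integration.integral_add integrable_sum integrable_mult_left) auto
  also have "(LINT x|?\<mu>. (\<Sum>i\<in>itins. indicat_real (starts i) x * bend i)) = (\<Sum>i\<in>itins. LINT x|?\<mu>. indicat_real (starts i) x * bend i)"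
    using sf by (intro Bochner_Integration.integral_sum integrable_mult_left)
  finally show ?thesis by (simp add: mult.commute)
qed

text \<open>Lets the prescribed angle provide the reference itinerary of
  \<open>hinge_contribution\<close>. Speed and hinge at a crossing are determined by the path, so
  the cosine of the itinerary is the speed \<open>c\<close> of the given crossing.\<close>

lemma crossing_angle_itin:
  assumes f: "f \<in> H" "f \<noteq> h" and c: "crossing_angle n K V h \<gamma> I f \<theta>"
  obtains k where "k \<in> itins" "final k = f" "crossing_cos k = cos \<theta>"
proof -
  obtain x t \<sigma> \<tau> c w where x: "x \<in> rel_interior h" "t \<in> I x" "\<gamma> x t \<in> A" and cr: "crosses_at n K (\<gamma> x) t f \<sigma> \<tau> c w"
    and \<theta>: "\<theta> = vangle (vector_derivative (\<gamma> x) (at_left t)) (- conormal \<sigma> f)"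
    using c unfolding crossing_angle_def A by blast
  have cf: "0 < c" "w \<in> dirs f" "c\<^sup>2 + (norm w)\<^sup>2 = 1" "\<gamma> x t \<in> rel_interior f" "facet f \<sigma>"
    using cr by (auto simp: crosses_at_def adjacent_at_def)
  have wm: "w \<bullet> conormal \<sigma> f = 0" "conormal \<sigma> f \<bullet> conormal \<sigma> f = 1" using conormal(3)[OF cf(5,2)] conormal_self[OF cf(5)] by auto
  have "w \<bullet> w = 1 - c\<^sup>2" using cf(3) by (simp add: power2_norm_eq_inner)
  then have n1: "norm (w - c *\<^sub>R conormal \<sigma> f) = 1"
    unfolding norm_eq_1 using wm by (simp add: inner_diff_left inner_diff_right inner_commute power2_eq_square)
  have "c\<^sup>2 \<le> 1\<^sup>2" unfolding one_power2 using cf(3) zero_le_power2[of "norm w"] by linarith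
  then have c1: "c \<le> 1" using power2_le_imp_le[of c 1] by simp
  have "\<theta> = arccos c"
    unfolding \<theta> vector_derivative_velocity(2)[OF crosses_velocity(1)[OF cr]] vangle_def
    using n1 wm conormal(1)[OF cf(5)] by (simp add: inner_diff_left)
  then have "cos \<theta> = c" using cf(1) c1 by simp
  moreover obtain k \<sigma>' \<tau>' w' where k: "k \<in> itins" "final k = f" "crosses_at n K (\<gamma> x) t f \<sigma>' \<tau>' (crossing_cos k) w'"
    using bounded_itinerary_of_crossing[OF x cf(4) H_hinges[OF f(1)] f(2)] by blast
  moreover have "crossing_cos k = c" using crossing_unique(2)[OF cr k(3)] .
  ultimately show thesis using that by simp
qed

text \<open>The itineraries are grouped by their last hinge. Those ending at \<open>h\<close> have
  no starting points, and at most \<open>N\<close> hinges remain.\<close>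

lemma integral_estimate:
  assumes \<theta>: "\<And>f. f \<in> H - {h} \<Longrightarrow> crossing_angle n K V h \<gamma> I f (\<theta> f)"
  shows "\<bar>(LINT x:rel_interior h|flat_measure h. segment_curvature n K \<nu> A (\<gamma> x) (I x))
      - (measure (flat_measure h) (rel_interior h) * hinge_angle n K \<nu> h
        + (\<Sum>f\<in>H - {h}. measure (flat_measure f) (rel_interior f \<inter> A) * (cos (\<theta> f))\<^sup>2 * hinge_angle n K \<nu> f))\<bar>
    \<le> real N * hinge_const n N D * e ^ 3"
proof -
  let ?m = "\<lambda>i. measure (flat_measure h) (starts i)"
  let ?T = "\<lambda>f. measure (flat_measure f) (rel_interior f \<inter> A) * (cos (\<theta> f))\<^sup>2 * hinge_angle n K \<nu> f"
  have "(\<Sum>i\<in>itins. bend i * ?m i) = (\<Sum>f\<in>H. \<Sum>i\<in>{i \<in> itins. final i = f}. bend i * ?m i)"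
    using final_in_H by (intro sum.group[symmetric] finite_itins(1) finite_H(1)) auto
  also have "\<dots> = (\<Sum>i\<in>{i \<in> itins. final i = h}. bend i * ?m i) + (\<Sum>f\<in>H - {h}. \<Sum>i\<in>{i \<in> itins. final i = f}. bend i * ?m i)"
    by (rule sum.remove[OF finite_H(1) hH])
  also have "(\<Sum>i\<in>{i \<in> itins. final i = h}. bend i * ?m i) = 0"
    using starts_empty by (intro sum.neutral) auto
  finally have "\<bar>(LINT x:rel_interior h|flat_measure h. segment_curvature n K \<nu> A (\<gamma> x) (I x))
      - (measure (flat_measure h) (rel_interior h) * hinge_angle n K \<nu> h + (\<Sum>f\<in>H - {h}. ?T f))\<bar>
    = \<bar>\<Sum>f\<in>H - {h}. (\<Sum>i\<in>{i \<in> itins. final i = f}. bend i * ?m i) - ?T f\<bar>"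
    unfolding integral_segment_curvature by (simp add: sum_subtractf)
  also have "\<dots> \<le> (\<Sum>f\<in>H - {h}. \<bar>(\<Sum>i\<in>{i \<in> itins. final i = f}. bend i * ?m i) - ?T f\<bar>)" by (rule sum_abs)
  also have "\<dots> \<le> real (card (H - {h})) * (hinge_const n N D * e ^ 3)"
  proof (rule sum_bounded_above)
    fix f assume f: "f \<in> H - {h}"
    obtain k where "k \<in> itins" "final k = f" "crossing_cos k = cos (\<theta> f)"
      using crossing_angle_itin[OF _ _ \<theta>[OF f]] f by auto
    then show "\<bar>(\<Sum>i\<in>{i \<in> itins. final i = f}. bend i * ?m i) - ?T f\<bar> \<le> hinge_const n N D * e ^ 3"
      using hinge_contribution[of f k] f by simp
  qed
  also have "\<dots> \<le> real N * (hinge_const n N D * e ^ 3)"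
  proof (rule mult_right_mono)
    have "card (H - {h}) \<le> card H" using finite_H(1) by (intro card_mono) auto
    then show "real (card (H - {h})) \<le> real N" using finite_H(2) by linarith
    have "0 \<le> hinge_const n N D"
      unfolding hinge_const_def using const_nonneg(1)[of n D] const_nonneg(2)[of n N D] const_nonneg(3,4)[of N] K_ge_1(3)[of N]
      by (intro add_nonneg_nonneg mult_nonneg_nonneg) auto
    then show "0 \<le> hinge_const n N D * e ^ 3" using e_pos by simp
  qed
  finally show ?thesis by (simp add: mult.assoc)
qed

end

theorem theorem12:
  fixes n N :: nat and D :: real
  assumes "DIM('a::euclidean_space) = n + 1" and "1 \<le> n"
  shows "\<exists>C \<delta>. 0 < \<delta> \<and>
    (\<forall>(K :: 'a set set) \<nu> V h \<gamma> I \<theta> A \<epsilon>max.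
       piecewise_flat_manifold n K \<longrightarrow>
       positive_normals n K \<nu> \<longrightarrow>
       dual_tessellation n K V \<longrightarrow>
       h \<in> hinges n K \<longrightarrow>
       orthogonal_lines n K V h \<gamma> I \<longrightarrow>
       A = hinge_region K V h \<gamma> I \<longrightarrow>
       region_bounded_by n K A h \<gamma> I N D \<longrightarrow>
       (\<forall>f \<in> hinges_meeting n K A - {h}. crossing_angle n K V h \<gamma> I f (\<theta> f)) \<longrightarrow>
       (\<forall>f \<in> hinges_meeting n K A. \<bar>hinge_angle n K \<nu> f\<bar> \<le> \<epsilon>max) \<longrightarrow>
       \<epsilon>max < \<delta> \<longrightarrow>
       (\<exists>R. \<bar>R\<bar> \<le> C * \<epsilon>max ^ 3 \<and>
          average_curvature n K \<nu> V h \<gamma> I =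
            1 / enn2real (surface_volume n K A) *
              (measure (flat_measure h) (rel_interior h) * hinge_angle n K \<nu> h
               + (\<Sum>f \<in> hinges_meeting n K A - {h}.
                    measure (flat_measure f) (rel_interior f \<inter> A)
                      * (cos (\<theta> f))\<^sup>2 * hinge_angle n K \<nu> f)
               + R)))"
proof (rule exI[of _ "real N * hinge_const n N D"], rule exI[of _ "1 / (2 * cosine_const N)"], intro conjI allI impI)
  \<comment> \<open>These inequalities let the single bound \<open>1 / (2 * cosine_const N)\<close>
    on \<open>e\<close> imply all three conditions in \<open>e_small\<close>; the factor 2 is the
    one in the third of them.\<close>
  have cosine_const: "1 \<le> cosine_const N" "1 \<le> direction_const N" "direction_const N \<le> cosine_const N"
    using K_ge_1[of N] by (auto simp: cosine_const_def)
  show "0 < 1 / (2 * cosine_const N)" using cosine_const by simp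
  fix K :: "'a set set" and \<nu> V h \<gamma> I \<theta> A and e :: real
  assume mf: "piecewise_flat_manifold n K" and pn: "positive_normals n K \<nu>" and tess: "dual_tessellation n K V"
    and h: "h \<in> hinges n K" and lines: "orthogonal_lines n K V h \<gamma> I" and A: "A = hinge_region K V h \<gamma> I"
    and rb: "region_bounded_by n K A h \<gamma> I N D"
    and \<theta>: "\<forall>f \<in> hinges_meeting n K A - {h}. crossing_angle n K V h \<gamma> I f (\<theta> f)"
    and ang: "\<forall>f \<in> hinges_meeting n K A. \<bar>hinge_angle n K \<nu> f\<bar> \<le> e" and e\<delta>: "e < 1 / (2 * cosine_const N)"
  interpret flat_manifold n K \<nu> by standard (use assms mf pn in auto)
  obtain \<tau>0 where \<tau>0: "h \<subseteq> \<tau>0" "\<tau>0 \<in> top_simplices n K"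
    using mf hinge_in(1)[OF h] unfolding piecewise_flat_manifold_def by blast
  then have sides: "adjacent_at n K h (other h \<tau>0) \<tau>0" using adjacent_sym[OF adjacent_other] h by blast
  have "rel_interior h \<subseteq> A" using lines A by (simp add: orthogonal_lines_def)
  then have "h \<in> hinges_meeting n K A" using ri_hinge_nonempty[OF h] h by (auto simp: hinges_meeting_def)
  \<comment> \<open>The hinge \<open>h\<close> itself meets the region, so \<open>e\<close> bounds
    an absolute value and is nonnegative.\<close>
  then have e0: "0 \<le> e" using ang by fastforce
  have eK: "2 * (cosine_const N * e) < 1" using e\<delta> cosine_const by (simp add: field_simps)
  have "1 * e \<le> cosine_const N * e" using cosine_const e0 by (intro mult_right_mono)
  then have e1: "e < 1" using eK e0 by linarith
  have "cosine_const N * e\<^sup>2 \<le> cosine_const N * e" using e0 e1 cosine_const by (simp add: power2_eq_square mult_left_le)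
  then have e2: "2 * (cosine_const N * e\<^sup>2) < 1" using eK by linarith
  have "direction_const N * e\<^sup>2 \<le> cosine_const N * e\<^sup>2" using cosine_const by (intro mult_right_mono) auto
  then have e3: "2 * (direction_const N * e\<^sup>2) \<le> 1" using e2 by linarith
  have "0 \<le> cosine_const N * e\<^sup>2" using cosine_const by simp
  then have e4: "cosine_const N * e\<^sup>2 < 1" using e2 by linarith
  interpret hinge_lines n K \<nu> V h \<gamma> I N D e "other h \<tau>0" \<tau>0 A "hinges_meeting n K A" "vertex_regions_of K V h"
    by standard (use tess lines A rb ang sides e0 e1 e3 e4 in auto)
  \<comment> \<open>The error is taken before division by the volume of the region, so no lower
    bound on that volume enters.\<close>
  define R where "R = (LINT x:rel_interior h|flat_measure h. segment_curvature n K \<nu> A (\<gamma> x) (I x))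
      - (measure (flat_measure h) (rel_interior h) * hinge_angle n K \<nu> h
        + (\<Sum>f\<in>hinges_meeting n K A - {h}. measure (flat_measure f) (rel_interior f \<inter> A) * (cos (\<theta> f))\<^sup>2 * hinge_angle n K \<nu> f))"
  have "\<bar>R\<bar> \<le> real N * hinge_const n N D * e ^ 3"
    unfolding R_def using \<theta> by (intro integral_estimate) blast
  moreover have "average_curvature n K \<nu> V h \<gamma> I =
      1 / enn2real (surface_volume n K A) *
        (measure (flat_measure h) (rel_interior h) * hinge_angle n K \<nu> h
         + (\<Sum>f \<in> hinges_meeting n K A - {h}. measure (flat_measure f) (rel_interior f \<inter> A) * (cos (\<theta> f))\<^sup>2 * hinge_angle n K \<nu> f)
         + R)"
    unfolding average_curvature_def Let_def A[symmetric] R_def by simp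
  ultimately show "\<exists>R. \<bar>R\<bar> \<le> real N * hinge_const n N D * e ^ 3 \<and>
      average_curvature n K \<nu> V h \<gamma> I =
      1 / enn2real (surface_volume n K A) *
        (measure (flat_measure h) (rel_interior h) * hinge_angle n K \<nu> h
         + (\<Sum>f \<in> hinges_meeting n K A - {h}. measure (flat_measure f) (rel_interior f \<inter> A) * (cos (\<theta> f))\<^sup>2 * hinge_angle n K \<nu> f)
         + R)" by blast
qed

end
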